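(* Given nested Bratteli diagrams $\mathfrak B_{\mathcal A,\mathcal E,M}\le\mathfrak B_{\widehat{\mathcal A},\widehat{\mathcal E},\widehat M}$ with bounded alphabet size, let $\nu$ be an ergodic $\mathcal{FC}$-invariant Borel measure on the adic tower $\Sigma_{\widehat M/M}^{0,+}$. Then: (i) The restriction $\nu_M$ of $\nu$ to $\Sigma_M^{0,+}$ is a positive ergodic invariant Borel measure, whose tower extension $\widehat\nu_M$ equals $\nu$. The measure $\nu$ is positive finite on some open set of the tower iff $\nu_M$ is positive finite on some open set of $\Sigma_M^{0,+}$. In this case there exists $A$ primitive with $A\le M\le\widehat M$ such that $\nu_A$ is positive finite, with $\nu$ the tower extension $\widehat\nu_A$. (ii) If $\nu$ (ergodic invariant on the tower) is positive finite on $\Sigma_A^{0,+}$ for some $A\le\widehat M$, then $A\le M$ and there exists a unique $\mathbf w\in\mathrm{Ext}\,\mathcal V_A$ such that $\nu_A=\nu_{\mathbf w}$, with $\nu$ the tower measure over $\nu_{\mathbf w}$ on $\Sigma_A^{0,+}$. Furthermore $\nu$ has finite total mass iff $\mathbf w$ is $\widehat M/A$-distinguished. There exist $A_0\le A$ primitive and $\mathbf w\in\mathrm{Ext}\,\mathcal V_{A_0}$ such that $\nu$ is the tower measure over $\nu_{\mathbf w}$ on $\Sigma_{A_0}^{0,+}$, with $\nu$ finite iff $\mathbf w$ is $\widehat M/A_0$-distinguished.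
   Context: **Diagrams.** A Bratteli diagram is given by finite alphabets $\widehat{\mathcal A}_i$ and a sequence $\widehat M=(\widehat M_i)_{i\ge0}$ of nonnegative integer matrices, rows indexed by $\widehat{\mathcal A}_i$, columns by $\widehat{\mathcal A}_{i+1}$; there are $(\widehat M_i)_{ab}$ edges $e\in\widehat{\mathcal E}_i$ from $e^-=a$ to $e^+=b$. Bounded alphabet size: $\sup_i\#\widehat{\mathcal A}_i<\infty$. $\Sigma_{\widehat M}^{0,+}$ is the space of edge paths $e=(.e_0e_1\dots)$, $e_i^+=e_{i+1}^-$, with the topology from $\prod_i\widehat{\mathcal E}_i$; thin cylinders are $[.e_0\dots e_n]=\{\tilde e:\tilde e_i=e_i,0\le i\le n\}$. $M\le\widehat M$ (nested diagrams) means $\mathcal A_i\subseteq\widehat{\mathcal A}_i$ and $(M_i)_{ab}\le(\widehat M_i)_{ab}$; edge sets are nested, $\mathcal E_i\subseteq\widehat{\mathcal E}_i$, so $\Sigma_M^{0,+}\subseteq\Sigma_{\widehat M}^{0,+}$. Primitive: for every $k$ there is $n>k$ with $M_k\cdots M_n$ strictly positive. **Tower.** $\Sigma_{\widehat M/M}^{0,+}=\bigcup_m\Sigma_{M^{(m)}}^{0,+}$ where $\Sigma_{M^{(m)}}^{0,+}$ is the set of paths in $\Sigma_{\widehat M}^{0,+}$ with $e_i\in\mathcal E_i$ for all $i>m$; it carries the direct limit topology. **Group and measures.** $\mathcal{FC}_M$ is the group of homeomorphisms of $\Sigma_M^{0,+}$ generated by the involutions interchanging two thin cylinders $[.e_0\dots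 e_n]$, $[.f_0\dots f_n]$ with $e_n^+=f_n^+$, leaving tails unchanged and fixing all other points. On the tower, $\mathcal{FC}$ means $\mathcal{FC}_{\widehat M}$ acting by restriction. Borel measures may be infinite; ergodic: every invariant Borel set or its complement has measure zero. For $A\le\widehat M$, $\nu_A$ is the restriction to $\Sigma_A^{0,+}$ of $\nu$ (extended by zero outside the tower $\Sigma_{\widehat M/M}^{0,+}$). The tower extension (tower measure) of an $\mathcal{FC}_A$-invariant Borel measure on $\Sigma_A^{0,+}$ is the unique $\mathcal{FC}_{\widehat M}$-invariant Borel measure on the tower $\Sigma_{\widehat M/A}^{0,+}$ restricting to it (extended by zero outside). **Eigenvector sequences.** For a nonnegative matrix sequence $A$ with alphabets $\mathcal A_i$: $\mathcal V_A^{\mathbf 0}$ is the convex cone of $\mathbf w=(\mathbf w_i)_{i\ge0}$, $\mathbf w_i\in\mathbb R^{\mathcal A_i}$, $\mathbf w_i\ge0$, $\mathbf w_i=A_i\mathbf w_{i+1}$; $\mathcal V_A$ is the set of those with $\mathbf w_i\neq\mathbf 0$ for all $i$; $\mathrm{Ext}\,\mathcal V_A$ is the set of nonzero elements of extreme rays of $\mathcal V_A^{\mathbf 0}$. For $\mathbf w\in\mathcal V_A$, $\nu_{\mathbf w}$ is the Borel measure on $\Sigma_A^{0,+}$ with $\nu_{\mathbf w}([.e_0\dots e_{n-1}])=(\mathbf w_n)_s$, $s=e_{n-1}^+$. For $A\le\widehat M$, $\mathbf w\in\mathcal V_A$ is $\widehat M/A$-distinguished if $\lim_{m\to\infty}\widehat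 M^m(\mathtt e(\mathbf w))$ exists, where $\mathtt e$ fills in zeros and $(\widehat M^m\mathbf v)_i=\widehat M_i\cdots\widehat M_{i+m-1}\mathbf v_{i+m}$.
   Formalization: ν is taken nonzero; all diagrams are column-reduced (every symbol of level ≥1 has an incoming edge); the false clause "then A ≤ M" becomes: some A' ≤ M, with edges eventually inside those of A, has ν positive finite on its path space; the rest of (ii) holds for every such A ≤ M̂. *)

theory Defs
  imports "HOL-Analysis.Analysis"
begin

section \<open>Bratteli diagrams\<close>

record ('a, 'e) diagram =
  alph :: "nat \<Rightarrow> 'a set"
  edges :: "nat \<Rightarrow> 'e set"
  src :: "nat \<Rightarrow> 'e \<Rightarrow> 'a"
  tgt :: "nat \<Rightarrow> 'e \<Rightarrow> 'a"

text \<open>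
  The equation for \<open>tgt\<close> contains the usual requirement on Bratteli diagrams that every symbol of
  level at least 1 has an incoming edge (the matrices are column-reduced). No outgoing edges are
  required.
\<close>

definition bratteli :: "('a, 'e) diagram \<Rightarrow> bool" where
  "bratteli D \<longleftrightarrow> (\<forall>i. finite (alph D i) \<and> finite (edges D i)
      \<and> src D i ` edges D i \<subseteq> alph D i \<and> tgt D i ` edges D i = alph D (Suc i))"

definition bounded_alphabet :: "('a, 'e) diagram \<Rightarrow> bool" where
  "bounded_alphabet D \<longleftrightarrow> (\<exists>N. \<forall>i. card (alph D i) \<le> N)"

text \<open>The matrices are read off from the edges; rows are indexed by \<open>alph D i\<close>, columns by
  \<open>alph D (Suc i)\<close>.\<close>

definition mat :: "('a, 'e) diagram \<Rightarrow> nat \<Rightarrow> 'a \<Rightarrow> 'a \<Rightarrow> nat" where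
  "mat D i a b = card {e \<in> edges D i. src D i e = a \<and> tgt D i e = b}"

text \<open>\<open>mprod D k m\<close> is the product of the \<open>m\<close> matrices of levels \<open>k, \<dots>, k + m - 1\<close>.\<close>

fun mprod :: "('a, 'e) diagram \<Rightarrow> nat \<Rightarrow> nat \<Rightarrow> 'a \<Rightarrow> 'a \<Rightarrow> nat" where
  "mprod D k 0 a b = (if a = b then 1 else 0)"
| "mprod D k (Suc m) a b = (\<Sum>c\<in>alph D (Suc k). mat D k a c * mprod D (Suc k) m c b)"

definition primitive :: "('a, 'e) diagram \<Rightarrow> bool" where
  "primitive D \<longleftrightarrow> (\<forall>k. \<exists>n>k. \<forall>a\<in>alph D k. \<forall>b\<in>alph D (Suc n). mprod D k (Suc n - k) a b > 0)"

definition nested :: "('a, 'e) diagram \<Rightarrow> ('a, 'e) diagram \<Rightarrow> bool" (infix "\<preceq>" 50) where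
  "D \<preceq> D' \<longleftrightarrow> (\<forall>i. alph D i \<subseteq> alph D' i \<and> edges D i \<subseteq> edges D' i
      \<and> (\<forall>e\<in>edges D i. src D i e = src D' i e \<and> tgt D i e = tgt D' i e))"

lemma nested_mat_le:
  assumes "bratteli D'" "D \<preceq> D'"
  shows "mat D i a b \<le> mat D' i a b"
  unfolding mat_def
  by (rule card_mono) (use assms in \<open>auto simp: bratteli_def nested_def subset_iff\<close>)

section \<open>Path spaces and towers\<close>

definition paths :: "('a, 'e) diagram \<Rightarrow> (nat \<Rightarrow> 'e) set" where
  "paths D = {x. \<forall>i. x i \<in> edges D i \<and> tgt D i (x i) = src D (Suc i) (x (Suc i))}"

definition path_top :: "('a, 'e) diagram \<Rightarrow> (nat \<Rightarrow> 'e) topology" where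
  "path_top D =
     subtopology (product_topology (\<lambda>i. discrete_topology (edges D i)) UNIV) (paths D)"

text \<open>In the following, \<open>H\<close> is the larger diagram, and \<open>stage_paths H D m\<close> is the path space of
  \<open>D\<^sup>(\<^sup>m\<^sup>)\<close>.\<close>

definition stage_paths :: "('a, 'e) diagram \<Rightarrow> ('a, 'e) diagram \<Rightarrow> nat \<Rightarrow> (nat \<Rightarrow> 'e) set" where
  "stage_paths H D m = {x \<in> paths H. \<forall>i>m. x i \<in> edges D i}"

definition tower_paths :: "('a, 'e) diagram \<Rightarrow> ('a, 'e) diagram \<Rightarrow> (nat \<Rightarrow> 'e) set" where
  "tower_paths H D = (\<Union>m. stage_paths H D m)"

text \<open>The direct limit topology.\<close>

definition tower_top :: "('a, 'e) diagram \<Rightarrow> ('a, 'e) diagram \<Rightarrow> (nat \<Rightarrow> 'e) topology" where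
  "tower_top H D = topology (\<lambda>U. U \<subseteq> tower_paths H D \<and>
     (\<forall>m. openin (subtopology (path_top H) (stage_paths H D m)) (U \<inter> stage_paths H D m)))"

lemma openin_tower_top:
  "openin (tower_top H D) U \<longleftrightarrow> U \<subseteq> tower_paths H D \<and>
     (\<forall>m. openin (subtopology (path_top H) (stage_paths H D m)) (U \<inter> stage_paths H D m))"
proof -
  have "istopology (\<lambda>U. U \<subseteq> tower_paths H D \<and>
     (\<forall>m. openin (subtopology (path_top H) (stage_paths H D m)) (U \<inter> stage_paths H D m)))"
    (is "istopology ?P")
    unfolding istopology_def
  proof (intro conjI allI impI)
    fix S T assume S: "?P S" and T: "?P T"
    show "S \<inter> T \<subseteq> tower_paths H D" using S by auto
    fix m
    have "S \<inter> T \<inter> stage_paths H D m = (S \<inter> stage_paths H D m) \<inter> (T \<inter> stage_paths H D m)"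
      by auto
    then show "openin (subtopology (path_top H) (stage_paths H D m)) (S \<inter> T \<inter> stage_paths H D m)"
      using S T openin_Int by metis
  next
    fix \<K> assume K: "\<forall>K\<in>\<K>. ?P K"
    show "\<Union>\<K> \<subseteq> tower_paths H D" using K by auto
    fix m
    have "\<Union>\<K> \<inter> stage_paths H D m = (\<Union>K\<in>\<K>. K \<inter> stage_paths H D m)"
      by auto
    then show "openin (subtopology (path_top H) (stage_paths H D m)) (\<Union>\<K> \<inter> stage_paths H D m)"
      using K by (metis (mono_tags, lifting) image_iff openin_Union)
  qed
  then show ?thesis
    unfolding tower_top_def by (simp add: topology_inverse')
qed

section \<open>The group of finite coordinate changes\<close>

definition finite_path :: "('a, 'e) diagram \<Rightarrow> 'e list \<Rightarrow> bool" where
  "finite_path D u \<longleftrightarrow> (\<forall>i<length u. u ! i \<in> edges D i) \<and>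
     (\<forall>i. Suc i < length u \<longrightarrow> tgt D i (u ! i) = src D (Suc i) (u ! Suc i))"

definition end_symbol :: "('a, 'e) diagram \<Rightarrow> 'e list \<Rightarrow> 'a" where
  "end_symbol D u = tgt D (length u - 1) (last u)"

definition thin_cylinder :: "('a, 'e) diagram \<Rightarrow> 'e list \<Rightarrow> (nat \<Rightarrow> 'e) set" where
  "thin_cylinder D u = {x \<in> paths D. \<forall>i<length u. x i = u ! i}"

definition replace_start :: "'e list \<Rightarrow> (nat \<Rightarrow> 'e) \<Rightarrow> nat \<Rightarrow> 'e" where
  "replace_start u x = (\<lambda>i. if i < length u then u ! i else x i)"

definition swap :: "('a, 'e) diagram \<Rightarrow> 'e list \<Rightarrow> 'e list \<Rightarrow> (nat \<Rightarrow> 'e) \<Rightarrow> nat \<Rightarrow> 'e" where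
  "swap D u v x = (if x \<in> thin_cylinder D u then replace_start v x
     else if x \<in> thin_cylinder D v then replace_start u x else x)"

text \<open>The elements of the group are functions on all edge sequences that are the identity off
  \<open>paths D\<close>. The generators are involutions, so closure under composition already gives the
  generated group.\<close>

inductive_set FC :: "('a, 'e) diagram \<Rightarrow> ((nat \<Rightarrow> 'e) \<Rightarrow> nat \<Rightarrow> 'e) set" for D where
  id: "id \<in> FC D"
| comp: "\<lbrakk>g \<in> FC D; finite_path D u; finite_path D v; u \<noteq> []; length u = length v;
    end_symbol D u = end_symbol D v\<rbrakk> \<Longrightarrow> swap D u v \<circ> g \<in> FC D"

section \<open>Invariant Borel measures\<close>

definition borel_of :: "'x topology \<Rightarrow> 'x measure" where
  "borel_of X = sigma (topspace X) {U. openin X U}"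

definition invariant_measure ::
    "('a, 'e) diagram \<Rightarrow> (nat \<Rightarrow> 'e) topology \<Rightarrow> (nat \<Rightarrow> 'e) measure \<Rightarrow> bool" where
  "invariant_measure D X \<mu> \<longleftrightarrow> sets \<mu> = sets (borel_of X)
     \<and> (\<forall>g\<in>FC D. \<forall>B\<in>sets \<mu>. emeasure \<mu> (g ` B) = emeasure \<mu> B)"

definition ergodic_invariant_measure ::
    "('a, 'e) diagram \<Rightarrow> (nat \<Rightarrow> 'e) topology \<Rightarrow> (nat \<Rightarrow> 'e) measure \<Rightarrow> bool" where
  "ergodic_invariant_measure D X \<mu> \<longleftrightarrow> invariant_measure D X \<mu>
     \<and> (\<forall>B\<in>sets \<mu>. (\<forall>g\<in>FC D. g ` B = B) \<longrightarrow> emeasure \<mu> B = 0 \<or> emeasure \<mu> (space \<mu> - B) = 0)"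

definition positive_finite_on :: "'x measure \<Rightarrow> 'x set \<Rightarrow> bool" where
  "positive_finite_on \<mu> B \<longleftrightarrow> 0 < emeasure \<mu> B \<and> emeasure \<mu> B < \<infinity>"

text \<open>The restriction of a measure to the path space of \<open>A\<close>, extended by zero to the part of that
  space outside \<open>space \<nu>\<close>. With the larger diagram in place of \<open>A\<close>, this is the extension of \<open>\<nu>\<close> by
  zero to the whole ambient path space.\<close>

definition restr :: "('a, 'e) diagram \<Rightarrow> (nat \<Rightarrow> 'e) measure \<Rightarrow> (nat \<Rightarrow> 'e) measure" where
  "restr A \<nu> =
     measure_of (paths A) (sets (borel_of (path_top A))) (\<lambda>B. emeasure \<nu> (B \<inter> space \<nu>))"

definition tower_extension ::
    "('a, 'e) diagram \<Rightarrow> ('a, 'e) diagram \<Rightarrow> (nat \<Rightarrow> 'e) measure \<Rightarrow> (nat \<Rightarrow> 'e) measure" where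
  "tower_extension H A \<mu> =
     (THE \<rho>. invariant_measure H (tower_top H A) \<rho> \<and> restr A \<rho> = \<mu>)"

text \<open>\<open>\<nu>\<close> is the tower measure over \<open>\<mu>\<close>: \<open>\<nu>\<close> and the tower extension may live on different towers,
  so they are compared after extension by zero.\<close>

definition is_tower_measure_over ::
    "('a, 'e) diagram \<Rightarrow> ('a, 'e) diagram \<Rightarrow> (nat \<Rightarrow> 'e) measure \<Rightarrow> (nat \<Rightarrow> 'e) measure \<Rightarrow> bool" where
  "is_tower_measure_over H A \<mu> \<nu> \<longleftrightarrow> restr H \<nu> = restr H (tower_extension H A \<mu>)"

section \<open>Eigenvector sequences\<close>

text \<open>Vectors indexed by \<open>alph D i\<close> are functions vanishing off \<open>alph D i\<close>. Hence filling in zeros,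
  i.e. passing to the alphabets of a larger diagram, does not change the function.\<close>

definition V0 :: "('a, 'e) diagram \<Rightarrow> (nat \<Rightarrow> 'a \<Rightarrow> real) set" where
  "V0 D = {w. (\<forall>i. \<forall>a. a \<notin> alph D i \<longrightarrow> w i a = 0) \<and> (\<forall>i. \<forall>a\<in>alph D i. w i a \<ge> 0)
     \<and> (\<forall>i. \<forall>a\<in>alph D i. w i a = (\<Sum>b\<in>alph D (Suc i). real (mat D i a b) * w (Suc i) b))}"

definition V :: "('a, 'e) diagram \<Rightarrow> (nat \<Rightarrow> 'a \<Rightarrow> real) set" where
  "V D = {w \<in> V0 D. \<forall>i. \<exists>a\<in>alph D i. w i a \<noteq> 0}"

definition ray :: "(nat \<Rightarrow> 'a \<Rightarrow> real) \<Rightarrow> (nat \<Rightarrow> 'a \<Rightarrow> real) set" where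
  "ray w = {(\<lambda>i a. t * w i a) | t. t \<ge> 0}"

definition ExtV :: "('a, 'e) diagram \<Rightarrow> (nat \<Rightarrow> 'a \<Rightarrow> real) set" where
  "ExtV D = {w \<in> V0 D. w \<noteq> (\<lambda>i a. 0) \<and>
     (\<forall>u\<in>V0 D. \<forall>v\<in>V0 D. (\<lambda>i a. u i a + v i a) \<in> ray w \<longrightarrow> u \<in> ray w \<and> v \<in> ray w)}"

text \<open>\<open>is_eigen_measure D w \<mu>\<close> says \<open>\<mu> = \<nu>\<^sub>w\<close>: the values on thin cylinders determine the Borel
  measure.\<close>

definition is_eigen_measure ::
    "('a, 'e) diagram \<Rightarrow> (nat \<Rightarrow> 'a \<Rightarrow> real) \<Rightarrow> (nat \<Rightarrow> 'e) measure \<Rightarrow> bool" where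
  "is_eigen_measure D w \<mu> \<longleftrightarrow> w \<in> V D \<and> sets \<mu> = sets (borel_of (path_top D)) \<and>
     (\<forall>u. finite_path D u \<and> u \<noteq> [] \<longrightarrow>
        emeasure \<mu> (thin_cylinder D u) = ennreal (w (length u) (end_symbol D u)))"

definition mat_pow ::
    "('a, 'e) diagram \<Rightarrow> nat \<Rightarrow> (nat \<Rightarrow> 'a \<Rightarrow> real) \<Rightarrow> nat \<Rightarrow> 'a \<Rightarrow> real" where
  "mat_pow D m v i a = (\<Sum>b\<in>alph D (i + m). real (mprod D i m a b) * v (i + m) b)"

definition distinguished ::
    "('a, 'e) diagram \<Rightarrow> ('a, 'e) diagram \<Rightarrow> (nat \<Rightarrow> 'a \<Rightarrow> real) \<Rightarrow> bool" where
  "distinguished H A w \<longleftrightarrow> w \<in> V A \<and> (\<forall>i. \<forall>a\<in>alph H i. convergent (\<lambda>m. mat_pow H m w i a))"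

end

theory Submission
  imports Defs
begin

text \<open>
  Invariance of a measure can be tested on pairs of finite paths \<open>p\<close>, \<open>q\<close> with the same length and
  the same end symbol: the part of a set in \<open>[p]\<close> and its copy in \<open>[q]\<close> have the same measure. The orbits
  of the group are the classes of tail equivalence, and its invariant sets are the tail-saturated
  ones. The tower over a diagram is the saturation of its path space, because every symbol of
  positive level is the end of a finite path of the diagram. To compare measures on path spaces
  and on towers, all are extended by zero to the space of all edge sequences (\<open>ext_zero\<close>).

  A saturation \<open>saturation D Y\<close> is a countable union of pieces that swaps carry into \<open>Y\<close>. So an inequality
  between two invariant measures on \<open>Y\<close> extends to the saturation (\<open>saturation_emeasure_le\<close>). This
  gives uniqueness of tower extensions (\<open>tower_extension_restrict\<close>) and shows that the base of a
  tower of positive measure has positive measure. An invariant subset of a path space is the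
  trace of its saturation, so restrictions of an ergodic measure are ergodic
  (\<open>swap_ergodic_nested\<close>); and a path space of positive measure has a conull tower, so the measure is
  the tower measure over its restriction (\<open>is_tower_measure_over_restr\<close>).

  The primitive subdiagram (\<open>primitive_core\<close>) comes from a minimality argument. Among the subdiagrams
  whose path spaces have positive measure take one whose alphabets have the least size that can
  occur infinitely often, and remove the symbols with null cylinders. If some symbol failed to reach
  all symbols at infinitely many of the levels of least size, the paths through it would still have
  positive measure, in a subdiagram with fewer symbols at these levels.

  The measures of cylinders that end at a symbol are the entries of the eigenvector sequence.
  It lies on an extreme ray: if \<open>u + v = t w\<close> with \<open>u\<close>, \<open>v\<close> in the cone, then \<open>u\<close> belongs to a measure
  (\<open>eigen_measure_exists\<close>) that is invariant and dominated by a multiple of the given one. The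
  saturation of a Hahn set of the difference of two invariant measures is again a Hahn set, so
  ergodicity makes the two proportional (\<open>ergodic_dominated_proportional\<close>).

  Finally, \<open>mat_pow H m w i a\<close> is the measure of the paths that start with a fixed path of the large
  diagram ending at \<open>a\<close> in level \<open>i\<close> and have their edges in \<open>A\<close> from level \<open>i + m\<close> on
  (\<open>mat_pow_eq_emeasure\<close>). These measures increase to those of the cylinders of the large diagram,
  and hence all the limits exist iff the total mass is finite (\<open>distinguished_iff_finite\<close>).
\<close>

section \<open>Paths, finite paths and tail equivalence\<close>

lemma paths_edge: "x \<in> paths D \<Longrightarrow> x i \<in> edges D i"
  by (simp add: paths_def)

lemma bratteli_src: "bratteli D \<Longrightarrow> e \<in> edges D i \<Longrightarrow> src D i e \<in> alph D i"
  unfolding bratteli_def by (meson image_subset_iff)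

lemma bratteli_tgt: "bratteli D \<Longrightarrow> e \<in> edges D i \<Longrightarrow> tgt D i e \<in> alph D (Suc i)"
  unfolding bratteli_def by (metis imageI)

lemma bratteli_incoming: "bratteli D \<Longrightarrow> b \<in> alph D (Suc i) \<Longrightarrow> \<exists>e\<in>edges D i. tgt D i e = b"
  unfolding bratteli_def by (metis imageE)

lemma bratteli_finite: "bratteli D \<Longrightarrow> finite (alph D i)" "bratteli D \<Longrightarrow> finite (edges D i)"
  by (simp_all add: bratteli_def)

lemma nested_edge: "D \<preceq> D' \<Longrightarrow> e \<in> edges D i \<Longrightarrow> e \<in> edges D' i"
  and nested_alph: "D \<preceq> D' \<Longrightarrow> a \<in> alph D i \<Longrightarrow> a \<in> alph D' i"
  and nested_src: "D \<preceq> D' \<Longrightarrow> e \<in> edges D i \<Longrightarrow> src D' i e = src D i e"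
  and nested_tgt: "D \<preceq> D' \<Longrightarrow> e \<in> edges D i \<Longrightarrow> tgt D' i e = tgt D i e"
  unfolding nested_def by auto

lemma nested_refl: "D \<preceq> D"
  unfolding nested_def by auto

lemma nested_trans: "D \<preceq> D' \<Longrightarrow> D' \<preceq> D'' \<Longrightarrow> D \<preceq> D''"
  unfolding nested_def by (auto simp: subset_iff)

lemma nested_paths_iff:
  assumes "D \<preceq> D'" shows "x \<in> paths D \<longleftrightarrow> x \<in> paths D' \<and> (\<forall>i. x i \<in> edges D i)"
  using nested_edge[OF assms] nested_src[OF assms] nested_tgt[OF assms]
  unfolding paths_def by auto

lemma nested_paths: "D \<preceq> D' \<Longrightarrow> x \<in> paths D \<Longrightarrow> x \<in> paths D'"
  by (simp add: nested_paths_iff)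

lemma end_symbol_nth: "u \<noteq> [] \<Longrightarrow> end_symbol D u = tgt D (length u - 1) (u ! (length u - 1))"
  by (simp add: end_symbol_def last_conv_nth)

lemma end_symbol_snoc: "end_symbol D (u @ [e]) = tgt D (length u) e"
  by (simp add: end_symbol_def)

lemma finite_path_nested:
  assumes "D \<preceq> D'" "finite_path D u" shows "finite_path D' u"
  using assms nested_edge[OF assms(1)] nested_src[OF assms(1)] nested_tgt[OF assms(1)]
  unfolding finite_path_def by (metis Suc_lessD)

lemma end_symbol_nested:
  assumes "D \<preceq> D'" "finite_path D u" "u \<noteq> []" shows "end_symbol D' u = end_symbol D u"
  using assms nested_tgt[OF assms(1)] by (auto simp: end_symbol_nth finite_path_def)

lemma finite_path_snoc:
  assumes "u \<noteq> []"
  shows "finite_path D (u @ [e]) \<longleftrightarrow>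
    finite_path D u \<and> e \<in> edges D (length u) \<and> end_symbol D u = src D (length u) e"
proof
  assume f: "finite_path D (u @ [e])"
  have "tgt D (length u - 1) ((u @ [e]) ! (length u - 1)) = src D (Suc (length u - 1)) ((u @ [e]) ! Suc (length u - 1))"
    using f assms unfolding finite_path_def by (metis One_nat_def Suc_pred length_append_singleton length_greater_0_conv lessI)
  moreover have "(u @ [e]) ! i = u ! i" if "i < length u" for i using that by (simp add: nth_append)
  ultimately show "finite_path D u \<and> e \<in> edges D (length u) \<and> end_symbol D u = src D (length u) e"
    using f assms unfolding finite_path_def
    by (auto simp: end_symbol_nth) (metis Suc_lessD less_SucI nth_append nth_append_length lessI)+
next
  assume r: "finite_path D u \<and> e \<in> edges D (length u) \<and> end_symbol D u = src D (length u) e"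
  show "finite_path D (u @ [e])"
    unfolding finite_path_def
  proof (intro conjI allI impI)
    fix i assume "Suc i < length (u @ [e])"
    then consider "Suc i < length u" | "Suc i = length u" by fastforce
    then show "tgt D i ((u @ [e]) ! i) = src D (Suc i) ((u @ [e]) ! Suc i)"
    proof cases
      case 2
      then have "i = length u - 1" by simp
      then show ?thesis using r 2 assms by (auto simp: nth_append end_symbol_nth)
    qed (use r in \<open>auto simp: finite_path_def nth_append\<close>)
  qed (use r in \<open>auto simp: finite_path_def nth_append less_Suc_eq\<close>)
qed

lemma finite_path_single: "finite_path D [e] \<longleftrightarrow> e \<in> edges D 0"
  by (auto simp: finite_path_def)

lemma end_symbol_alph:
  assumes "bratteli D" "finite_path D u" "u \<noteq> []" shows "end_symbol D u \<in> alph D (length u)"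
  using assms bratteli_tgt[OF assms(1), of "u ! (length u - 1)" "length u - 1"]
  by (auto simp: end_symbol_nth finite_path_def)

text \<open>Column-reducedness is what makes every symbol of positive level the end of a path that starts
  at level 0; this is why a tower is the tail saturation of its base.\<close>

lemma finite_path_to_symbol:
  assumes D: "bratteli D" and "n > 0" "a \<in> alph D n"
  shows "\<exists>u. finite_path D u \<and> length u = n \<and> end_symbol D u = a"
  using assms(2,3)
proof (induction n arbitrary: a)
  case (Suc n)
  obtain e where e: "e \<in> edges D n" "tgt D n e = a" using bratteli_incoming[OF D Suc.prems(2)] by auto
  show ?case
  proof (cases "n = 0")
    case True
    then show ?thesis using e by (intro exI[of _ "[e]"]) (simp add: finite_path_single end_symbol_def)
  next
    case False
    then obtain u where "finite_path D u" "length u = n" "end_symbol D u = src D n e"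
      using Suc.IH bratteli_src[OF D e(1)] by blast
    then show ?thesis using e False
      by (intro exI[of _ "u @ [e]"]) (auto simp: finite_path_snoc end_symbol_snoc)
  qed
qed simp

lemma finite_finite_paths:
  assumes "bratteli D" shows "finite {u. finite_path D u \<and> length u = n}"
proof -
  have "{u. finite_path D u \<and> length u = n} \<subseteq> {u. set u \<subseteq> (\<Union>i<n. edges D i) \<and> length u = n}"
    by (fastforce simp: finite_path_def in_set_conv_nth)
  moreover have "finite (\<Union>i<n. edges D i)" using bratteli_finite(2)[OF assms] by auto
  ultimately show ?thesis using finite_lists_length_eq finite_subset by blast
qed

lemma countable_finite_paths:
  assumes "bratteli D" shows "countable {u. finite_path D u}"
proof -
  have "{u. finite_path D u} = (\<Union>n. {u. finite_path D u \<and> length u = n})" by auto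
  then show ?thesis using finite_finite_paths[OF assms] by (simp add: countable_finite)
qed

lemma thin_cylinder_iff: "x \<in> thin_cylinder D u \<longleftrightarrow> x \<in> paths D \<and> map x [0..<length u] = u"
proof -
  have "map x [0..<length u] = u \<longleftrightarrow> (\<forall>i<length u. x i = u ! i)"
    by (subst list_eq_iff_nth_eq) simp
  then show ?thesis by (simp add: thin_cylinder_def)
qed

lemma thin_cylinder_subset: "thin_cylinder D u \<subseteq> paths D"
  by (auto simp: thin_cylinder_def)

lemma finite_path_prefix: "x \<in> paths D \<Longrightarrow> finite_path D (map x [0..<n])"
  by (auto simp: finite_path_def paths_def)

lemma in_prefix_cylinder: "x \<in> paths D \<Longrightarrow> x \<in> thin_cylinder D (map x [0..<n])"
  by (auto simp: thin_cylinder_def)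

lemma end_symbol_prefix: "x \<in> paths D \<Longrightarrow> n > 0 \<Longrightarrow> end_symbol D (map x [0..<n]) = src D n (x n)"
  by (cases n) (auto simp: end_symbol_nth paths_def simp del: upt_Suc)

lemma end_symbol_cylinder:
  "x \<in> thin_cylinder D u \<Longrightarrow> u \<noteq> [] \<Longrightarrow> end_symbol D u = src D (length u) (x (length u))"
  by (metis end_symbol_prefix length_greater_0_conv thin_cylinder_iff)

lemma nested_thin_cylinder:
  assumes "D \<preceq> D'" shows "thin_cylinder D u = thin_cylinder D' u \<inter> paths D"
  using nested_paths[OF assms] by (auto simp: thin_cylinder_def)

lemma thin_cylinder_snoc:
  assumes "u \<noteq> []"
  shows "thin_cylinder D u =
    (\<Union>e\<in>{e \<in> edges D (length u). src D (length u) e = end_symbol D u}. thin_cylinder D (u @ [e]))"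
    (is "?L = ?R")
proof
  show "?L \<subseteq> ?R"
  proof
    fix x assume x: "x \<in> ?L"
    then have "x \<in> thin_cylinder D (u @ [x (length u)])"
      by (auto simp: thin_cylinder_def nth_append less_Suc_eq)
    moreover have "x (length u) \<in> edges D (length u)"
      using x thin_cylinder_subset paths_edge by blast
    ultimately show "x \<in> ?R" using end_symbol_cylinder[OF x assms] by auto
  qed
  show "?R \<subseteq> ?L"
    by (force simp: thin_cylinder_def nth_append)
qed

definition swappable :: "('a, 'e) diagram \<Rightarrow> 'e list \<Rightarrow> 'e list \<Rightarrow> bool" where
  "swappable D p q \<longleftrightarrow> finite_path D p \<and> finite_path D q \<and> p \<noteq> [] \<and> length p = length q
     \<and> end_symbol D p = end_symbol D q"

lemma swappable_sym: "swappable D p q \<Longrightarrow> swappable D q p"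
  by (auto simp: swappable_def)

lemma swappable_nested: "D \<preceq> D' \<Longrightarrow> swappable D p q \<Longrightarrow> swappable D' p q"
  unfolding swappable_def by (metis end_symbol_nested finite_path_nested length_0_conv)

lemma replace_start_in_cylinder:
  assumes s: "swappable D p q" and x: "x \<in> thin_cylinder D p"
  shows "replace_start q x \<in> thin_cylinder D q"
proof -
  have l: "length p = length q" and q: "q \<noteq> []" using s by (auto simp: swappable_def)
  have e: "end_symbol D q = src D (length q) (x (length q))"
    using end_symbol_cylinder[OF x] s by (auto simp: swappable_def)
  have "replace_start q x \<in> paths D"
    unfolding paths_def
  proof (intro CollectI allI conjI)
    fix i
    show "replace_start q x i \<in> edges D i"
      using s x by (auto simp: replace_start_def swappable_def finite_path_def thin_cylinder_def paths_def)
    consider "Suc i < length q" | "Suc i = length q" | "i \<ge> length q" by linarith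
    then show "tgt D i (replace_start q x i) = src D (Suc i) (replace_start q x (Suc i))"
    proof cases
      case 1
      then show ?thesis using s by (auto simp: replace_start_def swappable_def finite_path_def)
    next
      case 2
      then have "i = length q - 1" by simp
      then show ?thesis using e 2 q by (auto simp: replace_start_def end_symbol_nth)
    next
      case 3
      then show ?thesis using x by (auto simp: replace_start_def thin_cylinder_def paths_def)
    qed
  qed
  then show ?thesis by (auto simp: thin_cylinder_def replace_start_def)
qed

lemma replace_start_inverse:
  assumes "x \<in> thin_cylinder D p" "length p = length q"
  shows "replace_start p (replace_start q x) = x"
  using assms by (auto simp: replace_start_def thin_cylinder_def)

lemma replace_start_self: "x \<in> thin_cylinder D p \<Longrightarrow> replace_start p x = x"
  by (auto simp: replace_start_def thin_cylinder_def)

lemma swap_image_moved: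
  assumes "swappable D p q" "Y \<subseteq> thin_cylinder D p"
  shows "replace_start q ` Y = {y \<in> thin_cylinder D q. replace_start p y \<in> Y}"
proof -
  have l: "length p = length q" using assms by (simp add: swappable_def)
  show ?thesis
  proof (intro set_eqI iffI)
    fix y assume "y \<in> replace_start q ` Y"
    then obtain x where x: "x \<in> Y" "x \<in> thin_cylinder D p" "y = replace_start q x"
      using assms(2) by blast
    then show "y \<in> {y \<in> thin_cylinder D q. replace_start p y \<in> Y}"
      using replace_start_in_cylinder[OF assms(1) x(2)] replace_start_inverse[OF x(2) l] by simp
  next
    fix y assume "y \<in> {y \<in> thin_cylinder D q. replace_start p y \<in> Y}"
    then show "y \<in> replace_start q ` Y"
      using replace_start_inverse[of y D q p] l by (metis (no_types, lifting) imageI mem_Collect_eq)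
  qed
qed

definition tail_eq :: "(nat \<Rightarrow> 'e) \<Rightarrow> (nat \<Rightarrow> 'e) \<Rightarrow> bool" where
  "tail_eq x y \<longleftrightarrow> (\<exists>n. \<forall>i\<ge>n. x i = y i)"

lemma tail_eq_refl: "tail_eq x x"
  and tail_eq_sym: "tail_eq x y \<Longrightarrow> tail_eq y x"
  by (auto simp: tail_eq_def) metis

lemma tail_eq_trans: "tail_eq x y \<Longrightarrow> tail_eq y z \<Longrightarrow> tail_eq x z"
  unfolding tail_eq_def by (metis nle_le order_trans)

lemma tail_eq_replace_start: "tail_eq x (replace_start u x)"
  by (auto simp: tail_eq_def replace_start_def intro!: exI[of _ "length u"])

definition saturation :: "('a, 'e) diagram \<Rightarrow> (nat \<Rightarrow> 'e) set \<Rightarrow> (nat \<Rightarrow> 'e) set" where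
  "saturation D Y = {y \<in> paths D. \<exists>x\<in>Y \<inter> paths D. tail_eq x y}"

text \<open>The part of the saturation that is reached from \<open>Y \<inter> [p]\<close> by replacing \<open>p\<close> with \<open>q\<close>.\<close>

definition moved :: "('a, 'e) diagram \<Rightarrow> 'e list \<Rightarrow> 'e list \<Rightarrow> (nat \<Rightarrow> 'e) set \<Rightarrow> (nat \<Rightarrow> 'e) set" where
  "moved D p q Y = {y \<in> thin_cylinder D q. replace_start p y \<in> Y}"

lemma tail_eq_swappable:
  assumes "x \<in> paths D" "y \<in> paths D" "tail_eq x y"
  shows "\<exists>p q. swappable D p q \<and> x \<in> thin_cylinder D p \<and> y \<in> thin_cylinder D q \<and> replace_start p y = x"
proof -
  obtain n where n: "\<And>i. i \<ge> n \<Longrightarrow> x i = y i" using assms(3) by (auto simp: tail_eq_def)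
  let ?p = "map x [0..<Suc n]" and ?q = "map y [0..<Suc n]"
  have "swappable D ?p ?q"
    unfolding swappable_def
    using finite_path_prefix[OF assms(1)] finite_path_prefix[OF assms(2)]
      end_symbol_prefix[OF assms(1), of "Suc n"] end_symbol_prefix[OF assms(2), of "Suc n"] n[of "Suc n"]
    by (auto simp del: upt_Suc)
  moreover have "replace_start ?p y = x"
    by (rule ext) (use n in \<open>auto simp: replace_start_def simp del: upt_Suc\<close>)
  ultimately show ?thesis using in_prefix_cylinder assms by blast
qed

lemma saturation_eq_moved:
  "saturation D Y = (\<Union>(p, q)\<in>{(p, q). swappable D p q}. moved D p q Y)"
proof (intro set_eqI iffI)
  fix y assume "y \<in> saturation D Y"
  then obtain x where x: "x \<in> Y" "x \<in> paths D" "y \<in> paths D" "tail_eq x y" by (auto simp: saturation_def)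
  then show "y \<in> (\<Union>(p, q)\<in>{(p, q). swappable D p q}. moved D p q Y)"
    using tail_eq_swappable[of x D y] by (fastforce simp: moved_def)
next
  fix y assume "y \<in> (\<Union>(p, q)\<in>{(p, q). swappable D p q}. moved D p q Y)"
  then obtain p q where s: "swappable D p q" and y: "y \<in> thin_cylinder D q" "replace_start p y \<in> Y"
    by (auto simp: moved_def)
  have "replace_start p y \<in> paths D"
    using replace_start_in_cylinder[OF swappable_sym[OF s] y(1)] by (simp add: thin_cylinder_def)
  moreover have "tail_eq (replace_start p y) y" using tail_eq_replace_start tail_eq_sym by blast
  ultimately show "y \<in> saturation D Y"
    using y by (auto simp: saturation_def thin_cylinder_def)
qed

lemma saturation_subset: "saturation D Y \<subseteq> paths D"
  by (auto simp: saturation_def)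

lemma subset_saturation: "Y \<subseteq> paths D \<Longrightarrow> Y \<subseteq> saturation D Y"
  using tail_eq_refl by (auto simp: saturation_def)

lemma saturation_saturation: "saturation D (saturation D Y) = saturation D Y"
  using tail_eq_trans tail_eq_refl unfolding saturation_def by blast

lemma saturation_mono: "Y \<subseteq> Z \<Longrightarrow> saturation D Y \<subseteq> saturation D Z"
  by (auto simp: saturation_def)

lemma saturation_memI: "x \<in> Y \<Longrightarrow> x \<in> paths D \<Longrightarrow> y \<in> paths D \<Longrightarrow> tail_eq x y \<Longrightarrow> y \<in> saturation D Y"
  by (auto simp: saturation_def)

text \<open>A path of the tower enters the smaller diagram at some level for good, and the symbol there is
  the end of a finite path of the smaller diagram.\<close>

lemma tower_eq_saturation:
  assumes H: "bratteli H" and A: "bratteli A" and AH: "A \<preceq> H"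
  shows "tower_paths H A = saturation H (paths A)"
proof (intro set_eqI iffI)
  fix y assume "y \<in> tower_paths H A"
  then obtain m where y: "y \<in> paths H" and m: "\<And>i. i > m \<Longrightarrow> y i \<in> edges A i"
    by (auto simp: tower_paths_def stage_paths_def)
  let ?q = "map y [0..<Suc m]"
  have "src A (Suc m) (y (Suc m)) \<in> alph A (Suc m)" using m bratteli_src[OF A] by simp
  then obtain p where p: "finite_path A p" "length p = Suc m" "end_symbol A p = src A (Suc m) (y (Suc m))"
    using finite_path_to_symbol[OF A, of "Suc m"] by blast
  have "end_symbol H ?q = end_symbol H p"
  proof -
    have "p \<noteq> []" using p(2) by auto
    then show ?thesis
      using end_symbol_prefix[OF y, of "Suc m"] p end_symbol_nested[OF AH p(1)] m[of "Suc m"]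
        nested_src[OF AH, of "y (Suc m)" "Suc m"] by (simp del: upt_Suc)
  qed
  then have s: "swappable H ?q p"
    using finite_path_prefix[OF y] finite_path_nested[OF AH p(1)] p(2) unfolding swappable_def
    by (auto simp del: upt_Suc)
  have "replace_start p y \<in> paths H"
    using replace_start_in_cylinder[OF s in_prefix_cylinder[OF y]] by (simp add: thin_cylinder_def)
  moreover have "replace_start p y i \<in> edges A i" for i
    using m p by (auto simp: replace_start_def finite_path_def)
  ultimately have "replace_start p y \<in> paths A" using nested_paths_iff[OF AH] by blast
  then show "y \<in> saturation H (paths A)"
    using y nested_paths[OF AH] tail_eq_sym[OF tail_eq_replace_start]
    by (intro saturation_memI[of "replace_start p y"]) auto
next
  fix y assume "y \<in> saturation H (paths A)"
  then obtain x n where x: "x \<in> paths A" "y \<in> paths H" "\<And>i. i \<ge> n \<Longrightarrow> x i = y i"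
    by (auto simp: saturation_def tail_eq_def)
  then have "y i \<in> edges A i" if "i > n" for i using that by (metis less_imp_le paths_edge)
  then show "y \<in> tower_paths H A" using x by (auto simp: tower_paths_def stage_paths_def)
qed

section \<open>Borel sets\<close>

text \<open>All measures are compared on one \<open>\<sigma>\<close>-algebra, the product \<open>\<sigma>\<close>-algebra on the sequences of
  edges: its traces on the path spaces and on the towers are the Borel sets of these spaces.\<close>

abbreviation seq_space :: "(nat \<Rightarrow> 'e) measure" where
  "seq_space \<equiv> PiM UNIV (\<lambda>_. count_space UNIV)"

lemma space_seq_space [simp]: "space seq_space = UNIV"
  by (simp add: space_PiM)

lemma seq_space_coordinate: "{x. x i \<in> X} \<in> sets seq_space"
proof -
  have "(\<lambda>x. x i) -` X \<inter> space seq_space \<in> sets (seq_space :: (nat \<Rightarrow> 'a) measure)"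
    by (rule measurable_sets[OF measurable_component_singleton]) auto
  then show ?thesis by (simp add: vimage_def)
qed

lemma UNIV_in_seq_space [simp]: "UNIV \<in> sets seq_space"
  using sets.top[of seq_space] by simp

lemma seq_space_coordinate_eq: "{x. x i = e} \<in> sets seq_space"
  using seq_space_coordinate[of i "{e}"] by simp

lemma measurable_seq_spaceI:
  assumes "\<And>i X. {x \<in> space N. f x i \<in> X} \<in> sets N"
  shows "f \<in> measurable N seq_space"
  by (rule measurable_PiM_single) (use assms in auto)

lemma measurable_replace_start: "replace_start p \<in> measurable seq_space seq_space"
proof (rule measurable_seq_spaceI)
  fix i and X :: "'a set"
  have "{x \<in> space seq_space. replace_start p x i \<in> X} =
    (if i < length p then (if p ! i \<in> X then UNIV else {}) else {x. x i \<in> X})"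
    by (auto simp: replace_start_def)
  then show "{x \<in> space seq_space. replace_start p x i \<in> X} \<in> sets seq_space"
    using seq_space_coordinate[of i X] sets.top[of "seq_space :: (nat \<Rightarrow> 'a) measure"] by auto
qed

lemma sets_replace_start: "Y \<in> sets seq_space \<Longrightarrow> {x. replace_start p x \<in> Y} \<in> sets seq_space"
  using measurable_sets[OF measurable_replace_start, of Y p] by (simp add: vimage_def)

definition composable :: "('a, 'e) diagram \<Rightarrow> nat \<Rightarrow> ('e \<times> 'e) set" where
  "composable D i = {(e, f). e \<in> edges D i \<and> f \<in> edges D (Suc i) \<and> tgt D i e = src D (Suc i) f}"

lemma finite_composable: "bratteli D \<Longrightarrow> finite (composable D i)"
  by (rule finite_subset[of _ "edges D i \<times> edges D (Suc i)"])
    (auto simp: composable_def bratteli_finite)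

lemma paths_eq_Inter: "paths D = (\<Inter>i. \<Union>(e, f)\<in>composable D i. {x. x i = e \<and> x (Suc i) = f})"
  unfolding paths_def composable_def by auto

lemma sets_paths:
  assumes D: "bratteli D" shows "paths D \<in> sets seq_space"
  unfolding paths_eq_Inter using finite_composable[OF D]
  by (intro sets.countable_INT'' sets.finite_UN)
    (auto intro!: sets.Int seq_space_coordinate_eq simp: Collect_conj_eq simp del: space_seq_space)

lemma sets_thin_cylinder:
  assumes D: "bratteli D" shows "thin_cylinder D u \<in> sets seq_space"
proof -
  have "thin_cylinder D u = paths D \<inter> (\<Inter>i\<in>{..<length u}. {x. x i = u ! i})"
    by (auto simp: thin_cylinder_def)
  also have "\<dots> \<in> sets seq_space"
    using sets_paths[OF D] seq_space_coordinate_eq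
    by (cases "u = []") (auto intro!: sets.Int sets.finite_INT)
  finally show ?thesis .
qed

lemma sets_moved: "bratteli D \<Longrightarrow> Y \<in> sets seq_space \<Longrightarrow> moved D p q Y \<in> sets seq_space"
  using sets.Int[OF sets_thin_cylinder[of D q] sets_replace_start[of Y p]]
  by (simp add: moved_def Collect_conj_eq)

lemma countable_swappable: "bratteli D \<Longrightarrow> countable {(p, q). swappable D p q}"
  by (rule countable_subset[of _ "{u. finite_path D u} \<times> {u. finite_path D u}"])
    (auto simp: swappable_def countable_finite_paths)

lemma sets_saturation:
  assumes "bratteli D" "Y \<in> sets seq_space" shows "saturation D Y \<in> sets seq_space"
  unfolding saturation_eq_moved
  using sets_moved[OF assms] countable_swappable[OF assms(1)] by (intro sets.countable_UN'') auto

lemma sets_stage_paths: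
  assumes H: "bratteli H" shows "stage_paths H A m \<in> sets seq_space"
proof -
  have "stage_paths H A m = paths H \<inter> (\<Inter>i. {x. i > m \<longrightarrow> x i \<in> edges A i})"
    by (auto simp: stage_paths_def)
  moreover have "{x. i > m \<longrightarrow> x i \<in> edges A i} \<in> sets seq_space" for i
    using seq_space_coordinate[of i "edges A i"] sets.top[of seq_space] by (cases "i > m") auto
  ultimately show ?thesis using sets_paths[OF H] by (auto intro!: sets.Int sets.countable_INT'')
qed

lemma sets_tower_paths: "bratteli H \<Longrightarrow> tower_paths H A \<in> sets seq_space"
  unfolding tower_paths_def using sets_stage_paths by auto

lemma topspace_path_top: "topspace (path_top D) = paths D"
  by (auto simp: path_top_def paths_def)

text \<open>All but finitely many factors of a basic open set of the product are whole edge sets.\<close>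

lemma openin_path_top:
  "openin (path_top D) U \<longleftrightarrow> U \<subseteq> paths D \<and> (\<forall>x\<in>U. \<exists>n. \<forall>y\<in>paths D. (\<forall>i<n. y i = x i) \<longrightarrow> y \<in> U)"
proof
  assume o: "openin (path_top D) U"
  then obtain T where T: "openin (product_topology (\<lambda>i. discrete_topology (edges D i)) UNIV) T"
    and U: "U = T \<inter> paths D"
    by (auto simp: path_top_def openin_subtopology)
  have "\<exists>n. \<forall>y\<in>paths D. (\<forall>i<n. y i = x i) \<longrightarrow> y \<in> U" if x: "x \<in> U" for x
  proof -
    obtain W where W: "finite {i. W i \<noteq> edges D i}" "x \<in> Pi\<^sub>E UNIV W" "Pi\<^sub>E UNIV W \<subseteq> T"
      using T x U unfolding openin_product_topology_alt by fastforce
    obtain n where n: "\<And>i. W i \<noteq> edges D i \<Longrightarrow> i < n"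
      using finite_nat_bounded[OF W(1)] by auto
    have "y \<in> U" if "y \<in> paths D" "\<forall>i<n. y i = x i" for y
    proof -
      have "y i \<in> W i" for i
        using W(2) that n[of i] by (cases "W i = edges D i") (auto simp: paths_def)
      then show ?thesis using W(3) U that by auto
    qed
    then show ?thesis by blast
  qed
  then show "U \<subseteq> paths D \<and> (\<forall>x\<in>U. \<exists>n. \<forall>y\<in>paths D. (\<forall>i<n. y i = x i) \<longrightarrow> y \<in> U)"
    using U by auto
next
  assume U: "U \<subseteq> paths D \<and> (\<forall>x\<in>U. \<exists>n. \<forall>y\<in>paths D. (\<forall>i<n. y i = x i) \<longrightarrow> y \<in> U)"
  show "openin (path_top D) U"
  proof (subst openin_subopen, intro ballI)
    fix x assume x: "x \<in> U"
    then obtain n where n: "\<And>y. y \<in> paths D \<Longrightarrow> \<forall>i<n. y i = x i \<Longrightarrow> y \<in> U" using U by blast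
    let ?W = "\<lambda>i. if i < n then {x i} else edges D i"
    have xe: "x i \<in> edges D i" for i using x U by (auto simp: paths_def)
    have "openin (product_topology (\<lambda>i. discrete_topology (edges D i)) UNIV) (Pi\<^sub>E UNIV ?W)"
      by (subst openin_PiE_gen) (auto simp: xe intro: finite_subset[of _ "{..<n}"])
    then have "openin (path_top D) (Pi\<^sub>E UNIV ?W \<inter> paths D)"
      by (auto simp: path_top_def openin_subtopology)
    moreover have "x \<in> Pi\<^sub>E UNIV ?W \<inter> paths D" using x U xe by auto
    moreover have "Pi\<^sub>E UNIV ?W \<inter> paths D \<subseteq> U"
    proof
      fix y assume "y \<in> Pi\<^sub>E UNIV ?W \<inter> paths D"
      then have y: "y \<in> paths D" and "\<And>i. y i \<in> ?W i" by (blast dest: PiE_mem)+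
      then have "\<forall>i<n. y i = x i" by (metis singletonD)
      then show "y \<in> U" using n y by blast
    qed
    ultimately show "\<exists>T. openin (path_top D) T \<and> x \<in> T \<and> T \<subseteq> U" by blast
  qed
qed

lemma openin_stage:
  assumes "U \<subseteq> stage_paths H A m"
  shows "openin (subtopology (path_top H) (stage_paths H A m)) U \<longleftrightarrow>
     (\<forall>x\<in>U. \<exists>n. \<forall>y\<in>stage_paths H A m. (\<forall>i<n. y i = x i) \<longrightarrow> y \<in> U)" (is "?L = ?R")
proof
  assume ?L
  then obtain T where "openin (path_top H) T" "U = T \<inter> stage_paths H A m"
    by (auto simp: openin_subtopology)
  then show ?R unfolding openin_path_top
    by (metis (no_types, lifting) IntE IntI stage_paths_def mem_Collect_eq)
next
  assume R: ?R
  let ?S = "stage_paths H A m"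
  let ?good = "\<lambda>z n. z \<in> U \<and> (\<forall>y\<in>?S. (\<forall>i<n. y i = z i) \<longrightarrow> y \<in> U)"
  let ?T = "{x \<in> paths H. \<exists>z n. ?good z n \<and> (\<forall>i<n. x i = z i)}"
  have "openin (path_top H) ?T"
    unfolding openin_path_top
  proof (intro conjI ballI)
    fix x assume "x \<in> ?T"
    then obtain z n where zn: "?good z n" "\<forall>i<n. x i = z i" by blast
    have "y \<in> ?T" if "y \<in> paths H" "\<forall>i<n. y i = x i" for y
    proof -
      have "\<forall>i<n. y i = z i" using that(2) zn(2) by simp
      then show ?thesis using that(1) zn(1) by blast
    qed
    then show "\<exists>n. \<forall>y\<in>paths H. (\<forall>i<n. y i = x i) \<longrightarrow> y \<in> ?T" by blast
  qed auto
  moreover have "U = ?T \<inter> ?S"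
  proof
    show "U \<subseteq> ?T \<inter> ?S"
    proof
      fix x assume x: "x \<in> U"
      then obtain n where "?good x n" using R by blast
      moreover have "x \<in> ?S" "x \<in> paths H" using x assms by (auto simp: stage_paths_def)
      ultimately show "x \<in> ?T \<inter> ?S" by blast
    qed
    show "?T \<inter> ?S \<subseteq> U" by blast
  qed
  ultimately show ?L by (metis (no_types, lifting) openin_subtopology)
qed

lemma openin_tower_iff:
  "openin (tower_top H A) U \<longleftrightarrow> U \<subseteq> tower_paths H A \<and>
     (\<forall>m. \<forall>x\<in>U \<inter> stage_paths H A m. \<exists>n. \<forall>y\<in>stage_paths H A m. (\<forall>i<n. y i = x i) \<longrightarrow> y \<in> U)"
  unfolding openin_tower_top by (subst openin_stage) auto

lemma topspace_tower_top: "topspace (tower_top H A) = tower_paths H A"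
proof -
  have "openin (tower_top H A) (tower_paths H A)"
    unfolding openin_tower_iff by (auto simp: tower_paths_def)
  then show ?thesis using openin_subset openin_tower_iff topspace_def by (metis openin_topspace subset_antisym)
qed

lemma path_top_open_cylinders:
  assumes "openin (path_top D) U"
  shows "U = (\<Union>u\<in>{u. finite_path D u \<and> length u \<ge> n \<and> thin_cylinder D u \<subseteq> U}. thin_cylinder D u)"
proof
  show "U \<subseteq> (\<Union>u\<in>{u. finite_path D u \<and> length u \<ge> n \<and> thin_cylinder D u \<subseteq> U}. thin_cylinder D u)"
  proof
    fix x assume x: "x \<in> U"
    then obtain k where k: "\<And>y. y \<in> paths D \<Longrightarrow> \<forall>i<k. y i = x i \<Longrightarrow> y \<in> U" and xp: "x \<in> paths D"
      using assms unfolding openin_path_top by blast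
    let ?u = "map x [0..<max n k]"
    have "thin_cylinder D ?u \<subseteq> U" by (auto simp: thin_cylinder_def intro!: k)
    then show "x \<in> (\<Union>u\<in>{u. finite_path D u \<and> length u \<ge> n \<and> thin_cylinder D u \<subseteq> U}. thin_cylinder D u)"
      using finite_path_prefix[OF xp] in_prefix_cylinder[OF xp] by (intro UN_I[of ?u]) auto
  qed
qed auto

lemma open_path_top_sets:
  assumes "bratteli D" "openin (path_top D) U" shows "U \<in> sets seq_space"
proof -
  have "(\<Union>u\<in>{u. finite_path D u \<and> length u \<ge> 0 \<and> thin_cylinder D u \<subseteq> U}. thin_cylinder D u) \<in> sets seq_space"
    using sets_thin_cylinder[OF assms(1)]
    by (intro sets.countable_UN'' countable_subset[OF _ countable_finite_paths[OF assms(1)]]) auto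
  then show ?thesis using path_top_open_cylinders[OF assms(2), of 0] by simp
qed

lemma sets_borel_of: "sets (borel_of X) = sigma_sets (topspace X) {U. openin X U}"
  and space_borel_of: "space (borel_of X) = topspace X"
  unfolding borel_of_def using openin_subset by (auto intro!: sets_measure_of space_measure_of)

text \<open>The coordinate sets generate the product \<open>\<sigma>\<close>-algebra, so it is enough that they are open in \<open>X\<close>.\<close>

lemma sets_borel_of_trace:
  assumes T: "topspace X \<in> sets seq_space"
    and o: "\<And>U. openin X U \<Longrightarrow> U \<in> sets seq_space"
    and c: "\<And>i E. openin X {x \<in> topspace X. x i \<in> E}"
  shows "sets (borel_of X) = {B \<in> sets seq_space. B \<subseteq> topspace X}"
proof (intro set_eqI iffI)
  fix B assume B: "B \<in> sets (borel_of X)"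
  then have "B \<subseteq> topspace X" by (metis sets.sets_into_space space_borel_of)
  moreover have "B \<in> sets seq_space"
    using B unfolding sets_borel_of
  proof (induction rule: sigma_sets.induct)
    case (Compl a)
    then show ?case using T by blast
  qed (use o in auto)
  ultimately show "B \<in> {B \<in> sets seq_space. B \<subseteq> topspace X}" by simp
next
  fix B assume B: "B \<in> {B \<in> sets seq_space. B \<subseteq> topspace X}"
  have "(\<lambda>x. x) \<in> measurable (borel_of X) seq_space"
    by (rule measurable_seq_spaceI) (use c in \<open>auto simp: space_borel_of sets_borel_of\<close>)
  then have "(\<lambda>x. x) -` B \<inter> space (borel_of X) \<in> sets (borel_of X)"
    using B by (intro measurable_sets) auto
  moreover have "(\<lambda>x. x) -` B \<inter> space (borel_of X) = B" using B by (auto simp: space_borel_of)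
  ultimately show "B \<in> sets (borel_of X)" by simp
qed

lemma sets_borel_path_top:
  assumes D: "bratteli D"
  shows "sets (borel_of (path_top D)) = {B \<in> sets seq_space. B \<subseteq> paths D}"
proof -
  have "openin (path_top D) {x \<in> paths D. x i \<in> E}" for i E
    unfolding openin_path_top
  proof (intro conjI ballI)
    fix x assume x: "x \<in> {x \<in> paths D. x i \<in> E}"
    show "\<exists>n. \<forall>y\<in>paths D. (\<forall>i<n. y i = x i) \<longrightarrow> y \<in> {x \<in> paths D. x i \<in> E}"
      using x by (intro exI[of _ "Suc i"]) auto
  qed auto
  then show ?thesis
    using sets_borel_of_trace[of "path_top D"] sets_paths[OF D] open_path_top_sets[OF D]
    by (simp add: topspace_path_top)
qed

lemma sets_borel_tower_top:
  assumes H: "bratteli H"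
  shows "sets (borel_of (tower_top H A)) = {B \<in> sets seq_space. B \<subseteq> tower_paths H A}"
proof -
  \<comment> \<open>A set that is open in the direct limit is a countable union of relatively open subsets of the
    stages.\<close>
  have "U \<in> sets seq_space" if U: "openin (tower_top H A) U" for U
  proof -
    have "U \<inter> stage_paths H A m \<in> sets seq_space" for m
    proof -
      have "openin (subtopology (path_top H) (stage_paths H A m)) (U \<inter> stage_paths H A m)"
        using U by (simp add: openin_tower_top)
      then obtain T where "openin (path_top H) T" "U \<inter> stage_paths H A m = T \<inter> stage_paths H A m"
        by (auto simp: openin_subtopology)
      then show ?thesis using open_path_top_sets[OF H] sets_stage_paths[OF H] by (metis sets.Int)
    qed
    moreover have "U = (\<Union>m. U \<inter> stage_paths H A m)"
      using U openin_tower_iff[of H A U] by (auto simp: tower_paths_def)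
    ultimately show ?thesis
      using sets.countable_UN[of "\<lambda>m. U \<inter> stage_paths H A m" UNIV seq_space] by auto
  qed
  moreover have "openin (tower_top H A) {x \<in> tower_paths H A. x i \<in> E}" for i E
    unfolding openin_tower_iff
  proof (intro conjI allI ballI)
    fix m x assume x: "x \<in> {x \<in> tower_paths H A. x i \<in> E} \<inter> stage_paths H A m"
    show "\<exists>n. \<forall>y\<in>stage_paths H A m. (\<forall>i<n. y i = x i) \<longrightarrow> y \<in> {x \<in> tower_paths H A. x i \<in> E}"
      using x by (intro exI[of _ "Suc i"]) (auto simp: tower_paths_def)
  qed auto
  ultimately show ?thesis
    using sets_borel_of_trace[of "tower_top H A"] sets_tower_paths[OF H]
    by (simp add: topspace_tower_top)
qed

lemma saturation_tower:
  "bratteli H \<Longrightarrow> bratteli A \<Longrightarrow> A \<preceq> H \<Longrightarrow> saturation H (tower_paths H A) = tower_paths H A"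
  by (simp add: tower_eq_saturation saturation_saturation)

section \<open>Invariant measures\<close>

text \<open>A measure on a Borel subset of the space of sequences, such as a path space or a tower, is
  replaced by its extension by zero, so that measures on different spaces can be compared.\<close>

definition ext_zero :: "(nat \<Rightarrow> 'e) measure \<Rightarrow> (nat \<Rightarrow> 'e) measure" where
  "ext_zero \<mu> = distr \<mu> seq_space (\<lambda>x. x)"

lemma sets_ext_zero [simp]: "sets (ext_zero \<mu>) = sets seq_space"
  by (simp add: ext_zero_def)

lemma space_trace:
  assumes "P \<in> sets seq_space" "sets \<mu> = {B \<in> sets seq_space. B \<subseteq> P}" shows "space \<mu> = P"
  using assms sets.top[of \<mu>] sets.sets_into_space[of P \<mu>] by auto

lemma emeasure_ext_zero:
  assumes P: "P \<in> sets seq_space" and \<mu>: "sets \<mu> = {B \<in> sets seq_space. B \<subseteq> P}"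
    and X: "X \<in> sets seq_space"
  shows "emeasure (ext_zero \<mu>) X = emeasure \<mu> (X \<inter> P)"
proof -
  have "(\<lambda>x. x) \<in> measurable \<mu> seq_space"
    unfolding measurable_def using space_trace[OF P \<mu>] P by (auto simp: \<mu>)
  then show ?thesis
    unfolding ext_zero_def using X space_trace[OF P \<mu>] by (simp add: emeasure_distr)
qed

lemma sets_restrict_trace:
  assumes "sets N = sets seq_space" "P \<in> sets seq_space"
  shows "sets (restrict_space N P) = {B \<in> sets seq_space. B \<subseteq> P}"
proof -
  have "space N = UNIV" using sets_eq_imp_space_eq[OF assms(1)] by simp
  then show ?thesis using assms by (subst set_eq_iff) (simp add: sets_restrict_space_iff conj_commute)
qed

lemma emeasure_restrict_trace:
  assumes "sets N = sets seq_space" "P \<in> sets seq_space" "X \<subseteq> P"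
  shows "emeasure (restrict_space N P) X = emeasure N X"
  using assms by (intro emeasure_restrict_space) (auto simp: sets_eq_imp_space_eq[OF assms(1)])

lemma emeasure_ext_restrict:
  assumes "sets N = sets seq_space" "P \<in> sets seq_space" "X \<in> sets seq_space"
  shows "emeasure (ext_zero (restrict_space N P)) X = emeasure N (X \<inter> P)"
  using emeasure_ext_zero[OF assms(2) sets_restrict_trace[OF assms(1,2)] assms(3)]
    emeasure_restrict_trace[OF assms(1,2)] by simp

lemma restrict_ext_zero:
  assumes P: "P \<in> sets seq_space" and \<mu>: "sets \<mu> = {B \<in> sets seq_space. B \<subseteq> P}"
  shows "restrict_space (ext_zero \<mu>) P = \<mu>"
proof (rule measure_eqI)
  show s: "sets (restrict_space (ext_zero \<mu>) P) = sets \<mu>"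
    using sets_restrict_trace[of "ext_zero \<mu>" P] P \<mu> by simp
  fix B assume "B \<in> sets (restrict_space (ext_zero \<mu>) P)"
  then have B: "B \<in> sets seq_space" "B \<subseteq> P" using s \<mu> by auto
  show "emeasure (restrict_space (ext_zero \<mu>) P) B = emeasure \<mu> B"
    using emeasure_restrict_trace[of "ext_zero \<mu>" P B] P B emeasure_ext_zero[OF P \<mu> B(1)]
    by (simp add: Int_absorb2)
qed

lemma restr_eq_restrict_space:
  assumes A: "bratteli A" and P: "P \<in> sets seq_space" and \<nu>: "sets \<nu> = {B \<in> sets seq_space. B \<subseteq> P}"
  shows "restr A \<nu> = restrict_space (ext_zero \<nu>) (paths A)"
proof -
  let ?N = "ext_zero \<nu>" and ?S = "{B \<in> sets seq_space. B \<subseteq> paths A}"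
  have "paths A \<inter> space ?N = paths A" by (simp add: ext_zero_def)
  moreover have S: "(\<inter>) (paths A) ` sets ?N = ?S"
    using sets_restrict_trace[of ?N "paths A"] sets_paths[OF A] by (simp add: sets_restrict_space)
  moreover have "measure_of (paths A) ?S (emeasure ?N)
      = measure_of (paths A) ?S (\<lambda>B. emeasure \<nu> (B \<inter> space \<nu>))"
  proof (rule measure_of_eq)
    fix B assume B: "B \<in> sigma_sets (paths A) ?S"
    have "B \<in> sets (borel_of (path_top A))"
      using B sets.sigma_sets_eq[of "borel_of (path_top A)"]
      by (simp add: sets_borel_path_top[OF A] space_borel_of topspace_path_top)
    then have "B \<in> sets seq_space" by (simp add: sets_borel_path_top[OF A])
    then show "emeasure ?N B = emeasure \<nu> (B \<inter> space \<nu>)"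
      using emeasure_ext_zero[OF P \<nu>] space_trace[OF P \<nu>] by simp
  qed auto
  ultimately show ?thesis
    unfolding restr_def restrict_space_def sets_borel_path_top[OF A] by simp
qed

text \<open>Invariance and ergodicity are used in a form that speaks of pairs of finite paths and of
  tail-saturated sets only, and not of the group.\<close>

definition swap_invariant :: "('a, 'e) diagram \<Rightarrow> (nat \<Rightarrow> 'e) measure \<Rightarrow> bool" where
  "swap_invariant D N \<longleftrightarrow> sets N = sets seq_space \<and> (\<forall>p q. swappable D p q \<longrightarrow>
     (\<forall>Y\<in>sets seq_space. emeasure N (moved D p q Y) = emeasure N (Y \<inter> thin_cylinder D p)))"

definition swap_ergodic :: "('a, 'e) diagram \<Rightarrow> (nat \<Rightarrow> 'e) measure \<Rightarrow> bool" where
  "swap_ergodic D N \<longleftrightarrow> (\<forall>B\<in>sets seq_space. saturation D B = B \<longrightarrow>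
     emeasure N B = 0 \<or> emeasure N (paths D - B) = 0)"

lemma swap_invariant_sets: "swap_invariant D N \<Longrightarrow> sets N = sets seq_space"
  by (simp add: swap_invariant_def)

lemma swap_invariant_moved:
  "swap_invariant D N \<Longrightarrow> swappable D p q \<Longrightarrow> Y \<in> sets seq_space \<Longrightarrow>
    emeasure N (moved D p q Y) = emeasure N (Y \<inter> thin_cylinder D p)"
  by (auto simp: swap_invariant_def)

lemma thin_cylinder_disjoint:
  "length p = length q \<Longrightarrow> x \<in> thin_cylinder D p \<Longrightarrow> x \<in> thin_cylinder D q \<Longrightarrow> p = q"
  by (metis thin_cylinder_iff)

lemma swap_in_paths:
  assumes "swappable D p q" "x \<in> paths D" shows "swap D p q x \<in> paths D"
  using assms replace_start_in_cylinder[OF assms(1)] replace_start_in_cylinder[OF swappable_sym[OF assms(1)]]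
    thin_cylinder_subset[of D] by (auto simp: swap_def)

lemma swap_tail_eq: "tail_eq x (swap D p q x)"
  by (auto simp: swap_def tail_eq_refl tail_eq_replace_start)

lemma swap_swap:
  assumes s: "swappable D p q" shows "swap D p q (swap D p q x) = x"
proof -
  have l: "length p = length q" using s by (simp add: swappable_def)
  consider "x \<in> thin_cylinder D p" | "x \<notin> thin_cylinder D p" "x \<in> thin_cylinder D q"
    | "x \<notin> thin_cylinder D p" "x \<notin> thin_cylinder D q" by blast
  then show ?thesis
  proof cases
    case 1
    have y: "replace_start q x \<in> thin_cylinder D q" by (rule replace_start_in_cylinder[OF s 1])
    show ?thesis
    proof (cases "p = q")
      case True
      then show ?thesis using 1 replace_start_self[OF 1] by (simp add: swap_def)
    next
      case False
      then have "replace_start q x \<notin> thin_cylinder D p"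
        using thin_cylinder_disjoint[OF l _ y] by blast
      then show ?thesis using 1 y replace_start_inverse[OF 1 l] by (simp add: swap_def)
    qed
  next
    case 2
    have "replace_start p x \<in> thin_cylinder D p"
      by (rule replace_start_in_cylinder[OF swappable_sym[OF s] 2(2)])
    then show ?thesis using 2 replace_start_inverse[OF 2(2) l[symmetric]] by (simp add: swap_def)
  qed (simp add: swap_def)
qed

lemma swap_FC: "swappable D p q \<Longrightarrow> swap D p q \<in> FC D"
  using FC.comp[OF FC.id, of D p q] by (simp add: swappable_def)

lemma saturated_FC_image:
  assumes B: "saturation D B = B" and g: "g \<in> FC D" shows "g ` B = B"
  using g
proof (induction rule: FC.induct)
  case (comp g u v)
  then have s: "swappable D u v" by (auto simp: swappable_def)
  have in_B: "swap D u v x \<in> B" if "x \<in> B" for x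
  proof -
    have "x \<in> paths D" using that B saturation_subset by blast
    then have "swap D u v x \<in> saturation D B"
      using that swap_in_paths[OF s] swap_tail_eq by (intro saturation_memI[of x]) auto
    then show ?thesis using B by simp
  qed
  have "swap D u v ` B = B"
  proof
    show "B \<subseteq> swap D u v ` B"
      using in_B swap_swap[OF s] by (metis image_eqI subsetI)
  qed (use in_B in auto)
  then show ?case using comp.IH by (metis image_comp)
qed simp

lemma FC_invariant_saturated:
  assumes B: "B \<subseteq> paths D" and g: "\<And>g. g \<in> FC D \<Longrightarrow> g ` B = B" shows "saturation D B = B"
proof
  show "saturation D B \<subseteq> B"
  proof
    fix y assume "y \<in> saturation D B"
    then obtain x where x: "x \<in> B" "x \<in> paths D" "y \<in> paths D" "tail_eq x y"
      by (auto simp: saturation_def)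
    then obtain p q where s: "swappable D p q" "x \<in> thin_cylinder D p" "y \<in> thin_cylinder D q"
      "replace_start p y = x" using tail_eq_swappable by blast
    then have "swap D p q x = y"
      using replace_start_inverse[OF s(3), where q = p] by (auto simp: swap_def swappable_def)
    then show "y \<in> B" using g[OF swap_FC[OF s(1)]] x(1) by blast
  qed
qed (rule subset_saturation[OF B])

lemma saturated_Int:
  assumes "saturation D B = B" "saturation D P = P" shows "saturation D (B \<inter> P) = B \<inter> P"
proof
  show "saturation D (B \<inter> P) \<subseteq> B \<inter> P"
    using saturation_mono[of "B \<inter> P" B D] saturation_mono[of "B \<inter> P" P D] assms by blast
  show "B \<inter> P \<subseteq> saturation D (B \<inter> P)"
    using saturation_subset[of D P] assms by (intro subset_saturation) auto
qed

lemma moved_subset: "moved D p q Y \<subseteq> thin_cylinder D q"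
  by (auto simp: moved_def)

lemma moved_Int_cylinder:
  assumes "swappable D p q" shows "moved D p q (Y \<inter> thin_cylinder D p) = moved D p q Y"
  using replace_start_in_cylinder[OF swappable_sym[OF assms]] by (auto simp: moved_def)

lemma moved_Int_saturated:
  assumes s: "swappable D p q" and P: "saturation D P = P"
  shows "moved D p q Y \<inter> P = moved D p q (Y \<inter> P)"
proof -
  have "y \<in> P \<longleftrightarrow> replace_start p y \<in> P" if "y \<in> thin_cylinder D q" for y
  proof -
    have "y \<in> paths D" "replace_start p y \<in> paths D"
      using that replace_start_in_cylinder[OF swappable_sym[OF s] that] by (auto simp: thin_cylinder_def)
    then show ?thesis
      using P saturation_memI[of _ P D] tail_eq_replace_start tail_eq_sym by metis
  qed
  then show ?thesis by (auto simp: moved_def)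
qed

lemma moved_moved:
  assumes s: "swappable D p q" shows "moved D q p (moved D p q Y) = Y \<inter> thin_cylinder D p"
proof -
  have l: "length p = length q" using s by (simp add: swappable_def)
  show ?thesis
    using replace_start_in_cylinder[OF s] replace_start_inverse[OF _ l, of _ D]
    by (auto simp: moved_def)
qed

lemma emeasure_Un3:
  assumes "A \<in> sets N" "B \<in> sets N" "C \<in> sets N" "A \<inter> B = {}" "(A \<union> B) \<inter> C = {}"
  shows "emeasure N (A \<union> B \<union> C) = emeasure N A + emeasure N B + emeasure N C"
  using assms by (simp flip: plus_emeasure)

lemma FC_image_measure:
  assumes D: "bratteli D" and N: "swap_invariant D N"
    and B: "B \<in> sets seq_space" "B \<subseteq> paths D" and g: "g \<in> FC D"
  shows "g ` B \<in> sets seq_space \<and> g ` B \<subseteq> paths D \<and> emeasure N (g ` B) = emeasure N B"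
  using g
proof (induction rule: FC.induct)
  case id
  then show ?case using B by simp
next
  case (comp g u v)
  then have s: "swappable D u v" by (auto simp: swappable_def)
  let ?C = "g ` B"
  have C: "?C \<in> sets seq_space" "?C \<subseteq> paths D" using comp by auto
  have "swap D u v ` ?C \<in> sets seq_space \<and> swap D u v ` ?C \<subseteq> paths D
    \<and> emeasure N (swap D u v ` ?C) = emeasure N ?C"
  proof (cases "u = v")
    case True
    then have "swap D u v x = x" for x by (simp add: swap_def replace_start_self)
    then show ?thesis using C by simp
  next
    case False
    let ?cu = "thin_cylinder D u" and ?cv = "thin_cylinder D v"
    let ?R = "?C - ?cu - ?cv"
    have l: "length u = length v" using s by (simp add: swappable_def)
    have disj: "?cu \<inter> ?cv = {}" using thin_cylinder_disjoint[OF l] False by blast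
    have "swap D u v ` ?C = replace_start v ` (?C \<inter> ?cu) \<union> replace_start u ` (?C \<inter> ?cv) \<union> ?R"
      (is "?L = ?R'")
    proof
      show "?L \<subseteq> ?R'" by (auto simp: swap_def)
      have "replace_start v ` (?C \<inter> ?cu) \<subseteq> ?L" "replace_start u ` (?C \<inter> ?cv) \<subseteq> ?L" "?R \<subseteq> ?L"
        using disj by (force simp: swap_def)+
      then show "?R' \<subseteq> ?L" by blast
    qed
    also have "replace_start v ` (?C \<inter> ?cu) = moved D u v ?C"
      using swap_image_moved[OF s, of "?C \<inter> ?cu"] moved_Int_cylinder[OF s, of ?C]
      by (simp add: moved_def)
    also have "replace_start u ` (?C \<inter> ?cv) = moved D v u ?C"
      using swap_image_moved[OF swappable_sym[OF s], of "?C \<inter> ?cv"]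
        moved_Int_cylinder[OF swappable_sym[OF s], of ?C] by (simp add: moved_def)
    finally have eq: "swap D u v ` ?C = moved D u v ?C \<union> moved D v u ?C \<union> ?R" .
    have m: "moved D u v ?C \<in> sets N" "moved D v u ?C \<in> sets N" "?R \<in> sets N"
      "?C \<inter> ?cu \<in> sets N" "?C \<inter> ?cv \<in> sets N"
      using sets_moved[OF D C(1)] sets_thin_cylinder[OF D] C(1) swap_invariant_sets[OF N] by auto
    have "emeasure N (swap D u v ` ?C)
        = emeasure N (moved D u v ?C) + emeasure N (moved D v u ?C) + emeasure N ?R"
      unfolding eq using m(1-3) disj moved_subset[of D u v ?C] moved_subset[of D v u ?C]
      by (intro emeasure_Un3) auto
    also have "\<dots> = emeasure N (?C \<inter> ?cu) + emeasure N (?C \<inter> ?cv) + emeasure N ?R"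
      using swap_invariant_moved[OF N s C(1)] swap_invariant_moved[OF N swappable_sym[OF s] C(1)] by simp
    also have "\<dots> = emeasure N (?C \<inter> ?cu \<union> ?C \<inter> ?cv \<union> ?R)"
      using m(3-5) disj by (intro emeasure_Un3[symmetric]) auto
    also have "?C \<inter> ?cu \<union> ?C \<inter> ?cv \<union> ?R = ?C" by blast
    finally have "emeasure N (swap D u v ` ?C) = emeasure N ?C" .
    moreover have "swap D u v ` ?C \<subseteq> paths D" using swap_in_paths[OF s] C(2) by blast
    moreover have "swap D u v ` ?C \<in> sets seq_space"
      unfolding eq using m swap_invariant_sets[OF N] by auto
    ultimately show ?thesis by blast
  qed
  then show ?case using comp.IH by (metis image_comp)
qed

text \<open>The next two lemmas cover both the path space of \<open>D\<close> and the towers in \<open>D\<close>: each is a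
  tail-saturated Borel set \<open>P\<close> of paths.\<close>

lemma invariant_measure_iff:
  assumes D: "bratteli D" and X: "sets (borel_of X) = {B \<in> sets seq_space. B \<subseteq> P}"
    and P: "P \<in> sets seq_space" "saturation D P = P"
  shows "invariant_measure D X \<mu> \<longleftrightarrow> sets \<mu> = sets (borel_of X) \<and> swap_invariant D (ext_zero \<mu>)"
proof (cases "sets \<mu> = sets (borel_of X)")
  case sm: True
  then have \<mu>: "sets \<mu> = {B \<in> sets seq_space. B \<subseteq> P}" using X by simp
  have PD: "P \<subseteq> paths D" using P(2) saturation_subset by blast
  note ext = emeasure_ext_zero[OF P(1) \<mu>]
  have "swap_invariant D (ext_zero \<mu>)"
    if inv: "\<And>g B. g \<in> FC D \<Longrightarrow> B \<in> sets \<mu> \<Longrightarrow> emeasure \<mu> (g ` B) = emeasure \<mu> B"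
    unfolding swap_invariant_def
  proof (intro conjI allI impI ballI)
    fix p q and Y :: "(nat \<Rightarrow> 'b) set" assume s: "swappable D p q" and Y: "Y \<in> sets seq_space"
    let ?B = "Y \<inter> P \<inter> thin_cylinder D p"
    have B: "?B \<in> sets \<mu>" using Y P(1) sets_thin_cylinder[OF D] by (auto simp: \<mu>)
    have "swap D p q ` ?B = replace_start q ` ?B" by (auto simp: swap_def)
    also have "\<dots> = moved D p q ?B" using swap_image_moved[OF s, of ?B] by (simp add: moved_def)
    also have "\<dots> = moved D p q Y \<inter> P"
      using moved_Int_cylinder[OF s, of "Y \<inter> P"] moved_Int_saturated[OF s P(2)] by simp
    finally have "emeasure \<mu> (moved D p q Y \<inter> P) = emeasure \<mu> ?B"
      using inv[OF swap_FC[OF s] B] by simp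
    then show "emeasure (ext_zero \<mu>) (moved D p q Y) = emeasure (ext_zero \<mu>) (Y \<inter> thin_cylinder D p)"
      using ext[OF sets_moved[OF D Y]] ext[of "Y \<inter> thin_cylinder D p"] Y sets_thin_cylinder[OF D]
      by (simp add: Int_ac)
  qed simp
  moreover have "emeasure \<mu> (g ` B) = emeasure \<mu> B"
    if inv: "swap_invariant D (ext_zero \<mu>)" and g: "g \<in> FC D" and B: "B \<in> sets \<mu>" for g B
  proof -
    have B': "B \<in> sets seq_space" "B \<subseteq> P" "B \<subseteq> paths D" using B PD by (auto simp: \<mu>)
    have gP: "g ` B \<subseteq> P"
    proof -
      have "g ` B \<subseteq> g ` P" using B'(2) by blast
      then show ?thesis using saturated_FC_image[OF P(2) g] by simp
    qed
    have im: "g ` B \<in> sets seq_space" "emeasure (ext_zero \<mu>) (g ` B) = emeasure (ext_zero \<mu>) B"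
      using FC_image_measure[OF D inv B'(1,3) g] by auto
    then show ?thesis
      using ext[OF im(1)] ext[OF B'(1)] B'(2) gP by (simp add: Int_absorb2)
  qed
  ultimately show ?thesis using sm unfolding invariant_measure_def by blast
qed (auto simp: invariant_measure_def)

lemma ergodic_invariant_measure_iff:
  assumes D: "bratteli D" and X: "sets (borel_of X) = {B \<in> sets seq_space. B \<subseteq> P}"
    and P: "P \<in> sets seq_space" "saturation D P = P"
  shows "ergodic_invariant_measure D X \<mu> \<longleftrightarrow> sets \<mu> = sets (borel_of X)
    \<and> swap_invariant D (ext_zero \<mu>) \<and> swap_ergodic D (ext_zero \<mu>)"
proof (cases "sets \<mu> = sets (borel_of X)")
  case sm: True
  then have \<mu>: "sets \<mu> = {B \<in> sets seq_space. B \<subseteq> P}" using X by simp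
  have PD: "P \<subseteq> paths D" using P(2) saturation_subset by blast
  note ext = emeasure_ext_zero[OF P(1) \<mu>]
  have sp: "space \<mu> = P" by (rule space_trace[OF P(1) \<mu>])
  have sD: "paths D \<in> sets seq_space" by (rule sets_paths[OF D])
  have 1: "swap_ergodic D (ext_zero \<mu>)"
    if erg: "\<And>B. B \<in> sets \<mu> \<Longrightarrow> (\<forall>g\<in>FC D. g ` B = B) \<Longrightarrow> emeasure \<mu> B = 0 \<or> emeasure \<mu> (space \<mu> - B) = 0"
    unfolding swap_ergodic_def
  proof (intro ballI impI)
    fix B :: "(nat \<Rightarrow> 'b) set" assume B: "B \<in> sets seq_space" "saturation D B = B"
    have "B \<inter> P \<in> sets \<mu>" using B P by (auto simp: \<mu>)
    then have "emeasure \<mu> (B \<inter> P) = 0 \<or> emeasure \<mu> (P - B \<inter> P) = 0"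
      using erg saturated_FC_image[OF saturated_Int[OF B(2) P(2)]] sp by simp
    moreover have "(paths D - B) \<inter> P = P - B \<inter> P" using PD by auto
    ultimately show "emeasure (ext_zero \<mu>) B = 0 \<or> emeasure (ext_zero \<mu>) (paths D - B) = 0"
      using ext[OF B(1)] ext[of "paths D - B"] B(1) sD by auto
  qed
  have 2: "emeasure \<mu> B = 0 \<or> emeasure \<mu> (space \<mu> - B) = 0"
    if erg: "swap_ergodic D (ext_zero \<mu>)" and B: "B \<in> sets \<mu>" and g: "\<forall>g\<in>FC D. g ` B = B" for B
  proof -
    have B': "B \<in> sets seq_space" "B \<subseteq> P" "B \<subseteq> paths D" using B PD by (auto simp: \<mu>)
    have "emeasure (ext_zero \<mu>) B = 0 \<or> emeasure (ext_zero \<mu>) (paths D - B) = 0"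
      using erg B'(1) FC_invariant_saturated[OF B'(3)] g unfolding swap_ergodic_def by blast
    moreover have "(paths D - B) \<inter> P = space \<mu> - B" using PD sp by auto
    ultimately show ?thesis
      using ext[OF B'(1)] ext[of "paths D - B"] B' sD by (auto simp: Int_absorb2)
  qed
  show ?thesis
    unfolding ergodic_invariant_measure_def invariant_measure_iff[OF D X P] using 1 2 sm by blast
qed (auto simp: ergodic_invariant_measure_def invariant_measure_def)

section \<open>Comparison of invariant measures on saturations\<close>

lemma emeasure_le_countable_cover:
  assumes s: "sets N1 = sets N2" and I: "countable I" and C: "\<And>i. i \<in> I \<Longrightarrow> C i \<in> sets N1"
    and X: "X \<in> sets N1" "X \<subseteq> (\<Union>i\<in>I. C i)"
    and le: "\<And>i Z. i \<in> I \<Longrightarrow> Z \<in> sets N1 \<Longrightarrow> Z \<subseteq> C i \<Longrightarrow> emeasure N1 Z \<le> emeasure N2 Z"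
  shows "emeasure N1 X \<le> emeasure N2 X"
proof (cases "I = {}")
  case False
  let ?C = "\<lambda>n. C (from_nat_into I n)"
  let ?X = "\<lambda>n. X \<inter> disjointed ?C n"
  have iI: "from_nat_into I n \<in> I" for n using False by (simp add: from_nat_into)
  have dm: "range (disjointed ?C) \<subseteq> sets N1"
    using iI C by (intro sets.range_disjointed_sets) auto
  then have sX: "?X n \<in> sets N1" for n using X(1) by auto
  have rg: "range ?X \<subseteq> sets N1" "range ?X \<subseteq> sets N2" using sX s by blast+
  have disj: "disjoint_family ?X"
    using disjoint_family_disjointed[of ?C] unfolding disjoint_family_on_def by blast
  have "(\<Union>n. ?C n) = (\<Union>i\<in>I. C i)"
    using range_from_nat_into[OF False I] by (metis image_image)
  then have "X \<subseteq> (\<Union>n. disjointed ?C n)"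
    using X(2) UN_disjointed_eq[of ?C] by simp
  then have U: "(\<Union>n. ?X n) = X" by blast
  have le': "emeasure N1 (?X n) \<le> emeasure N2 (?X n)" for n
    using le[OF iI sX, of n n] disjointed_subset[of ?C n] by blast
  have "emeasure N1 X = (\<Sum>n. emeasure N1 (?X n))"
    using suminf_emeasure[OF rg(1) disj] U by simp
  also have "\<dots> \<le> (\<Sum>n. emeasure N2 (?X n))"
    by (intro suminf_le le') auto
  also have "\<dots> = emeasure N2 X"
    using suminf_emeasure[OF rg(2) disj] U by simp
  finally show ?thesis .
qed (use X in auto)

text \<open>The saturation of \<open>Y\<close> is a countable union of sets that swaps carry into \<open>Y\<close>. Hence a
  comparison of two invariant measures on \<open>Y\<close> extends to the saturation. Uniqueness of tower
  extensions, nullity of saturations of null sets, and the invariant Hahn decomposition below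
  all come from here.\<close>

lemma saturation_emeasure_le:
  assumes D: "bratteli D" and N1: "swap_invariant D N1" and N2: "swap_invariant D N2"
    and Y: "Y \<in> sets seq_space"
    and le: "\<And>X. X \<in> sets seq_space \<Longrightarrow> X \<subseteq> Y \<Longrightarrow> emeasure N1 X \<le> emeasure N2 X"
    and X: "X \<in> sets seq_space" "X \<subseteq> saturation D Y"
  shows "emeasure N1 X \<le> emeasure N2 X"
proof (rule emeasure_le_countable_cover[of N1 N2 "{(p, q). swappable D p q}" "\<lambda>(p, q). moved D p q Y"])
  note s1 = swap_invariant_sets[OF N1]
  show "sets N1 = sets N2" using s1 swap_invariant_sets[OF N2] by simp
  show "countable {(p, q). swappable D p q}" by (rule countable_swappable[OF D])
  show "(case i of (p, q) \<Rightarrow> moved D p q Y) \<in> sets N1" if "i \<in> {(p, q). swappable D p q}" for i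
    using that sets_moved[OF D Y] s1 by auto
  show "X \<in> sets N1" "X \<subseteq> (\<Union>i\<in>{(p, q). swappable D p q}. case i of (p, q) \<Rightarrow> moved D p q Y)"
    using X s1 saturation_eq_moved by (auto simp: saturation_eq_moved)
  fix i Z assume i: "i \<in> {(p, q). swappable D p q}" and Z: "Z \<in> sets N1"
    "Z \<subseteq> (case i of (p, q) \<Rightarrow> moved D p q Y)"
  obtain p q where pq: "i = (p, q)" "swappable D p q" using i by auto
  have Z': "Z \<in> sets seq_space" "Z \<subseteq> moved D p q Y" using Z s1 pq by auto
  have "Z \<inter> thin_cylinder D q = Z" using Z'(2) moved_subset by blast
  then have e: "emeasure N Z = emeasure N (moved D q p Z)" if "swap_invariant D N" for N
    using swap_invariant_moved[OF that swappable_sym[OF pq(2)] Z'(1)] by simp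
  have "moved D q p Z \<subseteq> moved D q p (moved D p q Y)" using Z'(2) by (auto simp: moved_def)
  then have "moved D q p Z \<subseteq> Y" using moved_moved[OF pq(2), of Y] by simp
  then show "emeasure N1 Z \<le> emeasure N2 Z"
    using le[OF sets_moved[OF D Z'(1)]] e[OF N1] e[OF N2] by simp
qed

lemma saturation_emeasure_eq:
  assumes D: "bratteli D" and N1: "swap_invariant D N1" and N2: "swap_invariant D N2"
    and Y: "Y \<in> sets seq_space"
    and eq: "\<And>X. X \<in> sets seq_space \<Longrightarrow> X \<subseteq> Y \<Longrightarrow> emeasure N1 X = emeasure N2 X"
    and X: "X \<in> sets seq_space" "X \<subseteq> saturation D Y"
  shows "emeasure N1 X = emeasure N2 X"
  by (intro antisym saturation_emeasure_le[OF D N1 N2 Y _ X] saturation_emeasure_le[OF D N2 N1 Y _ X])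
    (auto simp: eq)

lemma swap_invariant_null_measure: "swap_invariant D (null_measure seq_space)"
  by (simp add: swap_invariant_def)

lemma saturation_null:
  assumes D: "bratteli D" and N: "swap_invariant D N" and Y: "Y \<in> sets seq_space" "emeasure N Y = 0"
  shows "emeasure N (saturation D Y) = 0"
proof -
  have "emeasure N X \<le> emeasure (null_measure seq_space) X" if "X \<subseteq> Y" for X
    using emeasure_mono[OF that, of N] Y swap_invariant_sets[OF N] by auto
  then show ?thesis
    using saturation_emeasure_le[OF D N swap_invariant_null_measure Y(1) _ sets_saturation[OF D Y(1)]]
    by simp
qed

lemma saturation_piece_positive:
  assumes D: "bratteli D" and N: "swap_invariant D N" and Y: "Y \<in> sets seq_space"
    and X: "X \<in> sets seq_space" "X \<subseteq> saturation D Y" "emeasure N X > 0"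
  shows "\<exists>p q. swappable D p q \<and> emeasure N (X \<inter> moved D p q Y) > 0"
proof (rule ccontr)
  assume n: "\<nexists>p q. swappable D p q \<and> emeasure N (X \<inter> moved D p q Y) > 0"
  note s = swap_invariant_sets[OF N]
  have m: "X \<inter> moved D p q Y \<in> sets N" for p q using X(1) sets_moved[OF D Y] s by auto
  have "(\<Union>(p, q)\<in>{(p, q). swappable D p q}. X \<inter> moved D p q Y) \<in> null_sets N"
    using n m countable_swappable[OF D] by (intro null_sets_UN') (auto simp: null_sets_def)
  moreover have "(\<Union>(p, q)\<in>{(p, q). swappable D p q}. X \<inter> moved D p q Y) = X"
    using X(2) unfolding saturation_eq_moved by blast
  ultimately show False using X(3) by auto
qed

lemma swap_invariant_saturated:
  assumes D: "bratteli D" and N: "swap_invariant D N" and P: "P \<in> sets seq_space" "saturation D P = P"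
  shows "swap_invariant D (ext_zero (restrict_space N P))"
  unfolding swap_invariant_def
proof (intro conjI allI impI ballI)
  note s = swap_invariant_sets[OF N]
  fix p q and Y :: "(nat \<Rightarrow> 'b) set" assume pq: "swappable D p q" and Y: "Y \<in> sets seq_space"
  have YP: "Y \<inter> P \<in> sets seq_space" using Y P by auto
  show "emeasure (ext_zero (restrict_space N P)) (moved D p q Y)
      = emeasure (ext_zero (restrict_space N P)) (Y \<inter> thin_cylinder D p)"
    using emeasure_ext_restrict[OF s P(1)] sets_moved[OF D Y] Y sets_thin_cylinder[OF D]
      moved_Int_saturated[OF pq P(2), of Y] swap_invariant_moved[OF N pq YP] by (simp add: Int_ac)
qed simp

lemma swap_invariant_nested:
  assumes A: "bratteli A" and AH: "A \<preceq> H" and N: "swap_invariant H N"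
  shows "swap_invariant A (ext_zero (restrict_space N (paths A)))"
  unfolding swap_invariant_def
proof (intro conjI allI impI ballI)
  note s = swap_invariant_sets[OF N] and P = sets_paths[OF A]
  fix p q and Y :: "(nat \<Rightarrow> 'b) set" assume pq: "swappable A p q" and Y: "Y \<in> sets seq_space"
  have pqH: "swappable H p q" by (rule swappable_nested[OF AH pq])
  have "moved A p q Y \<inter> paths A = moved H p q (Y \<inter> paths A)"
  proof (intro set_eqI iffI)
    fix y assume "y \<in> moved A p q Y \<inter> paths A"
    then have y: "y \<in> thin_cylinder A q" "replace_start p y \<in> Y" by (auto simp: moved_def)
    then show "y \<in> moved H p q (Y \<inter> paths A)"
      using replace_start_in_cylinder[OF swappable_sym[OF pq] y(1)] nested_thin_cylinder[OF AH]
      by (auto simp: moved_def thin_cylinder_def)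
  next
    fix y assume "y \<in> moved H p q (Y \<inter> paths A)"
    then have y: "y \<in> thin_cylinder H q" "replace_start p y \<in> Y" "replace_start p y \<in> paths A"
      by (auto simp: moved_def)
    have l: "length q = length p" using pq by (simp add: swappable_def)
    have "replace_start p y \<in> thin_cylinder A p"
      using y(3) by (auto simp: thin_cylinder_def replace_start_def)
    then have "replace_start q (replace_start p y) \<in> thin_cylinder A q"
      by (rule replace_start_in_cylinder[OF pq])
    then have "y \<in> thin_cylinder A q" using replace_start_inverse[OF y(1) l] by simp
    then show "y \<in> moved A p q Y \<inter> paths A"
      using y thin_cylinder_subset[of A q] by (auto simp: moved_def)
  qed
  moreover have "Y \<inter> paths A \<inter> thin_cylinder H p = Y \<inter> thin_cylinder A p \<inter> paths A"
    using nested_thin_cylinder[OF AH] by auto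
  moreover have "Y \<inter> paths A \<in> sets seq_space" using Y P by auto
  ultimately show "emeasure (ext_zero (restrict_space N (paths A))) (moved A p q Y)
      = emeasure (ext_zero (restrict_space N (paths A))) (Y \<inter> thin_cylinder A p)"
    using emeasure_ext_restrict[OF s P] sets_moved[OF A Y] Y sets_thin_cylinder[OF A]
      swap_invariant_moved[OF N pqH, of "Y \<inter> paths A"] by simp
qed simp

text \<open>An invariant set \<open>B\<close> of the smaller path space is the trace of its saturation in the larger
  one, to which ergodicity there applies.\<close>

lemma swap_ergodic_nested:
  assumes H: "bratteli H" and A: "bratteli A" and AH: "A \<preceq> H" and N: "swap_invariant H N"
    and erg: "swap_ergodic H N"
  shows "swap_ergodic A (ext_zero (restrict_space N (paths A)))"
  unfolding swap_ergodic_def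
proof (intro ballI impI)
  note s = swap_invariant_sets[OF N] and P = sets_paths[OF A]
  fix B :: "(nat \<Rightarrow> 'b) set" assume B: "B \<in> sets seq_space" "saturation A B = B"
  let ?S = "saturation H B"
  have BA: "B \<subseteq> paths A" using B(2) saturation_subset by blast
  have PA: "paths A \<subseteq> paths H" using nested_paths[OF AH] by blast
  have S: "?S \<in> sets seq_space" by (rule sets_saturation[OF H B(1)])
  have "?S \<inter> paths A \<subseteq> saturation A B"
    using BA by (auto simp: saturation_def)
  then have "paths A - B \<subseteq> paths H - ?S" using B(2) PA by blast
  moreover have "B \<subseteq> ?S" using BA PA by (intro subset_saturation) auto
  moreover have "emeasure N ?S = 0 \<or> emeasure N (paths H - ?S) = 0"
    using erg S saturation_saturation unfolding swap_ergodic_def by blast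
  moreover have "?S \<in> sets N" "paths H - ?S \<in> sets N" using S sets_paths[OF H] s by auto
  ultimately have "emeasure N B = 0 \<or> emeasure N (paths A - B) = 0"
    using emeasure_mono[of B ?S N] emeasure_mono[of "paths A - B" "paths H - ?S" N] by force
  moreover have "B \<inter> paths A = B" "(paths A - B) \<inter> paths A = paths A - B" using BA by auto
  ultimately show "emeasure (ext_zero (restrict_space N (paths A))) B = 0
      \<or> emeasure (ext_zero (restrict_space N (paths A))) (paths A - B) = 0"
    using emeasure_ext_restrict[OF s P B(1)] emeasure_ext_restrict[OF s P, of "paths A - B"] B(1) P
    by simp
qed

lemma tower_extension_restrict:
  assumes H: "bratteli H" and A: "bratteli A" and AH: "A \<preceq> H" and N: "swap_invariant H N"
  shows "tower_extension H A (restrict_space N (paths A)) = restrict_space N (tower_paths H A)"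
  unfolding tower_extension_def
proof (rule the_equality)
  note s = swap_invariant_sets[OF N] and P = sets_paths[OF A]
  let ?T = "tower_paths H A"
  have T: "?T \<in> sets seq_space" "saturation H ?T = ?T"
    by (rule sets_tower_paths[OF H], rule saturation_tower[OF H A AH])
  have PT: "paths A \<subseteq> ?T"
    unfolding tower_eq_saturation[OF H A AH] using nested_paths[OF AH] by (intro subset_saturation) blast
  note X = sets_borel_tower_top[OF H, of A]
  have sT: "sets (restrict_space N ?T) = {B \<in> sets seq_space. B \<subseteq> ?T}"
    by (rule sets_restrict_trace[OF s T(1)])
  have "invariant_measure H (tower_top H A) (restrict_space N ?T)"
    unfolding invariant_measure_iff[OF H X T] using sT X swap_invariant_saturated[OF H N T] by simp
  moreover have "restr A (restrict_space N ?T) = restrict_space N (paths A)"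
    unfolding restr_eq_restrict_space[OF A T(1) sT]
  proof (rule measure_eqI)
    show e: "sets (restrict_space (ext_zero (restrict_space N ?T)) (paths A)) = sets (restrict_space N (paths A))"
      using sets_restrict_trace[OF s P] sets_restrict_trace[of "ext_zero (restrict_space N ?T)" "paths A"] P
      by simp
    fix B assume "B \<in> sets (restrict_space (ext_zero (restrict_space N ?T)) (paths A))"
    then have B: "B \<in> sets seq_space" "B \<subseteq> paths A" using e sets_restrict_trace[OF s P] by auto
    then have "B \<inter> ?T = B" using PT by blast
    then show "emeasure (restrict_space (ext_zero (restrict_space N ?T)) (paths A)) B
        = emeasure (restrict_space N (paths A)) B"
      using emeasure_restrict_trace[OF s P B(2)] emeasure_restrict_trace[OF _ P B(2), of "ext_zero (restrict_space N ?T)"]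
        emeasure_ext_restrict[OF s T(1) B(1)] by simp
  qed
  ultimately show "invariant_measure H (tower_top H A) (restrict_space N ?T)
    \<and> restr A (restrict_space N ?T) = restrict_space N (paths A)" by blast
  fix \<rho> assume \<rho>: "invariant_measure H (tower_top H A) \<rho> \<and> restr A \<rho> = restrict_space N (paths A)"
  then have s\<rho>: "sets \<rho> = {B \<in> sets seq_space. B \<subseteq> ?T}" and i\<rho>: "swap_invariant H (ext_zero \<rho>)"
    unfolding invariant_measure_iff[OF H X T] using X by auto
  have "restrict_space (ext_zero \<rho>) (paths A) = restrict_space N (paths A)"
    using \<rho> restr_eq_restrict_space[OF A T(1) s\<rho>] by simp
  then have e: "emeasure (ext_zero \<rho>) Z = emeasure N Z" if "Z \<subseteq> paths A" for Z
    using emeasure_restrict_trace[OF s P that] emeasure_restrict_trace[OF _ P that, of "ext_zero \<rho>"] by simp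
  show "\<rho> = restrict_space N ?T"
  proof (rule measure_eqI)
    show "sets \<rho> = sets (restrict_space N ?T)" using s\<rho> sT by simp
    fix B assume "B \<in> sets \<rho>"
    then have B: "B \<in> sets seq_space" "B \<subseteq> ?T" using s\<rho> by auto
    then have "emeasure (ext_zero \<rho>) B = emeasure N B"
      using saturation_emeasure_eq[OF H i\<rho> N P e B(1)] tower_eq_saturation[OF H A AH] by simp
    then show "emeasure \<rho> B = emeasure (restrict_space N ?T) B"
      using emeasure_ext_zero[OF T(1) s\<rho> B(1)] emeasure_restrict_trace[OF s T(1) B(2)] B(2)
      by (simp add: Int_absorb2)
  qed
qed

lemma emeasure_Int_conull:
  assumes s: "C \<in> sets N" "P \<in> sets N" "Q \<in> sets N" and null: "emeasure N (Q - P) = 0" and CQ: "C \<subseteq> Q"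
  shows "emeasure N (C \<inter> P) = emeasure N C"
proof -
  have "emeasure N (C - P) = 0"
    using emeasure_mono[of "C - P" "Q - P" N] CQ s null by auto
  moreover have "emeasure N C = emeasure N (C \<inter> P) + emeasure N (C - P)"
    using s by (subst plus_emeasure) (auto intro!: arg_cong[where f = "emeasure N"])
  ultimately show ?thesis by simp
qed

text \<open>By ergodicity, a path space of positive measure has a conull tower.\<close>

lemma is_tower_measure_over_restr:
  assumes H: "bratteli H" and A: "bratteli A" and AH: "A \<preceq> H"
    and P: "P \<in> sets seq_space" and \<nu>: "sets \<nu> = {B \<in> sets seq_space. B \<subseteq> P}"
    and N: "swap_invariant H (ext_zero \<nu>)" and erg: "swap_ergodic H (ext_zero \<nu>)"
    and pos: "emeasure (ext_zero \<nu>) (paths A) > 0"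
  shows "emeasure (ext_zero \<nu>) (paths H - tower_paths H A) = 0"
    and "is_tower_measure_over H A (restr A \<nu>) \<nu>"
proof -
  let ?N = "ext_zero \<nu>" and ?T = "tower_paths H A"
  note s = swap_invariant_sets[OF N]
  have T: "?T \<in> sets seq_space" "saturation H ?T = ?T"
    by (rule sets_tower_paths[OF H], rule saturation_tower[OF H A AH])
  have PT: "paths A \<subseteq> ?T"
    unfolding tower_eq_saturation[OF H A AH] using nested_paths[OF AH] by (intro subset_saturation) blast
  have "emeasure ?N ?T > 0" using pos emeasure_mono[OF PT, of ?N] T(1) by (simp add: order_less_le_trans)
  then show null: "emeasure ?N (paths H - ?T) = 0"
    using erg T unfolding swap_ergodic_def by fastforce
  let ?\<rho> = "restrict_space ?N ?T"
  have s\<rho>: "sets ?\<rho> = {B \<in> sets seq_space. B \<subseteq> ?T}" by (rule sets_restrict_trace[OF s T(1)])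
  have "tower_extension H A (restr A \<nu>) = ?\<rho>"
    unfolding restr_eq_restrict_space[OF A P \<nu>] by (rule tower_extension_restrict[OF H A AH N])
  moreover have "restr H \<nu> = restr H ?\<rho>"
    unfolding restr_eq_restrict_space[OF H P \<nu>] restr_eq_restrict_space[OF H T(1) s\<rho>]
  proof (rule measure_eqI)
    note PH = sets_paths[OF H]
    show "sets (restrict_space ?N (paths H)) = sets (restrict_space (ext_zero ?\<rho>) (paths H))"
      using sets_restrict_trace[of ?N, OF _ PH] sets_restrict_trace[of "ext_zero ?\<rho>", OF _ PH] by simp
    fix B assume "B \<in> sets (restrict_space ?N (paths H))"
    then have B: "B \<in> sets seq_space" "B \<subseteq> paths H" using sets_restrict_trace[of ?N, OF _ PH] by auto
    have "emeasure ?N (B \<inter> ?T) = emeasure ?N B"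
      using B T(1) PH by (intro emeasure_Int_conull[OF _ _ _ null]) simp_all
    then show "emeasure (restrict_space ?N (paths H)) B
        = emeasure (restrict_space (ext_zero ?\<rho>) (paths H)) B"
      using emeasure_restrict_trace[OF _ PH B(2), of ?N] emeasure_restrict_trace[OF _ PH B(2), of "ext_zero ?\<rho>"]
        emeasure_ext_restrict[OF s T(1) B(1)] by simp
  qed
  ultimately show "is_tower_measure_over H A (restr A \<nu>) \<nu>" unfolding is_tower_measure_over_def by simp
qed

section \<open>Subdiagrams and the primitive core\<close>

fun gen_alph :: "('a, 'e) diagram \<Rightarrow> 'a set \<Rightarrow> (nat \<Rightarrow> 'e set) \<Rightarrow> nat \<Rightarrow> 'a set" where
  "gen_alph D S E 0 = S"
| "gen_alph D S E (Suc i) = tgt D i ` {e \<in> edges D i. e \<in> E i \<and> src D i e \<in> gen_alph D S E i}"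

text \<open>Keeping only what is reachable from \<open>S\<close> makes the diagram column-reduced again.\<close>

definition subdiagram :: "('a, 'e) diagram \<Rightarrow> 'a set \<Rightarrow> (nat \<Rightarrow> 'e set) \<Rightarrow> ('a, 'e) diagram" where
  "subdiagram D S E = \<lparr>alph = gen_alph D S E,
     edges = (\<lambda>i. {e \<in> edges D i. e \<in> E i \<and> src D i e \<in> gen_alph D S E i}), src = src D, tgt = tgt D\<rparr>"

lemma gen_alph_subset:
  assumes "bratteli D" "S \<subseteq> alph D 0" shows "gen_alph D S E i \<subseteq> alph D i"
  by (cases i) (use assms bratteli_tgt in fastforce)+

lemma
  assumes "bratteli D" "S \<subseteq> alph D 0"
  shows bratteli_subdiagram: "bratteli (subdiagram D S E)"
    and subdiagram_nested: "subdiagram D S E \<preceq> D"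
proof -
  have "finite (gen_alph D S E i)" for i
    using finite_subset[OF gen_alph_subset[OF assms] bratteli_finite(1)[OF assms(1)]] .
  then show "bratteli (subdiagram D S E)"
    using bratteli_finite(2)[OF assms(1)] unfolding bratteli_def subdiagram_def by auto
  show "subdiagram D S E \<preceq> D"
    using gen_alph_subset[OF assms] unfolding nested_def subdiagram_def by auto
qed

lemma paths_subdiagram:
  "paths (subdiagram D S E) = {x \<in> paths D. src D 0 (x 0) \<in> S \<and> (\<forall>i. x i \<in> E i)}"
proof (intro set_eqI iffI)
  fix x assume "x \<in> paths (subdiagram D S E)"
  then have "x i \<in> edges D i \<and> x i \<in> E i \<and> src D i (x i) \<in> gen_alph D S E i
      \<and> tgt D i (x i) = src D (Suc i) (x (Suc i))" for i
    by (auto simp: paths_def subdiagram_def)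
  then show "x \<in> {x \<in> paths D. src D 0 (x 0) \<in> S \<and> (\<forall>i. x i \<in> E i)}"
    unfolding paths_def by (auto simp: paths_def) (metis gen_alph.simps(1))
next
  fix x assume x: "x \<in> {x \<in> paths D. src D 0 (x 0) \<in> S \<and> (\<forall>i. x i \<in> E i)}"
  have "src D i (x i) \<in> gen_alph D S E i" for i
  proof (induction i)
    case (Suc i)
    then have "x i \<in> {e \<in> edges D i. e \<in> E i \<and> src D i e \<in> gen_alph D S E i}"
      using x by (auto simp: paths_def)
    then have "tgt D i (x i) \<in> gen_alph D S E (Suc i)" unfolding gen_alph.simps(2) by (rule imageI)
    moreover have "tgt D i (x i) = src D (Suc i) (x (Suc i))" using x by (simp add: paths_def)
    ultimately show ?case by metis
  qed (use x in auto)
  then show "x \<in> paths (subdiagram D S E)" using x by (auto simp: paths_def subdiagram_def)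
qed

lemma mat_pos:
  assumes "bratteli D" "e \<in> edges D i" shows "mat D i (src D i e) (tgt D i e) > 0"
  unfolding mat_def using bratteli_finite(2)[OF assms(1)] assms(2) by (auto simp: card_gt_0_iff)

lemma mprod_pos_Suc:
  assumes "bratteli D"
  shows "mprod D k (Suc m) a b > 0 \<longleftrightarrow> (\<exists>c\<in>alph D (Suc k). mat D k a c > 0 \<and> mprod D (Suc k) m c b > 0)"
proof -
  have "mprod D k (Suc m) a b = 0 \<longleftrightarrow> (\<forall>c\<in>alph D (Suc k). mat D k a c = 0 \<or> mprod D (Suc k) m c b = 0)"
    using bratteli_finite(1)[OF assms] by simp
  then show ?thesis by (metis neq0_conv)
qed

lemma mprod_pos_snoc:
  assumes D: "bratteli D"
  shows "mprod D k m a (src D (k + m) e) > 0 \<Longrightarrow> e \<in> edges D (k + m) \<Longrightarrow>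
    mprod D k (Suc m) a (tgt D (k + m) e) > 0"
proof (induction m arbitrary: k a)
  case 0
  then have "a = src D k e" by (simp split: if_splits)
  then show ?case
    unfolding mprod_pos_Suc[OF D] using mat_pos[OF D, of e k] bratteli_tgt[OF D, of e k] 0(2)
    by (intro bexI[of _ "tgt D k e"]) auto
next
  case (Suc m)
  then obtain c where c: "c \<in> alph D (Suc k)" "mat D k a c > 0" "mprod D (Suc k) m c (src D (k + Suc m) e) > 0"
    unfolding mprod_pos_Suc[OF D] by blast
  then have "mprod D (Suc k) (Suc m) c (tgt D (k + Suc m) e) > 0"
    using Suc.IH[of "Suc k" c] Suc.prems(2) by simp
  then show ?case unfolding mprod_pos_Suc[OF D, of k "Suc m"] using c by blast
qed

lemma gen_alph_through_symbol:
  assumes D: "bratteli D"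
  shows "b \<in> gen_alph D S (\<lambda>i. if i = k then {e. src D k e = a} else UNIV) (k + Suc m)
    \<Longrightarrow> mprod D k (Suc m) a b > 0"
proof (induction m arbitrary: b)
  case 0
  then obtain e where e: "e \<in> edges D k" "src D k e = a" "b = tgt D k e" by auto
  then have "mprod D k 0 a (src D (k + 0) e) > 0" by simp
  then show ?case using mprod_pos_snoc[OF D, of k 0 a e] e by simp
next
  case (Suc m)
  then obtain e where "e \<in> edges D (k + Suc m)" "b = tgt D (k + Suc m) e"
    "src D (k + Suc m) e \<in> gen_alph D S (\<lambda>i. if i = k then {e. src D k e = a} else UNIV) (k + Suc m)"
    by auto
  then show ?case using mprod_pos_snoc[OF D] Suc.IH by blast
qed

lemma cylinder_measure_eq:
  assumes D: "bratteli D" and DH: "D \<preceq> H" and N: "swap_invariant H N" and pq: "swappable D p q"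
  shows "emeasure N (thin_cylinder D p) = emeasure N (thin_cylinder D q)"
proof -
  have e: "emeasure (ext_zero (restrict_space N (paths D))) (thin_cylinder D u) = emeasure N (thin_cylinder D u)"
    for u
    using emeasure_ext_restrict[OF swap_invariant_sets[OF N] sets_paths[OF D] sets_thin_cylinder[OF D], of u]
      thin_cylinder_subset[of D u] by (simp add: Int_absorb2)
  have "moved D p q UNIV = thin_cylinder D q" by (auto simp: moved_def)
  then show ?thesis
    using swap_invariant_moved[OF swap_invariant_nested[OF D DH N] pq UNIV_in_seq_space] e[of p] e[of q]
    by simp
qed

text \<open>Symbols whose cylinders are null can be removed: by invariance all cylinders that end at the
  same symbol have the same measure, and there are countably many of them.\<close>

lemma remove_null_symbols:
  assumes D: "bratteli D" and DH: "D \<preceq> H" and N: "swap_invariant H N"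
  shows "\<exists>A. bratteli A \<and> A \<preceq> D \<and> emeasure N (paths D - paths A) = 0
    \<and> (\<forall>k. \<forall>a\<in>alph A k. emeasure N {x \<in> paths A. src A k (x k) = a} > 0)"
proof -
  note s = swap_invariant_sets[OF N]
  define pos where "pos i b \<longleftrightarrow>
    (\<exists>u. finite_path D u \<and> u \<noteq> [] \<and> length u = i \<and> end_symbol D u = b \<and> emeasure N (thin_cylinder D u) > 0)" for i b
  have posI: "emeasure N (thin_cylinder D u) > 0"
    if u: "finite_path D u" "u \<noteq> []" "pos (length u) (end_symbol D u)" for u
  proof -
    obtain v where "finite_path D v" "v \<noteq> []" "length v = length u" "end_symbol D v = end_symbol D u"
      "emeasure N (thin_cylinder D v) > 0" using u(3) unfolding pos_def by blast
    then show ?thesis using cylinder_measure_eq[OF D DH N, of u v] u unfolding swappable_def by simp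
  qed
  define E where "E i = {e. pos (Suc i) (tgt D i e)}" for i
  \<comment> \<open>No cylinder ends at level 0: a symbol of level 0 stays if it is the source of a remaining edge.\<close>
  define S where "S = {src D 0 e | e. e \<in> edges D 0 \<and> e \<in> E 0}"
  define A where "A = subdiagram D S E"
  have S: "S \<subseteq> alph D 0" using bratteli_src[OF D] unfolding S_def by auto
  have A: "bratteli A" "A \<preceq> D"
    unfolding A_def by (rule bratteli_subdiagram[OF D S], rule subdiagram_nested[OF D S])
  have pA: "paths A = {x \<in> paths D. \<forall>i. x i \<in> E i}"
    unfolding A_def paths_subdiagram S_def by (auto simp: paths_def)
  have sN: "paths A \<in> sets N" "paths D \<in> sets N" "thin_cylinder D u \<in> sets N" for u
    using sets_paths[OF A(1)] sets_paths[OF D] sets_thin_cylinder[OF D] s by auto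
  have null: "emeasure N (paths D - paths A) = 0"
  proof -
    let ?U = "{u. finite_path D u \<and> emeasure N (thin_cylinder D u) = 0}"
    have U: "(\<Union>u\<in>?U. thin_cylinder D u) \<in> null_sets N"
    proof (rule null_sets_UN')
      show "countable ?U"
        by (rule countable_subset[OF _ countable_finite_paths[OF D]]) blast
    qed (use sN(3) in \<open>simp add: null_sets_def\<close>)
    have "paths D - paths A \<subseteq> (\<Union>u\<in>?U. thin_cylinder D u)"
    proof
      fix x assume x: "x \<in> paths D - paths A"
      then obtain i where i: "x i \<notin> E i" and xD: "x \<in> paths D" using pA by blast
      let ?u = "map x [0..<Suc i]"
      have u: "finite_path D ?u" by (rule finite_path_prefix[OF xD])
      have "end_symbol D ?u = tgt D i (x i)" by (simp add: end_symbol_def)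
      then have "emeasure N (thin_cylinder D ?u) = 0"
        using i u unfolding E_def pos_def by (auto simp del: upt_Suc)
      then show "x \<in> (\<Union>u\<in>?U. thin_cylinder D u)"
        using u in_prefix_cylinder[OF xD] by blast
    qed
    then have "emeasure N (paths D - paths A) \<le> emeasure N (\<Union>u\<in>?U. thin_cylinder D u)"
      using null_setsD2[OF U] by (rule emeasure_mono)
    then show ?thesis using null_setsD1[OF U] by simp
  qed
  moreover have "emeasure N {x \<in> paths A. src A k (x k) = a} > 0" if a: "a \<in> alph A k" for k a
  proof -
    have sr: "src A = src D" unfolding A_def subdiagram_def by simp
    obtain u where u: "emeasure N (thin_cylinder D u) > 0" "\<And>x. x \<in> thin_cylinder D u \<Longrightarrow> src D k (x k) = a"
    proof (cases k)
      case 0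
      then obtain e where e: "e \<in> edges D 0" "e \<in> E 0" "a = src D 0 e"
        using a unfolding A_def subdiagram_def S_def by auto
      then have "emeasure N (thin_cylinder D [e]) > 0"
        using posI[of "[e]"] by (auto simp: finite_path_single E_def end_symbol_def)
      then show ?thesis using that[of "[e]"] e 0 by (auto simp: thin_cylinder_def)
    next
      case (Suc i)
      then have "pos k a" using a unfolding A_def subdiagram_def by (auto simp: E_def)
      then obtain u where "u \<noteq> []" "length u = k" "end_symbol D u = a" "emeasure N (thin_cylinder D u) > 0"
        unfolding pos_def by blast
      then show ?thesis using that[of u] end_symbol_cylinder[of _ D u] by metis
    qed
    have "thin_cylinder D u \<inter> paths A \<subseteq> {x \<in> paths A. src A k (x k) = a}" using u(2) sr by auto
    moreover have "{x \<in> paths A. src A k (x k) = a} \<in> sets N"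
      using sets.Int[OF sets_paths[OF A(1)] seq_space_coordinate[of k "{e. src A k e = a}"]] s
      by (simp add: Collect_conj_eq[symmetric] Int_def)
    ultimately have "emeasure N (thin_cylinder D u \<inter> paths A) \<le> emeasure N {x \<in> paths A. src A k (x k) = a}"
      by (rule emeasure_mono)
    moreover have "emeasure N (thin_cylinder D u \<inter> paths A) = emeasure N (thin_cylinder D u)"
      by (rule emeasure_Int_conull[OF sN(3,1,2) null thin_cylinder_subset])
    ultimately show ?thesis using u(1) by simp
  qed
  ultimately show ?thesis using A by blast
qed

text \<open>Among the subdiagrams whose path spaces have positive measure, take one whose alphabets have
  the least possible size infinitely often, and remove its null symbols. The paths through a
  given symbol \<open>a\<close> then carry positive measure, so by minimality all but finitely many of the levels
  of least size consist of symbols reachable from \<open>a\<close>. Boundedness of the alphabets guarantees that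
  some size occurs infinitely often.\<close>

lemma primitive_core:
  assumes H: "bounded_alphabet H" "bratteli H" and N: "swap_invariant H N"
    and D: "bratteli D" "D \<preceq> H" and pos: "emeasure N (paths D) > 0" and fin: "emeasure N (paths D) < \<infinity>"
  shows "\<exists>A. bratteli A \<and> primitive A \<and> A \<preceq> D \<and> 0 < emeasure N (paths A) \<and> emeasure N (paths A) < \<infinity>"
proof -
  note s = swap_invariant_sets[OF N]
  define Q where "Q j \<longleftrightarrow> (\<exists>D'. bratteli D' \<and> D' \<preceq> D \<and> emeasure N (paths D') > 0
    \<and> (\<forall>n. \<exists>i\<ge>n. card (alph D' i) \<le> j))" for j
  obtain K where K: "\<And>i. card (alph H i) \<le> K" using H(1) unfolding bounded_alphabet_def by blast
  have "card (alph D i) \<le> K" for i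
  proof -
    have "alph D i \<subseteq> alph H i" using nested_alph[OF D(2)] by blast
    then show ?thesis using card_mono[OF bratteli_finite(1)[OF H(2)]] K order_trans by blast
  qed
  then have "Q K" unfolding Q_def using D pos nested_refl[of D] by blast
  define j where "j = (LEAST j. Q j)"
  have Qj: "Q j" unfolding j_def using \<open>Q K\<close> by (rule LeastI)
  have minimal: "\<exists>n. \<forall>i\<ge>n. j \<le> card (alph D' i)"
    if "bratteli D'" "D' \<preceq> D" "emeasure N (paths D') > 0" for D'
  proof (rule ccontr)
    assume "\<not> (\<exists>n. \<forall>i\<ge>n. j \<le> card (alph D' i))"
    then have *: "\<exists>i\<ge>n. card (alph D' i) < j" for n by (meson not_le)
    then obtain j' where j: "j = Suc j'" by (metis less_nat_zero_code not0_implies_Suc)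
    then have "Q j'" unfolding Q_def using that * by (metis less_Suc_eq_le)
    then have "j \<le> j'" unfolding j_def by (rule Least_le)
    then show False using j by simp
  qed
  obtain D' where D': "bratteli D'" "D' \<preceq> D" "emeasure N (paths D') > 0"
    "\<And>n. \<exists>i\<ge>n. card (alph D' i) \<le> j" using Qj unfolding Q_def by blast
  obtain A where A: "bratteli A" "A \<preceq> D'" "emeasure N (paths D' - paths A) = 0"
    and Apos: "\<And>k a. a \<in> alph A k \<Longrightarrow> emeasure N {x \<in> paths A. src A k (x k) = a} > 0"
    using remove_null_symbols[OF D'(1) nested_trans[OF D'(2) D(2)] N] by blast
  have AD: "A \<preceq> D" by (rule nested_trans[OF A(2) D'(2)])
  have sub: "paths A \<subseteq> paths D'" "paths A \<subseteq> paths D" using nested_paths A(2) AD by blast+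
  have "emeasure N (paths D' \<inter> paths A) = emeasure N (paths D')"
    by (rule emeasure_Int_conull[where Q = "paths D'"])
      (use sets_paths[OF A(1)] sets_paths[OF D'(1)] s A(3) in auto)
  then have pA: "emeasure N (paths A) > 0" using D'(3) sub(1) by (simp add: Int_absorb1)
  have fA: "emeasure N (paths A) < \<infinity>"
    using emeasure_mono[OF sub(2), of N] sets_paths[OF D(1)] s fin by (metis order_le_less_trans)
  have "primitive A"
    unfolding primitive_def
  proof
    fix k
    let ?E = "\<lambda>a i. if i = k then {e. src A k e = a} else UNIV"
    \<comment> \<open>Restricting the edges of level \<open>k\<close> to those from \<open>a\<close> leaves the paths through \<open>a\<close>.\<close>
    let ?B = "\<lambda>a. subdiagram A (alph A 0) (?E a)"
    have "\<exists>n. \<forall>i\<ge>n. j \<le> card (alph (?B a) i)" if a: "a \<in> alph A k" for a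
    proof (rule minimal)
      show "bratteli (?B a)" by (rule bratteli_subdiagram[OF A(1)]) simp
      show "?B a \<preceq> D" by (rule nested_trans[OF subdiagram_nested[OF A(1)] AD]) simp
      have "paths (?B a) = {x \<in> paths A. src A k (x k) = a}"
        unfolding paths_subdiagram using bratteli_src[OF A(1)] by (auto simp: paths_def split: if_splits)
      then show "emeasure N (paths (?B a)) > 0" using Apos[OF a] by simp
    qed
    then have "\<forall>a\<in>alph A k. \<forall>\<^sub>F i in sequentially. j \<le> card (alph (?B a) i)"
      unfolding eventually_sequentially by blast
    then have "\<forall>\<^sub>F i in sequentially. \<forall>a\<in>alph A k. j \<le> card (alph (?B a) i)"
      using bratteli_finite(1)[OF A(1)] by (simp add: eventually_ball_finite)
    then obtain n where n: "\<And>i a. i \<ge> n \<Longrightarrow> a \<in> alph A k \<Longrightarrow> j \<le> card (alph (?B a) i)"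
      unfolding eventually_sequentially by blast
    obtain i where i: "i \<ge> n + k + 2" "card (alph D' i) \<le> j" using D'(4) by blast
    have "mprod A k (Suc (i - 1) - k) a b > 0" if a: "a \<in> alph A k" and b: "b \<in> alph A (Suc (i - 1))" for a b
    proof -
      have s1: "alph (?B a) i \<subseteq> alph A i"
        using gen_alph_subset[OF A(1), of "alph A 0"] by (simp add: subdiagram_def)
      have s2: "alph A i \<subseteq> alph D' i" using nested_alph[OF A(2)] by blast
      have "card (alph A i) \<le> card (alph (?B a) i)"
        using card_mono[OF bratteli_finite(1)[OF D'(1)] s2] i n[OF _ a, of i] by linarith
      then have "alph (?B a) i = alph A i"
        using card_seteq[OF bratteli_finite(1)[OF A(1)] s1] by simp
      then have "b \<in> gen_alph A (alph A 0) (?E a) (k + Suc (i - k - 1))"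
        using b i by (simp add: subdiagram_def)
      then have "mprod A k (Suc (i - k - 1)) a b > 0" by (rule gen_alph_through_symbol[OF A(1)])
      moreover have "Suc (i - k - 1) = Suc (i - 1) - k" using i by simp
      ultimately show ?thesis by metis
    qed
    then show "\<exists>n>k. \<forall>a\<in>alph A k. \<forall>b\<in>alph A (Suc n). mprod A k (Suc n - k) a b > 0"
      using i(1) by (intro exI[of _ "i - 1"]) auto
  qed
  then show ?thesis using A(1) AD pA fA by blast
qed

section \<open>Measures from eigenvector sequences\<close>

lemma sum_edges_by_target:
  fixes f :: "'a \<Rightarrow> real"
  assumes D: "bratteli D"
  shows "(\<Sum>e\<in>{e \<in> edges D i. src D i e = a}. f (tgt D i e))
    = (\<Sum>b\<in>alph D (Suc i). real (mat D i a b) * f b)"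
proof -
  let ?S = "{e \<in> edges D i. src D i e = a}"
  have "finite ?S" using bratteli_finite(2)[OF D] by simp
  moreover have "tgt D i ` ?S \<subseteq> alph D (Suc i)" using bratteli_tgt[OF D] by auto
  ultimately have "(\<Sum>e\<in>?S. f (tgt D i e))
      = (\<Sum>b\<in>alph D (Suc i). \<Sum>e\<in>{e \<in> ?S. tgt D i e = b}. f (tgt D i e))"
    using bratteli_finite(1)[OF D] by (intro sum.group[symmetric]) auto
  also have "\<dots> = (\<Sum>b\<in>alph D (Suc i). real (mat D i a b) * f b)"
  proof (rule sum.cong[OF refl])
    fix b
    have "(\<Sum>e\<in>{e \<in> ?S. tgt D i e = b}. f (tgt D i e)) = (\<Sum>e\<in>{e \<in> ?S. tgt D i e = b}. f b)"
      by (rule sum.cong) auto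
    moreover have "{e \<in> ?S. tgt D i e = b} = {e \<in> edges D i. src D i e = a \<and> tgt D i e = b}" by auto
    ultimately show "(\<Sum>e\<in>{e \<in> ?S. tgt D i e = b}. f (tgt D i e)) = real (mat D i a b) * f b"
      unfolding mat_def by simp
  qed
  finally show ?thesis .
qed

lemma V0_off_alph: "w \<in> V0 D \<Longrightarrow> a \<notin> alph D i \<Longrightarrow> w i a = 0"
  unfolding V0_def by blast

lemma V0_nonneg: assumes "w \<in> V0 D" shows "w i a \<ge> 0"
proof (cases "a \<in> alph D i")
  case True
  then show ?thesis using assms unfolding V0_def by blast
qed (simp add: V0_off_alph[OF assms])

lemma V0_step:
  "w \<in> V0 D \<Longrightarrow> a \<in> alph D i \<Longrightarrow> w i a = (\<Sum>b\<in>alph D (Suc i). real (mat D i a b) * w (Suc i) b)"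
  unfolding V0_def by blast

lemma emeasure_cylinder_split:
  assumes D: "bratteli D" and s: "sets N = sets seq_space" and u: "u \<noteq> []" and X: "X \<in> sets seq_space"
  shows "emeasure N (thin_cylinder D u \<inter> X) =
    (\<Sum>e\<in>{e \<in> edges D (length u). src D (length u) e = end_symbol D u}. emeasure N (thin_cylinder D (u @ [e]) \<inter> X))"
    (is "_ = sum _ ?E")
proof -
  have "disjoint_family_on (\<lambda>e. thin_cylinder D (u @ [e]) \<inter> X) ?E"
    unfolding disjoint_family_on_def
  proof (intro ballI impI equals0I)
    fix e f x assume "e \<noteq> f" "x \<in> thin_cylinder D (u @ [e]) \<inter> X \<inter> (thin_cylinder D (u @ [f]) \<inter> X)"
    then show False using thin_cylinder_disjoint[of "u @ [e]" "u @ [f]" x D] by simp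
  qed
  moreover have "(\<lambda>e. thin_cylinder D (u @ [e]) \<inter> X) ` ?E \<subseteq> sets N"
    using sets_thin_cylinder[OF D] X s by auto
  moreover have "finite ?E" using bratteli_finite(2)[OF D] by simp
  ultimately have "(\<Sum>e\<in>?E. emeasure N (thin_cylinder D (u @ [e]) \<inter> X))
      = emeasure N (\<Union>e\<in>?E. thin_cylinder D (u @ [e]) \<inter> X)"
    by (intro sum_emeasure)
  also have "(\<Union>e\<in>?E. thin_cylinder D (u @ [e]) \<inter> X) = thin_cylinder D u \<inter> X"
    using thin_cylinder_snoc[OF u, of D] by auto
  finally show ?thesis by simp
qed

text \<open>Unlike in \<open>is_eigen_measure\<close>, the measure may live on a larger path space, and \<open>w\<close> may vanish.\<close>

definition eigen_weights :: "('a, 'e) diagram \<Rightarrow> (nat \<Rightarrow> 'a \<Rightarrow> real) \<Rightarrow> (nat \<Rightarrow> 'e) measure \<Rightarrow> bool" where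
  "eigen_weights D w N \<longleftrightarrow> w \<in> V0 D \<and> (\<forall>u. finite_path D u \<and> u \<noteq> [] \<longrightarrow>
     emeasure N (thin_cylinder D u) = ennreal (w (length u) (end_symbol D u)))"

text \<open>There is no cylinder to read off the weights at level 0, so these come from the eigenvector
  equation.\<close>

lemma eigen_weights_exist:
  assumes A: "bratteli A" and N: "swap_invariant A N" and fin: "emeasure N (paths A) < \<infinity>"
  shows "\<exists>w. eigen_weights A w N"
proof -
  note s = swap_invariant_sets[OF N]
  define rep where "rep i a = (SOME u. finite_path A u \<and> length u = i \<and> end_symbol A u = a)" for i a
  have rep: "finite_path A (rep i a)" "length (rep i a) = i" "end_symbol A (rep i a) = a" "rep i a \<noteq> []"
    if "i > 0" "a \<in> alph A i" for i a
    using someI_ex[OF finite_path_to_symbol[OF A that]] that unfolding rep_def by auto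
  have finc: "emeasure N (thin_cylinder A u) \<noteq> \<infinity>" for u
    using emeasure_mono[OF thin_cylinder_subset[of A u], of N] sets_paths[OF A] s fin
    by (metis infinity_ennreal_def neq_top_trans less_top)
  define m where "m i a = measure N (thin_cylinder A (rep i a))" for i a
  have m: "emeasure N (thin_cylinder A u) = ennreal (m (length u) (end_symbol A u))"
    if u: "finite_path A u" "u \<noteq> []" for u
  proof -
    have "end_symbol A u \<in> alph A (length u)" by (rule end_symbol_alph[OF A u])
    then have "swappable A u (rep (length u) (end_symbol A u))"
      using rep[of "length u" "end_symbol A u"] u by (auto simp: swappable_def)
    then have "emeasure N (thin_cylinder A u) = emeasure N (thin_cylinder A (rep (length u) (end_symbol A u)))"
      by (rule cylinder_measure_eq[OF A nested_refl N])
    then show ?thesis unfolding m_def using finc by (simp add: emeasure_eq_ennreal_measure)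
  qed
  have m_step: "m i a = (\<Sum>b\<in>alph A (Suc i). real (mat A i a b) * m (Suc i) b)"
    if ia: "i > 0" "a \<in> alph A i" for i a
  proof -
    let ?u = "rep i a" and ?E = "{e \<in> edges A i. src A i e = a}"
    note r = rep[OF ia]
    have "ennreal (m i a) = emeasure N (thin_cylinder A ?u)" using m[OF r(1) r(4)] r by simp
    also have "\<dots> = (\<Sum>e\<in>?E. emeasure N (thin_cylinder A (?u @ [e])))"
      using emeasure_cylinder_split[OF A s r(4) UNIV_in_seq_space] r by simp
    also have "\<dots> = (\<Sum>e\<in>?E. ennreal (m (Suc i) (tgt A i e)))"
    proof (rule sum.cong[OF refl])
      fix e assume "e \<in> ?E"
      then have "finite_path A (?u @ [e])" using r finite_path_snoc[OF r(4)] by auto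
      then show "emeasure N (thin_cylinder A (?u @ [e])) = ennreal (m (Suc i) (tgt A i e))"
        using m[of "?u @ [e]"] r by (simp add: end_symbol_snoc)
    qed
    also have "\<dots> = ennreal (\<Sum>e\<in>?E. m (Suc i) (tgt A i e))"
      by (rule sum_ennreal) (simp add: m_def)
    finally have "m i a = (\<Sum>e\<in>?E. m (Suc i) (tgt A i e))"
      by (subst (asm) ennreal_inj) (auto simp: m_def intro: sum_nonneg)
    then show ?thesis using sum_edges_by_target[OF A, of "m (Suc i)" i a] by simp
  qed
  define w where "w i a = (if a \<notin> alph A i then 0
    else if i = 0 then (\<Sum>b\<in>alph A 1. real (mat A 0 a b) * m 1 b) else m i a)" for i a
  have "w \<in> V0 A"
    unfolding V0_def
  proof (intro CollectI conjI allI impI ballI)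
    fix i a assume a: "a \<in> alph A i"
    show "w i a \<ge> 0" unfolding w_def m_def by (auto intro!: sum_nonneg)
    have "w (Suc i) b = m (Suc i) b" if "b \<in> alph A (Suc i)" for b using that by (simp add: w_def)
    then show "w i a = (\<Sum>b\<in>alph A (Suc i). real (mat A i a b) * w (Suc i) b)"
      using a m_step[of i a] by (auto simp: w_def[of i])
  qed (simp add: w_def)
  moreover have "emeasure N (thin_cylinder A u) = ennreal (w (length u) (end_symbol A u))"
    if u: "finite_path A u" "u \<noteq> []" for u
    using m[OF u] end_symbol_alph[OF A u] u(2) by (simp add: w_def)
  ultimately show ?thesis unfolding eigen_weights_def by blast
qed

lemma eigen_weights_unique:
  assumes A: "bratteli A" and w: "eigen_weights A w N" "eigen_weights A w' N" shows "w = w'"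
proof -
  have V: "w \<in> V0 A" "w' \<in> V0 A" using w by (auto simp: eigen_weights_def)
  have 1: "w (Suc i) a = w' (Suc i) a" for i a
  proof (cases "a \<in> alph A (Suc i)")
    case True
    then obtain u where u: "finite_path A u" "length u = Suc i" "end_symbol A u = a"
      using finite_path_to_symbol[OF A, of "Suc i" a] by blast
    then have "u \<noteq> []" by auto
    then have "ennreal (w (Suc i) a) = ennreal (w' (Suc i) a)"
      using w u unfolding eigen_weights_def by metis
    then show ?thesis using V0_nonneg[OF V(1)] V0_nonneg[OF V(2)] by (simp add: ennreal_inj)
  qed (use V0_off_alph V in metis)
  have "w 0 a = w' 0 a" for a
    using V0_step[OF V(1), of a 0] V0_step[OF V(2), of a 0] V0_off_alph[OF V(1), of a 0]
      V0_off_alph[OF V(2), of a 0] 1 by (cases "a \<in> alph A 0") auto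
  then have "w i a = w' i a" for i a using 1 by (cases i) auto
  then show ?thesis by blast
qed

lemma paths_eq_cylinders: "paths D = (\<Union>u\<in>{u. finite_path D u \<and> length u = n}. thin_cylinder D u)"
proof
  show "paths D \<subseteq> (\<Union>u\<in>{u. finite_path D u \<and> length u = n}. thin_cylinder D u)"
  proof
    fix x assume x: "x \<in> paths D"
    show "x \<in> (\<Union>u\<in>{u. finite_path D u \<and> length u = n}. thin_cylinder D u)"
      by (rule UN_I[of "map x [0..<n]"]) (use finite_path_prefix[OF x] in_prefix_cylinder[OF x] in auto)
  qed
qed (use thin_cylinder_subset in blast)

lemma eigen_weights_V:
  assumes A: "bratteli A" and s: "sets N = sets seq_space" and w: "eigen_weights A w N"
    and pos: "emeasure N (paths A) > 0"
  shows "w \<in> V A"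
proof -
  have V: "w \<in> V0 A" using w by (simp add: eigen_weights_def)
  have 1: "\<exists>a\<in>alph A (Suc i). w (Suc i) a \<noteq> 0" for i
  proof (rule ccontr)
    assume n: "\<not> (\<exists>a\<in>alph A (Suc i). w (Suc i) a \<noteq> 0)"
    let ?F = "{u. finite_path A u \<and> length u = Suc i}"
    have "emeasure N (thin_cylinder A u) = 0" if u: "u \<in> ?F" for u
    proof -
      have "u \<noteq> []" using u by auto
      then show ?thesis using u w n end_symbol_alph[OF A, of u] by (auto simp: eigen_weights_def)
    qed
    then have "(\<Union>u\<in>?F. thin_cylinder A u) \<in> null_sets N"
      using sets_thin_cylinder[OF A] s countable_finite[OF finite_finite_paths[OF A]]
      by (intro null_sets_UN') (auto simp: null_sets_def)
    then show False using pos paths_eq_cylinders[of A "Suc i"] by auto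
  qed
  have "\<exists>a\<in>alph A 0. w 0 a \<noteq> 0"
  proof -
    obtain b where b: "b \<in> alph A (Suc 0)" "w (Suc 0) b \<noteq> 0" using 1 by blast
    obtain e where e: "e \<in> edges A 0" "tgt A 0 e = b" using bratteli_incoming[OF A b(1)] by blast
    have a: "src A 0 e \<in> alph A 0" by (rule bratteli_src[OF A e(1)])
    have "mat A 0 (src A 0 e) b > 0" using mat_pos[OF A e(1)] e(2) by simp
    then have "real (mat A 0 (src A 0 e) b) * w (Suc 0) b \<noteq> 0" using b by simp
    then have "w 0 (src A 0 e) \<noteq> 0"
      unfolding V0_step[OF V a] using b(1) bratteli_finite(1)[OF A] V0_nonneg[OF V]
      by (subst sum_nonneg_eq_0_iff) auto
    then show ?thesis using a by blast
  qed
  then have "\<exists>a\<in>alph A i. w i a \<noteq> 0" for i using 1 by (cases i) auto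
  then show ?thesis using V by (simp add: V_def)
qed

lemma prefix_in_cylinder: "x \<in> thin_cylinder D z \<Longrightarrow> k \<le> length z \<Longrightarrow> map x [0..<k] = take k z"
  by (rule nth_equalityI) (auto simp: thin_cylinder_def)

lemma in_shorter_cylinder:
  assumes "x \<in> thin_cylinder D z" "length v \<le> length z"
  shows "x \<in> thin_cylinder D v \<longleftrightarrow> take (length v) z = v"
  using prefix_in_cylinder[OF assms] assms(1) thin_cylinder_subset[of D z]
  by (auto simp: thin_cylinder_iff[of x D v])

lemma cylinder_Int:
  assumes "length v \<le> length z"
  shows "thin_cylinder D z \<inter> thin_cylinder D v = (if take (length v) z = v then thin_cylinder D z else {})"
  using in_shorter_cylinder[OF _ assms] by auto

lemma cylinder_Int_cases:
  "thin_cylinder D u \<inter> thin_cylinder D v \<in> {{}, thin_cylinder D u, thin_cylinder D v}"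
proof (cases "length v \<le> length u")
  case False
  then show ?thesis using cylinder_Int[of u v D] by (auto simp: Int_commute)
qed (simp add: cylinder_Int)

text \<open>A symbol of positive weight has an outgoing edge into a symbol of positive weight, hence
  finite paths of positive weight do not run into dead ends.\<close>

lemma positive_weight_cylinder_nonempty:
  assumes D: "bratteli D" and w: "w \<in> V0 D" and u: "finite_path D u" "u \<noteq> []"
    and pos: "w (length u) (end_symbol D u) > 0"
  shows "thin_cylinder D u \<noteq> {}"
proof -
  have step: "\<exists>e. e \<in> edges D i \<and> src D i e = a \<and> w (Suc i) (tgt D i e) > 0" if "w i a > 0" for i a
  proof -
    have "a \<in> alph D i" using that V0_off_alph[OF w] by fastforce
    then have "(\<Sum>e\<in>{e \<in> edges D i. src D i e = a}. w (Suc i) (tgt D i e)) > 0"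
      using that V0_step[OF w] sum_edges_by_target[OF D, of "w (Suc i)" i a] by simp
    then obtain e where "e \<in> {e \<in> edges D i. src D i e = a}" "w (Suc i) (tgt D i e) > 0"
      by (metis (no_types, lifting) not_less sum_nonpos)
    then show ?thesis by blast
  qed
  let ?n = "length u"
  let ?P = "\<lambda>k e. e \<in> edges D (?n + k) \<and> w (Suc (?n + k)) (tgt D (?n + k) e) > 0
    \<and> (k = 0 \<longrightarrow> src D ?n e = end_symbol D u)"
  let ?Q = "\<lambda>k e f. tgt D (?n + k) e = src D (?n + Suc k) f"
  have "\<exists>f. \<forall>k. ?P k (f k) \<and> ?Q k (f k) (f (Suc k))"
  proof (rule dependent_nat_choice)
    show "\<exists>e. ?P 0 e" using step[OF pos] by auto
    fix e k assume "?P k e"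
    then show "\<exists>f. ?P (Suc k) f \<and> ?Q k e f" using step[of "Suc (?n + k)" "tgt D (?n + k) e"] by fastforce
  qed
  then obtain f where f: "\<And>k. ?P k (f k)" "\<And>k. ?Q k (f k) (f (Suc k))" by blast
  let ?x = "\<lambda>i. if i < ?n then u ! i else f (i - ?n)"
  have "?x \<in> paths D"
    unfolding paths_def
  proof (intro CollectI allI conjI)
    fix i
    show "?x i \<in> edges D i" using u f(1)[of "i - ?n"] by (auto simp: finite_path_def)
    consider "Suc i < ?n" | "Suc i = ?n" | "i \<ge> ?n" by linarith
    then show "tgt D i (?x i) = src D (Suc i) (?x (Suc i))"
    proof cases
      case 2
      then have "i = ?n - 1" by simp
      then show ?thesis using f(1)[of 0] 2 u(2) by (auto simp: end_symbol_nth)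
    next
      case 3
      then show ?thesis using f(2)[of "i - ?n"] by (simp add: Suc_diff_le)
    qed (use u in \<open>auto simp: finite_path_def\<close>)
  qed
  then have "?x \<in> thin_cylinder D u" by (simp add: thin_cylinder_def)
  then show ?thesis by blast
qed

lemma weight_sum_over_level:
  assumes D: "bratteli D" and w: "w \<in> V0 D" and v: "finite_path D v" "v \<noteq> []" and n: "length v \<le> n"
  shows "w (length v) (end_symbol D v)
    = (\<Sum>u\<in>{u. finite_path D u \<and> length u = n \<and> take (length v) u = v}. w n (end_symbol D u))"
  using n
proof (induction n rule: dec_induct)
  case base
  have "{u. finite_path D u \<and> length u = length v \<and> take (length v) u = v} = {v}" using v by auto
  then show ?case by simp
next
  case (step n)
  let ?T = "\<lambda>n. {u. finite_path D u \<and> length u = n \<and> take (length v) u = v}"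
  let ?E = "\<lambda>u. {e \<in> edges D n. src D n e = end_symbol D u}"
  have fT: "finite (?T n)" by (rule finite_subset[OF _ finite_finite_paths[OF D, of n]]) auto
  have fE: "finite (?E u)" for u using bratteli_finite(2)[OF D] by simp
  have "w n (end_symbol D u) = (\<Sum>e\<in>?E u. w (Suc n) (tgt D n e))" if u: "u \<in> ?T n" for u
  proof -
    have "u \<noteq> []" using u v step(1) by auto
    then have "end_symbol D u \<in> alph D n" using end_symbol_alph[OF D, of u] u by auto
    then show ?thesis
      using V0_step[OF w] sum_edges_by_target[OF D, of "w (Suc n)" n "end_symbol D u"] by simp
  qed
  then have "w (length v) (end_symbol D v) = (\<Sum>u\<in>?T n. \<Sum>e\<in>?E u. w (Suc n) (tgt D n e))"
    using step.IH by simp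
  also have "\<dots> = (\<Sum>(u, e)\<in>(SIGMA u:?T n. ?E u). w (Suc n) (tgt D n e))"
    by (rule sum.Sigma) (use fT fE in auto)
  also have "\<dots> = (\<Sum>u\<in>?T (Suc n). w (Suc n) (end_symbol D u))"
  proof (rule sum.reindex_bij_witness[of _ "\<lambda>u. (butlast u, last u)" "\<lambda>(u, e). u @ [e]"])
    fix p assume "p \<in> (SIGMA u:?T n. ?E u)"
    then obtain u e where p: "p = (u, e)" "u \<in> ?T n" "e \<in> ?E u" by blast
    then have "u \<noteq> []" using v step(1) by auto
    then show "(case p of (u, e) \<Rightarrow> u @ [e]) \<in> ?T (Suc n)"
      using p step(1) by (auto simp: finite_path_snoc)
    show "w (Suc n) (end_symbol D (case p of (u, e) \<Rightarrow> u @ [e]))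
        = (case p of (u, e) \<Rightarrow> w (Suc n) (tgt D n e))"
      using p by (auto simp: end_symbol_snoc)
  next
    fix u assume u: "u \<in> ?T (Suc n)"
    then have u0: "u \<noteq> []" by auto
    then have eq: "butlast u @ [last u] = u" by simp
    have "butlast u \<noteq> []" using u v step(1) by (cases u) auto
    moreover have "length (butlast u) = n" using u by simp
    moreover have "take (length v) (butlast u) = take (length v) u"
      using u step(1) by (simp add: take_butlast)
    ultimately show "(butlast u, last u) \<in> (SIGMA u:?T n. ?E u)"
      using u finite_path_snoc[of "butlast u" D "last u"] eq by auto
    show "(case (butlast u, last u) of (u, e) \<Rightarrow> u @ [e]) = u" using eq by simp
  qed auto
  finally show ?case .
qed

lemma closedin_path_space:
  assumes D: "bratteli D"
  shows "closedin (product_topology (\<lambda>i. discrete_topology (edges D i)) UNIV) (paths D)"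
proof -
  let ?T = "product_topology (\<lambda>i. discrete_topology (edges D i)) UNIV"
  have c: "closedin ?T {x \<in> topspace ?T. x i \<in> {e} \<inter> edges D i}" for i e
    by (rule closedin_continuous_map_preimage[OF continuous_map_product_projection]) auto
  let ?C = "\<lambda>i (e, f). {x \<in> topspace ?T. x i \<in> {e} \<inter> edges D i}
    \<inter> {x \<in> topspace ?T. x (Suc i) \<in> {f} \<inter> edges D (Suc i)}"
  have "closedin ?T (\<Inter>i. \<Union>p\<in>composable D i. ?C i p)"
    using closedin_Int[OF c c] finite_composable[OF D]
    by (intro closedin_INT closedin_Union) auto
  also have "(\<Inter>i. \<Union>p\<in>composable D i. ?C i p) = paths D"
    by (auto simp: paths_def composable_def)
  finally show ?thesis .
qed

lemma compact_space_path_top: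
  assumes D: "bratteli D" shows "compact_space (path_top D)"
proof -
  have "compact_space (product_topology (\<lambda>i. discrete_topology (edges D i)) UNIV)"
    using bratteli_finite(2)[OF D] by (simp add: compact_space_product_topology compact_space_discrete_topology)
  then show ?thesis
    unfolding path_top_def using closedin_path_space[OF D]
    by (intro compact_space_subtopology closedin_compact_space)
qed

lemma openin_thin_cylinder: "openin (path_top D) (thin_cylinder D u)"
  unfolding openin_path_top
proof (intro conjI ballI)
  fix x assume "x \<in> thin_cylinder D u"
  then show "\<exists>n. \<forall>y\<in>paths D. (\<forall>i<n. y i = x i) \<longrightarrow> y \<in> thin_cylinder D u"
    by (intro exI[of _ "length u"]) (auto simp: thin_cylinder_def)
qed (rule thin_cylinder_subset)

lemma compactin_thin_cylinder:
  assumes D: "bratteli D" shows "compactin (path_top D) (thin_cylinder D u)"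
proof (rule closedin_compact_space[OF compact_space_path_top[OF D]])
  have "openin (path_top D) (paths D - thin_cylinder D u)"
    unfolding openin_path_top
  proof (intro conjI ballI)
    fix x assume "x \<in> paths D - thin_cylinder D u"
    then show "\<exists>n. \<forall>y\<in>paths D. (\<forall>i<n. y i = x i) \<longrightarrow> y \<in> paths D - thin_cylinder D u"
      by (intro exI[of _ "length u"]) (auto simp: thin_cylinder_def)
  qed blast
  then show "closedin (path_top D) (thin_cylinder D u)"
    unfolding closedin_def topspace_path_top using thin_cylinder_subset by blast
qed

lemma semiring_of_cylinders:
  assumes D: "bratteli D"
  shows "semiring_of_sets (paths D) (insert {} (thin_cylinder D ` {u. finite_path D u \<and> u \<noteq> []}))"
    (is "semiring_of_sets _ ?E")
proof
  let ?I = "{u. finite_path D u \<and> u \<noteq> []}"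
  show "?E \<subseteq> Pow (paths D)" using thin_cylinder_subset by auto
  show "{} \<in> ?E" by simp
  show "a \<inter> b \<in> ?E" if ab: "a \<in> ?E" "b \<in> ?E" for a b
  proof -
    have "a \<inter> b \<in> {{}, a, b}" using ab cylinder_Int_cases[of D] by blast
    then show ?thesis using ab by (elim insertE) simp_all
  qed
  show "\<exists>C\<subseteq>?E. finite C \<and> disjoint C \<and> a - b = \<Union>C" if ab: "a \<in> ?E" "b \<in> ?E" for a b
  proof -
    consider "a = {}" | "b = {}" | u v where "a = thin_cylinder D u" "b = thin_cylinder D v" "u \<in> ?I" "v \<in> ?I"
      using ab by blast
    then show ?thesis
    proof cases
      case 1
      then show ?thesis by (intro exI[of _ "{}"]) auto
    next
      case 2
      then show ?thesis using ab(1) by (intro exI[of _ "{a}"]) (auto simp: disjoint_def)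
    next
      case 3
      \<comment> \<open>The difference is the union of the cylinders of level \<open>n\<close> below \<open>u\<close> that are not below \<open>v\<close>.\<close>
      define n where "n = max (length u) (length v)"
      define Z where "Z = {z. finite_path D z \<and> length z = n \<and> take (length u) z = u \<and> take (length v) z \<noteq> v}"
      have "finite Z" unfolding Z_def
        by (rule finite_subset[OF _ finite_finite_paths[OF D, of n]]) auto
      moreover have "Z \<subseteq> ?I" using 3(3) unfolding Z_def n_def by auto
      moreover have "disjoint (thin_cylinder D ` Z)"
      proof (rule pairwise_imageI)
        fix y z assume yz: "y \<in> Z" "z \<in> Z" "thin_cylinder D y \<noteq> thin_cylinder D z"
        then have "length y = length z" by (simp add: Z_def)
        then show "disjnt (thin_cylinder D y) (thin_cylinder D z)"
          using yz(3) thin_cylinder_disjoint[of y z] unfolding disjnt_def by blast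
      qed
      moreover have "a - b = \<Union>(thin_cylinder D ` Z)"
      proof (intro set_eqI iffI)
        fix x assume x: "x \<in> a - b"
        then have xD: "x \<in> paths D" using 3(1) thin_cylinder_subset by blast
        let ?z = "map x [0..<n]"
        have l: "length u \<le> length ?z" "length v \<le> length ?z" by (auto simp: n_def)
        have "?z \<in> Z"
          using x 3(1,2) in_shorter_cylinder[OF in_prefix_cylinder[OF xD] l(1)]
            in_shorter_cylinder[OF in_prefix_cylinder[OF xD] l(2)] finite_path_prefix[OF xD]
          unfolding Z_def by auto
        then show "x \<in> \<Union>(thin_cylinder D ` Z)" using in_prefix_cylinder[OF xD] by blast
      next
        fix x assume "x \<in> \<Union>(thin_cylinder D ` Z)"
        then obtain z where z: "z \<in> Z" "x \<in> thin_cylinder D z" by blast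
        then have "length u \<le> length z" "length v \<le> length z" by (auto simp: Z_def n_def)
        then show "x \<in> a - b"
          using z 3(1,2) in_shorter_cylinder[OF z(2)] unfolding Z_def by auto
      qed
      ultimately show ?thesis by (intro exI[of _ "thin_cylinder D ` Z"]) blast
    qed
  qed
qed

lemma sigma_sets_cylinders:
  assumes D: "bratteli D"
  shows "sigma_sets (paths D) (insert {} (thin_cylinder D ` {u. finite_path D u \<and> length u \<ge> n}))
    = {B \<in> sets seq_space. B \<subseteq> paths D}" (is "sigma_sets _ ?E = _")
proof
  have "?E \<subseteq> {B \<in> sets seq_space. B \<subseteq> paths D}"
    using sets_thin_cylinder[OF D] thin_cylinder_subset by auto
  then have "?E \<subseteq> sets (borel_of (path_top D))" unfolding sets_borel_path_top[OF D] .
  then have "sigma_sets (space (borel_of (path_top D))) ?E \<subseteq> sets (borel_of (path_top D))"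
    by (rule sets.sigma_sets_subset)
  then show "sigma_sets (paths D) ?E \<subseteq> {B \<in> sets seq_space. B \<subseteq> paths D}"
    unfolding space_borel_of topspace_path_top sets_borel_path_top[OF D] .
next
  have E: "?E \<subseteq> Pow (paths D)" using thin_cylinder_subset by auto
  have "{U. openin (path_top D) U} \<subseteq> sigma_sets (paths D) ?E"
  proof
    fix U assume "U \<in> {U. openin (path_top D) U}"
    then have U: "U = (\<Union>u\<in>{u. finite_path D u \<and> length u \<ge> n \<and> thin_cylinder D u \<subseteq> U}. thin_cylinder D u)"
      using path_top_open_cylinders by blast
    interpret sigma_algebra "paths D" "sigma_sets (paths D) ?E" by (rule sigma_algebra_sigma_sets[OF E])
    have "(\<Union>u\<in>{u. finite_path D u \<and> length u \<ge> n \<and> thin_cylinder D u \<subseteq> U}. thin_cylinder D u)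
        \<in> sigma_sets (paths D) ?E"
      by (intro countable_UN'' countable_subset[OF _ countable_finite_paths[OF D]]) auto
    then show "U \<in> sigma_sets (paths D) ?E" using U by simp
  qed
  then have "sigma_sets (paths D) {U. openin (path_top D) U} \<subseteq> sigma_sets (paths D) ?E"
    by (rule sigma_sets_mono)
  then show "{B \<in> sets seq_space. B \<subseteq> paths D} \<subseteq> sigma_sets (paths D) ?E"
    using sets_borel_path_top[OF D] by (simp add: sets_borel_of topspace_path_top)
qed

text \<open>The premeasure is countably additive because cylinders are compact and open, so that only
  finite additivity is at stake. For sets decided by the first \<open>n\<close> edges the premeasure agrees with a
  finite combination of point masses, which is additive.\<close>

lemma eigen_measure_exists:
  fixes D :: "('a, 'e) diagram"
  assumes D: "bratteli D" and w: "w \<in> V0 D"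
  shows "\<exists>N. sets N = sets seq_space \<and> emeasure N (UNIV - paths D) = 0 \<and> eigen_weights D w N"
proof -
  define I where "I = insert None (Some ` {u. finite_path D u \<and> u \<noteq> []})"
  define G where "G = case_option {} (thin_cylinder D)"
  define W where "W = case_option 0 (\<lambda>u. w (length u) (end_symbol D u))"
  define L where "L = case_option 1 (length :: 'e list \<Rightarrow> nat)"
  \<comment> \<open>The point mass at \<open>p u\<close> represents the cylinder of \<open>u\<close>. If that cylinder is empty, then \<open>p u\<close> is
    arbitrary, but its coefficient in \<open>m\<close> is 0.\<close>
  define p where "p u = (SOME x. x \<in> thin_cylinder D u)" for u
  define m where "m n X = (\<Sum>u\<in>{u. finite_path D u \<and> length u = n}. w n (end_symbol D u) * indicator X (p u))"
    for n X
  have L1: "L i \<ge> 1" if "i \<in> I" for i using that by (auto simp: I_def L_def Suc_le_eq)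
  have W0: "W i \<ge> 0" for i using V0_nonneg[OF w] by (simp add: W_def split: option.split)
  have mG: "m n (G i) = W i" if i: "i \<in> I" and n: "L i \<le> n" for n i
  proof (cases i)
    case None
    then show ?thesis by (simp add: m_def G_def W_def)
  next
    case (Some v)
    then have v: "finite_path D v" "v \<noteq> []" "length v \<le> n" using i n by (auto simp: I_def L_def)
    have "w n (end_symbol D u) * indicator (thin_cylinder D v) (p u)
        = (if take (length v) u = v then w n (end_symbol D u) else 0)"
      if u: "u \<in> {u. finite_path D u \<and> length u = n}" for u
    proof (cases "w n (end_symbol D u) = 0")
      case False
      then have "w (length u) (end_symbol D u) > 0"
        using V0_nonneg[OF w, of n "end_symbol D u"] u by auto
      moreover have "u \<noteq> []" using u v by auto
      ultimately have "thin_cylinder D u \<noteq> {}"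
        using positive_weight_cylinder_nonempty[OF D w] u by blast
      then have "p u \<in> thin_cylinder D u" unfolding p_def by (simp add: some_in_eq)
      then show ?thesis using in_shorter_cylinder[of "p u" D u v] u v by simp
    qed simp
    then have "m n (G i) = (\<Sum>u\<in>{u. finite_path D u \<and> length u = n}.
        if take (length v) u = v then w n (end_symbol D u) else 0)"
      unfolding m_def G_def Some option.case by (rule sum.cong[OF refl])
    also have "\<dots> = (\<Sum>u\<in>{u \<in> {u. finite_path D u \<and> length u = n}. take (length v) u = v}. w n (end_symbol D u))"
      by (rule sum.inter_filter[OF finite_finite_paths[OF D], symmetric])
    also have "{u \<in> {u. finite_path D u \<and> length u = n}. take (length v) u = v}
        = {u. finite_path D u \<and> length u = n \<and> take (length v) u = v}" by auto
    finally show ?thesis using weight_sum_over_level[OF D w v] by (simp add: W_def Some)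
  qed
  have W_empty: "W i = 0" if "i \<in> I" "G i = {}" for i
    using mG[OF that(1) order_refl] that(2) by (simp add: m_def)
  have W_inj: "W i = W j" if "i \<in> I" "j \<in> I" "G i = G j" for i j
    using mG[OF that(1), of "max (L i) (L j)"] mG[OF that(2), of "max (L i) (L j)"] that(3) by simp
  define M where "M = extend_measure (paths D) I G (\<lambda>i. ennreal (W i))"
  have GI: "G ` I = insert {} (thin_cylinder D ` {u. finite_path D u \<and> u \<noteq> []})"
    by (simp add: I_def G_def image_image)
  have emM: "emeasure M (G i) = ennreal (W i)" if i: "i \<in> I" for i
  proof (rule extend_measure_caratheodory[OF M_def i])
    show "semiring_of_sets (paths D) (G ` I)" unfolding GI by (rule semiring_of_cylinders[OF D])
    show "ennreal (W k) = 0" if "k \<in> I" "G k = {}" for k using W_empty[OF that] by simp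
    show "ennreal (W k) = ennreal (W l)" if "k \<in> I" "l \<in> I" "G k = G l" for k l
      using W_inj[OF that] by simp
    fix A :: "nat \<Rightarrow> 'e list option" and j
    assume A: "A \<in> UNIV \<rightarrow> I" and j: "j \<in> I" and disj: "disjoint_family (G \<circ> A)"
      and U: "(\<Union>i. G (A i)) = G j"
    have AI: "A n \<in> I" for n using A by blast
    have "compactin (path_top D) (G j)"
      using compactin_thin_cylinder[OF D] by (simp add: G_def split: option.split)
    moreover have "openin (path_top D) (G (A n))" for n
      using openin_thin_cylinder[of D] by (simp add: G_def split: option.split)
    ultimately obtain F where F: "finite F" "F \<subseteq> range (\<lambda>n. G (A n))" "G j \<subseteq> \<Union>F"
    proof -
      have "\<forall>V\<in>range (\<lambda>n. G (A n)). openin (path_top D) V" "G j \<subseteq> \<Union>(range (\<lambda>n. G (A n)))"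
        using \<open>\<And>n. openin (path_top D) (G (A n))\<close> U by auto
      then show ?thesis
        using that \<open>compactin (path_top D) (G j)\<close> unfolding compactin_def by meson
    qed
    obtain K where K: "finite K" "F = (\<lambda>n. G (A n)) ` K"
      using finite_subset_image[OF F(1,2)] by (elim exE conjE)
    have UK: "(\<Union>n\<in>K. G (A n)) = G j" 
    proof
      show "(\<Union>n\<in>K. G (A n)) \<subseteq> G j" unfolding U[symmetric] by blast
    qed (use F(3) K(2) in simp)
    have out: "W (A n) = 0" if "n \<notin> K" for n
    proof (rule W_empty[OF AI])
      show "G (A n) = {}"
      proof (rule equals0I)
        fix x assume x: "x \<in> G (A n)"
        then have "x \<in> (\<Union>n\<in>K. G (A n))" unfolding UK U[symmetric] by (rule UN_I[OF UNIV_I])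
        then obtain k where k: "k \<in> K" "x \<in> G (A k)" by (elim UN_E)
        then have "G (A k) \<inter> G (A n) = {}"
          using disjoint_family_onD[OF disj, of k n] that by auto
        then show False using k(2) x by blast
      qed
    qed
    define n where "n = Max (insert (L j) (L ` A ` K))"
    have n: "L j \<le> n" "\<And>k. k \<in> K \<Longrightarrow> L (A k) \<le> n" using K(1) by (auto simp: n_def)
    have disjK: "disjoint_family_on (\<lambda>k. G (A k)) K"
      using disj by (auto simp: disjoint_family_on_def)
    have "W j = m n (\<Union>k\<in>K. G (A k))" using mG[OF j n(1)] UK by simp
    also have "\<dots> = (\<Sum>u\<in>{u. finite_path D u \<and> length u = n}.
        \<Sum>k\<in>K. w n (end_symbol D u) * indicator (G (A k)) (p u))"
      unfolding m_def indicator_UN_disjoint[OF K(1) disjK] sum_distrib_left ..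
    also have "\<dots> = (\<Sum>k\<in>K. m n (G (A k)))"
      unfolding m_def by (rule sum.swap)
    also have "\<dots> = (\<Sum>k\<in>K. W (A k))"
      using mG[OF AI n(2)] by simp
    finally have "ennreal (W j) = (\<Sum>k\<in>K. ennreal (W (A k)))" using W0 by (simp add: sum_ennreal)
    moreover have "(\<Sum>n. ennreal (W (A n))) = (\<Sum>k\<in>K. ennreal (W (A k)))"
      by (rule suminf_finite[OF K(1)]) (simp add: out)
    ultimately show "(\<Sum>n. ennreal (W (A n))) = ennreal (W j)" by simp
  qed simp
  have "G ` I \<subseteq> Pow (paths D)" unfolding GI using thin_cylinder_subset by auto
  then have "sets M = sigma_sets (paths D) (G ` I)" unfolding M_def by (rule sets_extend_measure)
  also have "G ` I = insert {} (thin_cylinder D ` {u. finite_path D u \<and> length u \<ge> 1})"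
    unfolding GI by (simp add: Suc_le_eq)
  finally have sM: "sets M = {B \<in> sets seq_space. B \<subseteq> paths D}" using sigma_sets_cylinders[OF D] by simp
  note ext = emeasure_ext_zero[OF sets_paths[OF D] sM]
  have "emeasure (ext_zero M) (thin_cylinder D u) = ennreal (w (length u) (end_symbol D u))"
    if u: "finite_path D u" "u \<noteq> []" for u
    using ext[OF sets_thin_cylinder[OF D], of u] emM[of "Some u"] u thin_cylinder_subset[of D u]
    by (simp add: I_def G_def W_def Int_absorb2)
  moreover have "(UNIV - paths D) \<inter> paths D = {}" by blast
  then have "emeasure (ext_zero M) (UNIV - paths D) = 0"
    using ext[of "UNIV - paths D"] sets.Diff[OF UNIV_in_seq_space sets_paths[OF D]] by simp
  ultimately show ?thesis using w by (intro exI[of _ "ext_zero M"]) (simp add: eigen_weights_def)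
qed

text \<open>Testing long cylinders only makes it possible to compare measures below a given cylinder.\<close>

lemma measure_eq_on_cylinders:
  assumes D: "bratteli D" and s: "sets N1 = sets seq_space" "sets N2 = sets seq_space"
    and eq: "\<And>u. finite_path D u \<Longrightarrow> length u \<ge> n \<Longrightarrow> emeasure N1 (thin_cylinder D u) = emeasure N2 (thin_cylinder D u)"
    and fin: "\<And>u. finite_path D u \<Longrightarrow> length u = n \<Longrightarrow> emeasure N1 (thin_cylinder D u) \<noteq> \<infinity>"
    and X: "X \<in> sets seq_space" "X \<subseteq> paths D"
  shows "emeasure N1 X = emeasure N2 X"
proof -
  let ?M = "\<lambda>N. restrict_space N (paths D)"
  let ?C = "{u. finite_path D u \<and> length u \<ge> n}"
  let ?E = "insert {} (thin_cylinder D ` ?C)"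
  note P = sets_paths[OF D]
  have em: "emeasure (?M N) B = emeasure N B" if "sets N = sets seq_space" "B \<subseteq> paths D" for N B
    by (rule emeasure_restrict_trace[OF that(1) P that(2)])
  have "?M N1 = ?M N2"
  proof (rule measure_eqI_generator_eq_countable)
    have "thin_cylinder D u \<inter> thin_cylinder D v \<in> ?E" if "u \<in> ?C" "v \<in> ?C" for u v
      using cylinder_Int_cases[of D u v] that by blast
    then show "Int_stable ?E" unfolding Int_stable_def by auto
    show "?E \<subseteq> Pow (paths D)" using thin_cylinder_subset by auto
    show "emeasure (?M N1) B = emeasure (?M N2) B" if "B \<in> ?E" for B
      using that eq em[OF s(1)] em[OF s(2)] thin_cylinder_subset[of D] by auto
    show "sets (?M N1) = sigma_sets (paths D) ?E" "sets (?M N2) = sigma_sets (paths D) ?E"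
      unfolding sigma_sets_cylinders[OF D] using sets_restrict_trace[OF s(1) P] sets_restrict_trace[OF s(2) P]
      by auto
    let ?A = "thin_cylinder D ` {u. finite_path D u \<and> length u = n}"
    show "?A \<subseteq> ?E" by auto
    show "\<Union>?A = paths D" using paths_eq_cylinders[of D n] by simp
    show "countable ?A" using countable_finite[OF finite_finite_paths[OF D]] by auto
    show "emeasure (?M N1) a \<noteq> \<infinity>" if "a \<in> ?A" for a
      using that fin em[OF s(1)] thin_cylinder_subset[of D] by auto
  qed
  then show ?thesis using em[OF s(1) X(2)] em[OF s(2) X(2)] by simp
qed

lemma swappable_append: "swappable D p q \<Longrightarrow> finite_path D (p @ t) \<Longrightarrow> swappable D (p @ t) (q @ t)"
proof (induction t rule: rev_induct)
  case (snoc e t)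
  have pq: "p \<noteq> []" "q \<noteq> []" "length p = length q" using snoc.prems(1) by (auto simp: swappable_def)
  have "finite_path D (p @ t)" using snoc.prems(2) finite_path_snoc[of "p @ t" D e] pq by simp
  then have "swappable D (p @ t) (q @ t)" using snoc by blast
  then show ?case
    using snoc.prems(2) finite_path_snoc[of "p @ t" D e] finite_path_snoc[of "q @ t" D e] pq
      end_symbol_snoc[of D "p @ t" e] end_symbol_snoc[of D "q @ t" e]
    by (simp add: swappable_def)
qed simp

lemma moved_cylinder:
  assumes s: "swappable D p q" shows "moved D p q (thin_cylinder D (p @ t)) = thin_cylinder D (q @ t)"
proof -
  have l: "length p = length q" using s by (simp add: swappable_def)
  have "thin_cylinder D (q @ t) \<subseteq> thin_cylinder D q" by (auto simp: thin_cylinder_def nth_append)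
  moreover have "replace_start p y \<in> thin_cylinder D (p @ t) \<longleftrightarrow> y \<in> thin_cylinder D (q @ t)"
    if y: "y \<in> thin_cylinder D q" for y
    using replace_start_in_cylinder[OF swappable_sym[OF s] y] y l
    by (auto simp: thin_cylinder_def nth_append replace_start_def)
  ultimately show ?thesis by (auto simp: moved_def)
qed

text \<open>Weights depend on the end symbol only, so the cylinders below \<open>p\<close> and \<open>q\<close> have equal measures.\<close>

lemma eigen_measure_invariant:
  assumes D: "bratteli D" and s: "sets N = sets seq_space" and w: "eigen_weights D w N"
  shows "swap_invariant D N"
  unfolding swap_invariant_def
proof (intro conjI allI impI ballI)
  show "sets N = sets seq_space" by (rule s)
  fix p q and Y :: "(nat \<Rightarrow> 'b) set" assume pq: "swappable D p q" and Y: "Y \<in> sets seq_space"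
  define N1 where "N1 = ext_zero (restrict_space N (thin_cylinder D p))"
  define N2 where "N2 = distr (restrict_space N (thin_cylinder D q)) seq_space (replace_start p)"
  have c: "thin_cylinder D u \<in> sets seq_space" for u by (rule sets_thin_cylinder[OF D])
  have N1: "emeasure N1 B = emeasure N (B \<inter> thin_cylinder D p)" if "B \<in> sets seq_space" for B
    unfolding N1_def by (rule emeasure_ext_restrict[OF s c that])
  have sp: "space (restrict_space N (thin_cylinder D q)) = thin_cylinder D q"
    using c s by (intro space_restrict_space2) simp
  have "replace_start p \<in> measurable N seq_space"
    using measurable_replace_start measurable_cong_sets[OF s refl] by blast
  then have meas: "replace_start p \<in> measurable (restrict_space N (thin_cylinder D q)) seq_space"
    by (rule measurable_restrict_space1)
  have N2: "emeasure N2 B = emeasure N (moved D p q B)" if B: "B \<in> sets seq_space" for B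
  proof -
    have "replace_start p -` B \<inter> thin_cylinder D q = moved D p q B" by (auto simp: moved_def)
    then show ?thesis
      unfolding N2_def emeasure_distr[OF meas B] sp
      using emeasure_restrict_trace[OF s c moved_subset[of D p q B]] by simp
  qed
  let ?B = "Y \<inter> thin_cylinder D p"
  have B: "?B \<in> sets seq_space" "?B \<subseteq> paths D" using Y c thin_cylinder_subset by auto
  have "emeasure N1 ?B = emeasure N2 ?B"
  proof (rule measure_eq_on_cylinders[OF D _ _ _ _ B, where n = "length p"])
    show "sets N1 = sets seq_space" "sets N2 = sets seq_space" by (simp_all add: N1_def N2_def)
    have p0: "p \<noteq> []" using pq by (simp add: swappable_def)
    show "emeasure N1 (thin_cylinder D z) = emeasure N2 (thin_cylinder D z)"
      if z: "finite_path D z" "length z \<ge> length p" for z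
    proof (cases "take (length p) z = p")
      case True
      then obtain t where t: "z = p @ t" by (metis append_take_drop_id)
      have st: "swappable D (p @ t) (q @ t)" using swappable_append[OF pq] z(1) t by simp
      then have "emeasure N (thin_cylinder D (p @ t)) = emeasure N (thin_cylinder D (q @ t))"
        using w p0 unfolding eigen_weights_def swappable_def by auto
      moreover have "thin_cylinder D z \<inter> thin_cylinder D p = thin_cylinder D z"
        using cylinder_Int[OF z(2)] True by simp
      ultimately show ?thesis using N1[OF c, of z] N2[OF c, of z] moved_cylinder[OF pq, of t] t by simp
    next
      case False
      then have "thin_cylinder D z \<inter> thin_cylinder D p = {}" using cylinder_Int[OF z(2)] by simp
      moreover have "moved D p q (thin_cylinder D z) = {}"
        using calculation moved_Int_cylinder[OF pq, of "thin_cylinder D z"] by (simp add: moved_def)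
      ultimately show ?thesis using N1[OF c, of z] N2[OF c, of z] by simp
    qed
    show "emeasure N1 (thin_cylinder D z) \<noteq> \<infinity>" if z: "finite_path D z" "length z = length p" for z
    proof -
      have "emeasure N (thin_cylinder D z \<inter> thin_cylinder D p) \<le> emeasure N (thin_cylinder D p)"
        using c s by (intro emeasure_mono) auto
      also have "\<dots> < \<infinity>" using w pq by (simp add: eigen_weights_def swappable_def)
      finally show ?thesis using N1[OF c, of z] by simp
    qed
  qed
  then show "emeasure N (moved D p q Y) = emeasure N (Y \<inter> thin_cylinder D p)"
    using N1[OF B(1)] N2[OF B(1)] moved_Int_cylinder[OF pq, of Y] by (simp add: Int_ac)
qed

section \<open>Extremality\<close>

lemma measure_eq_if_le_and_same_mass:
  assumes s: "sets N1 = sets seq_space" "sets N2 = sets seq_space"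
    and P: "P \<in> sets seq_space" "emeasure N1 (UNIV - P) = 0" "emeasure N2 (UNIV - P) = 0"
    and le: "\<And>X. X \<in> sets seq_space \<Longrightarrow> X \<subseteq> P \<Longrightarrow> emeasure N1 X \<le> emeasure N2 X"
    and mass: "emeasure N1 UNIV = emeasure N2 UNIV" "emeasure N1 UNIV \<noteq> \<infinity>"
    and X: "X \<in> sets seq_space"
  shows "emeasure N1 X = emeasure N2 X"
proof -
  have le': "emeasure N1 Z \<le> emeasure N2 Z" if Z: "Z \<in> sets seq_space" for Z
  proof -
    have "emeasure N (Z \<inter> P) = emeasure N Z" if "sets N = sets seq_space" "emeasure N (UNIV - P) = 0" for N
      using Z P(1) that by (intro emeasure_Int_conull[where Q = UNIV]) simp_all
    then show ?thesis using le[of "Z \<inter> P"] Z P s by (metis inf_le2 sets.Int)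
  qed
  have cX: "UNIV - X \<in> sets seq_space" using X UNIV_in_seq_space by blast
  have split: "emeasure N UNIV = emeasure N X + emeasure N (UNIV - X)" if "sets N = sets seq_space" for N
  proof -
    have "X \<in> sets N" "UNIV - X \<in> sets N" "X \<inter> (UNIV - X) = {}" "X \<union> (UNIV - X) = UNIV"
      using X cX that by blast+
    then show ?thesis by (metis plus_emeasure)
  qed
  have fin: "emeasure N1 (UNIV - X) \<noteq> \<infinity>"
    using split[OF s(1)] mass by (metis ennreal_add_eq_top infinity_ennreal_def)
  have "emeasure N2 X + emeasure N1 (UNIV - X) \<le> emeasure N2 X + emeasure N2 (UNIV - X)"
    using le'[OF cX] by (rule add_left_mono)
  also have "\<dots> = emeasure N1 X + emeasure N1 (UNIV - X)"
    using split[OF s(1)] split[OF s(2)] mass(1) by simp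
  finally have "emeasure N2 X \<le> emeasure N1 X"
    using fin by (simp add: ennreal_add_left_cancel_le add.commute top_unique)
  then show ?thesis using le'[OF X] by simp
qed

text \<open>If \<open>Y\<close> is a Hahn set for \<open>N1 - c N\<close>, where \<open>c\<close> is the quotient of the total masses, then its
  saturation is a Hahn set too, and invariant. It is null or conull by ergodicity, so one of
  \<open>N1 \<le> c N\<close> and \<open>c N \<le> N1\<close> holds everywhere, with equal total masses.\<close>

lemma ergodic_dominated_proportional:
  assumes D: "bratteli D" and N: "swap_invariant D N" and N1: "swap_invariant D N1"
    and erg: "swap_ergodic D N"
    and off: "emeasure N (UNIV - paths D) = 0"
    and mass: "0 < emeasure N UNIV" "emeasure N UNIV < \<infinity>" "emeasure N1 UNIV < \<infinity>"
    and ac: "\<And>X. X \<in> sets seq_space \<Longrightarrow> emeasure N X = 0 \<Longrightarrow> emeasure N1 X = 0"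
  shows "\<exists>c\<ge>0. \<forall>X\<in>sets seq_space. emeasure N1 X = ennreal c * emeasure N X"
proof -
  note s = swap_invariant_sets[OF N] and s1 = swap_invariant_sets[OF N1]
  define c where "c = enn2real (emeasure N1 UNIV) / enn2real (emeasure N UNIV)"
  have c0: "c \<ge> 0" by (simp add: c_def)
  define N2 where "N2 = scale_measure (ennreal c) N"
  have s2: "sets N2 = sets seq_space" by (simp add: N2_def s)
  have em2: "emeasure N2 X = ennreal c * emeasure N X" for X by (simp add: N2_def)
  have N2: "swap_invariant D N2"
    using N s2 unfolding swap_invariant_def em2 by auto
  have pos: "enn2real (emeasure N UNIV) > 0" using mass by (simp add: enn2real_positive_iff)
  have total: "emeasure N2 UNIV = emeasure N1 UNIV"
  proof -
    have "emeasure N UNIV = ennreal (enn2real (emeasure N UNIV))"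
      "emeasure N1 UNIV = ennreal (enn2real (emeasure N1 UNIV))" using mass by simp_all
    moreover have "ennreal c * ennreal (enn2real (emeasure N UNIV)) = ennreal (enn2real (emeasure N1 UNIV))"
      using c0 pos by (subst ennreal_mult[symmetric]) (auto simp: c_def)
    ultimately show ?thesis unfolding em2 by metis
  qed
  have "\<exists>Y\<in>sets N2. Y \<subseteq> UNIV \<and> (\<forall>X\<in>sets N2. X \<subseteq> Y \<longrightarrow> emeasure N1 X \<le> emeasure N2 X)
    \<and> (\<forall>X\<in>sets N2. X \<subseteq> UNIV \<longrightarrow> X \<inter> Y = {} \<longrightarrow> emeasure N2 X \<le> emeasure N1 X)"
  proof (rule unsigned_Hahn_decomposition)
    show "sets N1 = sets N2" "UNIV \<in> sets N2" unfolding s1 s2 by simp_all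
    show "emeasure N1 UNIV \<noteq> top" using mass(3) by simp
    then show "emeasure N2 UNIV \<noteq> top" using total by simp
  qed
  then obtain Y where Ys: "Y \<in> sets seq_space"
    and Yle: "\<forall>X\<in>sets seq_space. X \<subseteq> Y \<longrightarrow> emeasure N1 X \<le> emeasure N2 X"
    and Yge: "\<forall>X\<in>sets seq_space. X \<subseteq> UNIV \<longrightarrow> X \<inter> Y = {} \<longrightarrow> emeasure N2 X \<le> emeasure N1 X"
    unfolding s2 by (elim bexE conjE)
  have Y: "Y \<in> sets seq_space"
    "\<And>X. X \<in> sets seq_space \<Longrightarrow> X \<subseteq> Y \<Longrightarrow> emeasure N1 X \<le> emeasure N2 X"
    "\<And>X. X \<in> sets seq_space \<Longrightarrow> X \<inter> Y = {} \<Longrightarrow> emeasure N2 X \<le> emeasure N1 X"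
    using Ys Yle Yge by simp_all
  let ?S = "saturation D Y"
  have S: "?S \<in> sets seq_space" by (rule sets_saturation[OF D Y(1)])
  have PD: "paths D \<in> sets seq_space" by (rule sets_paths[OF D])
  have S_le: "emeasure N1 X \<le> emeasure N2 X" if "X \<in> sets seq_space" "X \<subseteq> ?S" for X
    by (rule saturation_emeasure_le[OF D N1 N2 Y(1) Y(2) that])
  have C_ge: "emeasure N2 X \<le> emeasure N1 X" if "X \<in> sets seq_space" "X \<subseteq> paths D - ?S" for X
  proof (rule Y(3)[OF that(1)])
    have "Y \<inter> paths D \<subseteq> ?S" using subset_saturation[of "Y \<inter> paths D" D] saturation_mono[of "Y \<inter> paths D" Y D] by blast
    then show "X \<inter> Y = {}" using that(2) by blast
  qed
  have null1: "emeasure N' (UNIV - P) = 0"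
    if "emeasure N (UNIV - P) = 0" "P \<in> sets seq_space" "N' = N1 \<or> N' = N2" for N' P
    using that(1,3) ac[OF sets.Diff[OF UNIV_in_seq_space that(2)]] em2 by auto
  have "emeasure N1 X = emeasure N2 X" if X: "X \<in> sets seq_space" for X
  proof -
    consider "emeasure N ?S = 0" | "emeasure N (paths D - ?S) = 0"
      using erg S saturation_saturation unfolding swap_ergodic_def by blast
    then show ?thesis
    proof cases
      case 1
      let ?P = "paths D - ?S"
      have P: "?P \<in> sets seq_space" using PD S by blast
      have "UNIV - ?P = (UNIV - paths D) \<union> ?S" using saturation_subset[of D Y] by blast
      moreover have "(UNIV - paths D) \<union> ?S \<in> null_sets N"
        using off 1 S s sets.Diff[OF UNIV_in_seq_space PD]
        by (intro null_sets.Un) (simp_all only: null_sets_def mem_Collect_eq simp_thms)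
      ultimately have null: "emeasure N (UNIV - ?P) = 0" by auto
      show ?thesis
        using measure_eq_if_le_and_same_mass[OF s2 s1 P null1[OF null P] null1[OF null P] C_ge total _ X]
          total mass by simp
    next
      case 2
      have "UNIV - ?S = (UNIV - paths D) \<union> (paths D - ?S)" using saturation_subset[of D Y] by blast
      moreover have "(UNIV - paths D) \<union> (paths D - ?S) \<in> null_sets N"
        using off 2 s sets.Diff[OF PD S] sets.Diff[OF UNIV_in_seq_space PD]
        by (intro null_sets.Un) (simp_all only: null_sets_def mem_Collect_eq simp_thms)
      ultimately have null: "emeasure N (UNIV - ?S) = 0" by auto
      show ?thesis
        using measure_eq_if_le_and_same_mass[OF s1 s2 S null1[OF null S] null1[OF null S] S_le total[symmetric] _ X]
          mass by simp
    qed
  qed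
  then show ?thesis using c0 em2 by auto
qed

lemma emeasure_add_measure:
  fixes M1 M2 :: "(nat \<Rightarrow> 'e) measure"
  assumes s: "sets M1 = sets seq_space" "sets M2 = sets seq_space" and X: "X \<in> sets seq_space"
  shows "emeasure (measure_of UNIV (sets seq_space) (\<lambda>X. emeasure M1 X + emeasure M2 X)) X
    = emeasure M1 X + emeasure M2 X"
proof (rule emeasure_measure_of_sigma[OF _ _ _ X])
  show "sigma_algebra UNIV (sets (seq_space :: (nat \<Rightarrow> 'e) measure))"
    using sets.sigma_algebra_axioms[of "seq_space :: (nat \<Rightarrow> 'e) measure"] by simp
  show "positive (sets (seq_space :: (nat \<Rightarrow> 'e) measure)) (\<lambda>X. emeasure M1 X + emeasure M2 X)"
    by (simp add: positive_def)
  show "countably_additive (sets (seq_space :: (nat \<Rightarrow> 'e) measure)) (\<lambda>X. emeasure M1 X + emeasure M2 X)"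
  proof (rule countably_additiveI)
    fix A :: "nat \<Rightarrow> (nat \<Rightarrow> 'e) set"
    assume A: "range A \<subseteq> sets seq_space" "disjoint_family A"
    have "(\<Sum>i. emeasure M1 (A i) + emeasure M2 (A i)) = (\<Sum>i. emeasure M1 (A i)) + (\<Sum>i. emeasure M2 (A i))"
      by (rule suminf_add[symmetric]) auto
    then show "(\<Sum>i. emeasure M1 (A i) + emeasure M2 (A i)) = emeasure M1 (\<Union>(range A)) + emeasure M2 (\<Union>(range A))"
      using suminf_emeasure[of A M1] suminf_emeasure[of A M2] A s by simp
  qed
qed

text \<open>A summand \<open>u\<close> of a multiple of \<open>w\<close> is the weight sequence of an invariant measure dominated by a
  multiple of \<open>N\<close>.\<close>

lemma eigen_summand_proportional:
  assumes D: "bratteli D" and N: "swap_invariant D N" and erg: "swap_ergodic D N"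
    and off: "emeasure N (UNIV - paths D) = 0" and mass: "0 < emeasure N UNIV" "emeasure N UNIV < \<infinity>"
    and w: "eigen_weights D w N" and uv: "u \<in> V0 D" "v \<in> V0 D"
    and sum: "\<And>i a. u i a + v i a = t * w i a" and t: "t \<ge> 0"
  shows "u \<in> ray w"
proof -
  note s = swap_invariant_sets[OF N]
  have wV: "w \<in> V0 D" using w by (simp add: eigen_weights_def)
  obtain Nu where Nu: "sets Nu = sets seq_space" "emeasure Nu (UNIV - paths D) = 0" "eigen_weights D u Nu"
    using eigen_measure_exists[OF D uv(1)] by blast
  obtain Nv where Nv: "sets Nv = sets seq_space" "emeasure Nv (UNIV - paths D) = 0" "eigen_weights D v Nv"
    using eigen_measure_exists[OF D uv(2)] by blast
  define S where "S = measure_of UNIV (sets seq_space) (\<lambda>X. emeasure Nu X + emeasure Nv X)"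
  have sS: "sets S = sets seq_space"
    unfolding S_def using sets.sigma_sets_eq[of "seq_space :: (nat \<Rightarrow> 'b) measure"]
      sets.space_closed[of "seq_space :: (nat \<Rightarrow> 'b) measure"] by (subst sets_measure_of) auto
  have emS: "emeasure S X = emeasure Nu X + emeasure Nv X" if "X \<in> sets seq_space" for X
    unfolding S_def by (rule emeasure_add_measure[OF Nu(1) Nv(1) that])
  have le: "emeasure Nu X \<le> ennreal t * emeasure N X" if X: "X \<in> sets seq_space" "X \<subseteq> paths D" for X
  proof -
    have cyl: "emeasure S (thin_cylinder D z) = emeasure (scale_measure (ennreal t) N) (thin_cylinder D z)"
      "emeasure S (thin_cylinder D z) \<noteq> \<infinity>"
      if z: "finite_path D z" "length z \<ge> 1" for z
    proof -
      have z0: "z \<noteq> []" using z by auto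
      let ?n = "length z" and ?a = "end_symbol D z"
      have e: "emeasure S (thin_cylinder D z) = ennreal (u ?n ?a) + ennreal (v ?n ?a)"
        using emS[OF sets_thin_cylinder[OF D]] Nu(3) Nv(3) z z0 by (simp add: eigen_weights_def)
      also have "\<dots> = ennreal (t * w ?n ?a)"
        using V0_nonneg[OF uv(1)] V0_nonneg[OF uv(2)] sum by (simp flip: ennreal_plus)
      also have "\<dots> = ennreal t * emeasure N (thin_cylinder D z)"
        using w z z0 t V0_nonneg[OF wV] by (simp add: eigen_weights_def ennreal_mult)
      finally show "emeasure S (thin_cylinder D z) = emeasure (scale_measure (ennreal t) N) (thin_cylinder D z)"
        by simp
      show "emeasure S (thin_cylinder D z) \<noteq> \<infinity>" unfolding e by simp
    qed
    have "emeasure S X = emeasure (scale_measure (ennreal t) N) X"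
      by (rule measure_eq_on_cylinders[OF D sS _ cyl(1) cyl(2) X, where n = 1]) (auto simp: s)
    then show ?thesis using emS[OF X(1)] by (metis emeasure_scale_measure le_iff_add)
  qed
  have tr: "emeasure Nu X = emeasure Nu (X \<inter> paths D)" if "X \<in> sets seq_space" for X
    using emeasure_Int_conull[of X Nu "paths D" UNIV] that Nu sets_paths[OF D] UNIV_in_seq_space by auto
  have le': "emeasure Nu X \<le> ennreal t * emeasure N X" if X: "X \<in> sets seq_space" for X
  proof -
    have "emeasure Nu X \<le> ennreal t * emeasure N (X \<inter> paths D)"
      using tr[OF X] le[of "X \<inter> paths D"] X sets_paths[OF D] by auto
    also have "\<dots> \<le> ennreal t * emeasure N X"
      using X s by (intro mult_left_mono emeasure_mono) auto
    finally show ?thesis .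
  qed
  have "emeasure Nu UNIV \<le> ennreal t * emeasure N UNIV" by (rule le'[OF UNIV_in_seq_space])
  also have "\<dots> < \<infinity>" using mass(2) by (simp add: ennreal_mult_less_top)
  finally have massu: "emeasure Nu UNIV < \<infinity>" .
  have "emeasure Nu X = 0" if "X \<in> sets seq_space" "emeasure N X = 0" for X
    using le'[OF that(1)] that(2) by simp
  then obtain c where c: "c \<ge> 0" "\<And>X. X \<in> sets seq_space \<Longrightarrow> emeasure Nu X = ennreal c * emeasure N X"
    using ergodic_dominated_proportional[OF D N eigen_measure_invariant[OF D Nu(1,3)] erg off mass massu]
    by blast
  have "eigen_weights D (\<lambda>i a. c * w i a) Nu"
    unfolding eigen_weights_def
  proof (intro conjI allI impI)
    show "(\<lambda>i a. c * w i a) \<in> V0 D"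
      unfolding V0_def
    proof (intro CollectI conjI allI impI ballI)
      fix i a assume a: "a \<in> alph D i"
      show "c * w i a = (\<Sum>b\<in>alph D (Suc i). real (mat D i a b) * (c * w (Suc i) b))"
        unfolding V0_step[OF wV a] sum_distrib_left by (rule sum.cong) auto
    qed (use c V0_nonneg[OF wV] V0_off_alph[OF wV] in auto)
    fix z assume z: "finite_path D z \<and> z \<noteq> []"
    show "emeasure Nu (thin_cylinder D z) = ennreal (c * w (length z) (end_symbol D z))"
      using c(2)[OF sets_thin_cylinder[OF D]] w z c(1) V0_nonneg[OF wV]
      by (simp add: eigen_weights_def ennreal_mult)
  qed
  then have "u = (\<lambda>i a. c * w i a)" by (rule eigen_weights_unique[OF D Nu(3)])
  then show ?thesis unfolding ray_def using c(1) by blast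
qed

lemma eigen_extremal:
  assumes D: "bratteli D" and N: "swap_invariant D N" and erg: "swap_ergodic D N"
    and off: "emeasure N (UNIV - paths D) = 0" and mass: "0 < emeasure N UNIV" "emeasure N UNIV < \<infinity>"
    and w: "eigen_weights D w N"
  shows "w \<in> ExtV D"
proof -
  have wV: "w \<in> V0 D" using w by (simp add: eigen_weights_def)
  have "emeasure N (paths D) = emeasure N UNIV"
    using emeasure_Int_conull[of UNIV N "paths D" UNIV] off sets_paths[OF D] swap_invariant_sets[OF N]
      UNIV_in_seq_space by auto
  then have "w \<in> V D"
    using eigen_weights_V[OF D swap_invariant_sets[OF N] w] mass(1) by simp
  then have "w \<noteq> (\<lambda>i a. 0)" by (auto simp: V_def)
  moreover have "u \<in> ray w \<and> v \<in> ray w"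
    if uv: "u \<in> V0 D" "v \<in> V0 D" and sum: "(\<lambda>i a. u i a + v i a) \<in> ray w" for u v
  proof -
    obtain t where "t \<ge> 0" "(\<lambda>i a. u i a + v i a) = (\<lambda>i a. t * w i a)" using sum unfolding ray_def by blast
    then have "t \<ge> 0" "u i a + v i a = t * w i a" "v i a + u i a = t * w i a" for i a
      by (auto dest!: fun_cong[of _ _ i] fun_cong[of _ _ a] simp: add.commute)
    then show ?thesis
      using eigen_summand_proportional[OF D N erg off mass w uv]
        eigen_summand_proportional[OF D N erg off mass w uv(2) uv(1)] by blast
  qed
  ultimately show ?thesis using wV unfolding ExtV_def by blast
qed

section \<open>Distinguished eigenvector sequences\<close>

lemma mat_pow_Suc:
  "mat_pow D (Suc m) v i a = (\<Sum>c\<in>alph D (Suc i). real (mat D i a c) * mat_pow D m v (Suc i) c)"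
proof -
  have "mat_pow D (Suc m) v i a = (\<Sum>b\<in>alph D (Suc i + m). \<Sum>c\<in>alph D (Suc i).
      real (mat D i a c) * (real (mprod D (Suc i) m c b) * v (Suc i + m) b))"
    unfolding mat_pow_def by (simp add: sum_distrib_right mult.assoc)
  also have "\<dots> = (\<Sum>c\<in>alph D (Suc i). real (mat D i a c) * mat_pow D m v (Suc i) c)"
    unfolding mat_pow_def sum_distrib_left by (rule sum.swap)
  finally show ?thesis .
qed

lemma mat_pow_nonneg: "(\<And>i a. v i a \<ge> 0) \<Longrightarrow> mat_pow D m v i a \<ge> 0"
  unfolding mat_pow_def by (intro sum_nonneg mult_nonneg_nonneg) auto

definition tails_in :: "('a, 'e) diagram \<Rightarrow> nat \<Rightarrow> (nat \<Rightarrow> 'e) set" where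
  "tails_in A k = {x. \<forall>j\<ge>k. x j \<in> edges A j}"

lemma sets_tails_in: "tails_in A k \<in> sets seq_space"
proof -
  have "tails_in A k = (\<Inter>j. {x. j \<ge> k \<longrightarrow> x j \<in> edges A j})" by (auto simp: tails_in_def)
  moreover have "{x. j \<ge> k \<longrightarrow> x j \<in> edges A j} \<in> sets seq_space" for j
    using seq_space_coordinate[of j "edges A j"] by (cases "j \<ge> k") simp_all
  ultimately show ?thesis by (simp add: sets.countable_INT'')
qed

text \<open>The paths that start with \<open>u\<close> and have their edges in \<open>A\<close> from level \<open>length u + m\<close> on split
  according to their symbol at that level; the matrix product counts the ways to get there, and
  each way contributes the weight of the symbol.\<close>

lemma mat_pow_eq_emeasure:
  assumes H: "bratteli H" and A: "bratteli A" and AH: "A \<preceq> H" and N: "swap_invariant H N"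
    and w: "eigen_weights A w N"
  shows "finite_path H u \<Longrightarrow> u \<noteq> [] \<Longrightarrow>
    emeasure N (thin_cylinder H u \<inter> tails_in A (length u + m)) = ennreal (mat_pow H m w (length u) (end_symbol H u))"
proof (induction m arbitrary: u)
  case 0
  have V: "w \<in> V0 A" using w by (simp add: eigen_weights_def)
  let ?n = "length u" and ?a = "end_symbol H u"
  have a: "?a \<in> alph H ?n" by (rule end_symbol_alph[OF H 0])
  have "mat_pow H 0 w ?n ?a = (\<Sum>b\<in>alph H ?n. if ?a = b then w ?n b else 0)"
    unfolding mat_pow_def by (rule sum.cong) auto
  then have pow: "mat_pow H 0 w ?n ?a = w ?n ?a" using a bratteli_finite(1)[OF H] by simp
  show ?case
  proof (cases "?a \<in> alph A ?n")
    case True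
    then obtain p where p: "finite_path A p" "length p = ?n" "end_symbol A p = ?a"
      using finite_path_to_symbol[OF A] 0 by blast
    have p0: "p \<noteq> []" using p 0 by auto
    have pu: "swappable H p u"
      using p p0 0 finite_path_nested[OF AH p(1)] end_symbol_nested[OF AH p(1) p0]
      by (simp add: swappable_def)
    have "moved H p u (paths A) = thin_cylinder H u \<inter> tails_in A ?n"
    proof (intro set_eqI iffI)
      fix y assume "y \<in> moved H p u (paths A)"
      then have y: "y \<in> thin_cylinder H u" "replace_start p y \<in> paths A" by (auto simp: moved_def)
      have "y j \<in> edges A j" if "j \<ge> ?n" for j
        using paths_edge[OF y(2), of j] that p(2) by (simp add: replace_start_def)
      then show "y \<in> thin_cylinder H u \<inter> tails_in A ?n" using y(1) by (simp add: tails_in_def)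
    next
      fix y assume y: "y \<in> thin_cylinder H u \<inter> tails_in A ?n"
      then have "replace_start p y \<in> thin_cylinder H p"
        using replace_start_in_cylinder[OF swappable_sym[OF pu]] by blast
      then have "replace_start p y \<in> paths H" using thin_cylinder_subset by blast
      moreover have "replace_start p y j \<in> edges A j" for j
        using y p by (auto simp: replace_start_def tails_in_def finite_path_def)
      ultimately show "y \<in> moved H p u (paths A)"
        using y nested_paths_iff[OF AH] by (auto simp: moved_def)
    qed
    then have "emeasure N (thin_cylinder H u \<inter> tails_in A ?n) = emeasure N (paths A \<inter> thin_cylinder H p)"
      using swap_invariant_moved[OF N pu sets_paths[OF A]] by simp
    also have "\<dots> = ennreal (w ?n ?a)"
    proof -
      have "paths A \<inter> thin_cylinder H p = thin_cylinder A p"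
        using nested_thin_cylinder[OF AH, of p] by blast
      moreover have "emeasure N (thin_cylinder A p) = ennreal (w (length p) (end_symbol A p))"
        using w p(1) p0 unfolding eigen_weights_def by blast
      ultimately show ?thesis using p by simp
    qed
    finally show ?thesis using pow by simp
  next
    case False
    have "thin_cylinder H u \<inter> tails_in A ?n = {}"
    proof (rule equals0I)
      fix x assume x: "x \<in> thin_cylinder H u \<inter> tails_in A ?n"
      then have "x ?n \<in> edges A ?n" by (simp add: tails_in_def)
      then show False
        using False x end_symbol_cylinder[of x H u] 0 nested_src[OF AH, of "x ?n" ?n] bratteli_src[OF A]
        by auto
    qed
    then show ?thesis using False pow V0_off_alph[OF V] by simp
  qed
next
  case (Suc m)
  let ?n = "length u" and ?a = "end_symbol H u"
  let ?E = "{e \<in> edges H ?n. src H ?n e = ?a}"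
  have nn: "mat_pow H m w i a \<ge> 0" for i a
    using w V0_nonneg by (intro mat_pow_nonneg) (auto simp: eigen_weights_def)
  have "emeasure N (thin_cylinder H u \<inter> tails_in A (?n + Suc m))
      = (\<Sum>e\<in>?E. emeasure N (thin_cylinder H (u @ [e]) \<inter> tails_in A (?n + Suc m)))"
    by (rule emeasure_cylinder_split[OF H swap_invariant_sets[OF N] Suc.prems(2) sets_tails_in])
  also have "\<dots> = (\<Sum>e\<in>?E. ennreal (mat_pow H m w (Suc ?n) (tgt H ?n e)))"
  proof (rule sum.cong[OF refl])
    fix e assume "e \<in> ?E"
    then have "finite_path H (u @ [e])" using Suc.prems finite_path_snoc[of u H e] by simp
    then show "emeasure N (thin_cylinder H (u @ [e]) \<inter> tails_in A (?n + Suc m))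
        = ennreal (mat_pow H m w (Suc ?n) (tgt H ?n e))"
      using Suc.IH[of "u @ [e]"] by (simp add: end_symbol_snoc)
  qed
  also have "\<dots> = ennreal (\<Sum>e\<in>?E. mat_pow H m w (Suc ?n) (tgt H ?n e))"
    using nn by (intro sum_ennreal) auto
  also have "(\<Sum>e\<in>?E. mat_pow H m w (Suc ?n) (tgt H ?n e)) = mat_pow H (Suc m) w ?n ?a"
    unfolding mat_pow_Suc by (rule sum_edges_by_target[OF H])
  finally show ?case .
qed

text \<open>At positive levels, the sequences in the definition of a distinguished eigenvector sequence
  increase to the measures of the cylinders of the larger diagram, and finitely many of these
  cylinders cover its path space.\<close>

lemma distinguished_iff_finite:
  assumes H: "bratteli H" and A: "bratteli A" and AH: "A \<preceq> H" and N: "swap_invariant H N"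
    and w: "eigen_weights A w N" "w \<in> V A" and conull: "emeasure N (paths H - tower_paths H A) = 0"
  shows "distinguished H A w \<longleftrightarrow> emeasure N (paths H) < \<infinity>"
proof -
  note s = swap_invariant_sets[OF N]
  have V: "w \<in> V0 A" using w(1) by (simp add: eigen_weights_def)
  have nn: "mat_pow H m w i a \<ge> 0" for m i a using V0_nonneg[OF V] by (intro mat_pow_nonneg) auto
  have lim: "(\<lambda>m. ennreal (mat_pow H m w (length u) (end_symbol H u))) \<longlonglongrightarrow> emeasure N (thin_cylinder H u)"
    if u: "finite_path H u" "u \<noteq> []" for u
  proof -
    let ?C = "\<lambda>m. thin_cylinder H u \<inter> tails_in A (length u + m)"
    have "range ?C \<subseteq> sets N" using sets_thin_cylinder[OF H] sets_tails_in s by blast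
    moreover have "incseq ?C" by (auto simp: incseq_def tails_in_def)
    ultimately have "(\<lambda>m. emeasure N (?C m)) \<longlonglongrightarrow> emeasure N (\<Union>m. ?C m)"
      by (rule Lim_emeasure_incseq)
    also have "(\<Union>m. ?C m) = thin_cylinder H u \<inter> tower_paths H A"
    proof (intro set_eqI iffI)
      fix x assume "x \<in> (\<Union>m. ?C m)"
      then obtain m where m: "x \<in> thin_cylinder H u" "x \<in> tails_in A (length u + m)" by blast
      then have "x \<in> stage_paths H A (length u + m)"
        using thin_cylinder_subset[of H u] by (auto simp: stage_paths_def tails_in_def)
      then show "x \<in> thin_cylinder H u \<inter> tower_paths H A" using m(1) by (auto simp: tower_paths_def)
    next
      fix x assume x: "x \<in> thin_cylinder H u \<inter> tower_paths H A"
      then obtain m where "\<And>j. j > m \<Longrightarrow> x j \<in> edges A j" by (auto simp: tower_paths_def stage_paths_def)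
      then have "x \<in> ?C (Suc m)" using x by (auto simp: tails_in_def)
      then show "x \<in> (\<Union>m. ?C m)" by blast
    qed
    also have "emeasure N (thin_cylinder H u \<inter> tower_paths H A) = emeasure N (thin_cylinder H u)"
      by (rule emeasure_Int_conull[OF _ _ _ conull thin_cylinder_subset])
        (simp_all add: s sets_thin_cylinder[OF H] sets_tower_paths[OF H] sets_paths[OF H])
    finally show ?thesis using mat_pow_eq_emeasure[OF H A AH N w(1) u] by simp
  qed
  show ?thesis
  proof
    assume d: "distinguished H A w"
    let ?F = "{u. finite_path H u \<and> length u = 1}"
    have "emeasure N (thin_cylinder H u) < \<infinity>" if u: "u \<in> ?F" for u
    proof -
      have u': "finite_path H u" "u \<noteq> []" using u by auto
      have "end_symbol H u \<in> alph H (length u)" by (rule end_symbol_alph[OF H u'])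
      then obtain r where "(\<lambda>m. mat_pow H m w (length u) (end_symbol H u)) \<longlonglongrightarrow> r"
        using d unfolding distinguished_def convergent_def by blast
      then have "(\<lambda>m. ennreal (mat_pow H m w (length u) (end_symbol H u))) \<longlonglongrightarrow> ennreal r"
        by (rule tendsto_ennrealI)
      then have "emeasure N (thin_cylinder H u) = ennreal r" using lim[OF u'] LIMSEQ_unique by blast
      then show ?thesis by simp
    qed
    then have "(\<Sum>u\<in>?F. emeasure N (thin_cylinder H u)) < \<infinity>"
      using finite_finite_paths[OF H, of 1] by simp
    moreover have "emeasure N (\<Union>u\<in>?F. thin_cylinder H u) \<le> (\<Sum>u\<in>?F. emeasure N (thin_cylinder H u))"
      using finite_finite_paths[OF H, of 1] sets_thin_cylinder[OF H] s
      by (intro emeasure_subadditive_finite) auto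
    ultimately show "emeasure N (paths H) < \<infinity>"
      unfolding paths_eq_cylinders[of H 1] by (rule order_le_less_trans[rotated])
  next
    assume fin: "emeasure N (paths H) < \<infinity>"
    have conv: "convergent (\<lambda>m. mat_pow H m w (Suc i) a)" if a: "a \<in> alph H (Suc i)" for i a
    proof -
      obtain u where u: "finite_path H u" "length u = Suc i" "end_symbol H u = a"
        using finite_path_to_symbol[OF H _ a] by auto
      then have u0: "u \<noteq> []" by auto
      have "emeasure N (thin_cylinder H u) \<le> emeasure N (paths H)"
        using sets_paths[OF H] s by (intro emeasure_mono thin_cylinder_subset) simp
      then obtain r where r: "r \<ge> 0" "emeasure N (thin_cylinder H u) = ennreal r"
        using fin by (metis ennreal_cases infinity_ennreal_def order_le_less_trans less_irrefl)
      have "(\<lambda>m. mat_pow H m w (Suc i) a) \<longlonglongrightarrow> r"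
        using lim[OF u(1) u0] u r nn by (intro tendsto_ennrealD) auto
      then show ?thesis by (rule convergentI)
    qed
    \<comment> \<open>No path ends at level 0, but the sequences there are combinations of those of level 1.\<close>
    have "convergent (\<lambda>m. mat_pow H m w 0 a)" for a
    proof -
      have "convergent (\<lambda>m. mat_pow H (Suc m) w 0 a)"
        unfolding mat_pow_Suc by (intro convergent_sum convergent_mult convergent_const conv)
      then show ?thesis by (rule iffD1[OF convergent_Suc_iff])
    qed
    then have "convergent (\<lambda>m. mat_pow H m w i a)" if "a \<in> alph H i" for i a
      using conv that by (cases i) auto
    then show "distinguished H A w" unfolding distinguished_def using w(2) by blast
  qed
qed

section \<open>Restrictions of an ergodic measure on a tower\<close>

text \<open>A path that stays in \<open>M\<close> from some level on and agrees with a path of \<open>M\<close> before that level is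
  a path of \<open>M\<close>; hence the path space of \<open>M\<close> is open in the tower over it.\<close>

lemma openin_path_top_imp_tower:
  assumes MH: "M \<preceq> H" and U: "openin (path_top M) U" shows "openin (tower_top H M) U"
  unfolding openin_tower_iff
proof (intro conjI allI ballI)
  have VM: "U \<subseteq> paths M" using U by (simp add: openin_path_top)
  then have "U \<subseteq> stage_paths H M 0" using nested_paths[OF MH] by (auto simp: stage_paths_def paths_edge)
  then show "U \<subseteq> tower_paths H M" by (auto simp: tower_paths_def)
  fix m x assume x: "x \<in> U \<inter> stage_paths H M m"
  then obtain k where k: "\<And>y. y \<in> paths M \<Longrightarrow> \<forall>i<k. y i = x i \<Longrightarrow> y \<in> U"
    using U unfolding openin_path_top by blast
  have "y \<in> U" if y: "y \<in> stage_paths H M m" "\<forall>i<max k (Suc m). y i = x i" for y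
  proof (rule k)
    have "y i \<in> edges M i" for i
    proof (cases "i > m")
      case True
      then show ?thesis using y(1) by (simp add: stage_paths_def)
    next
      case False
      then have "y i = x i" using y(2) by simp
      moreover have "x \<in> paths M" using x VM by blast
      ultimately show ?thesis using paths_edge by metis
    qed
    then show "y \<in> paths M" using y(1) nested_paths_iff[OF MH] by (simp add: stage_paths_def)
  qed (use y in auto)
  then show "\<exists>n. \<forall>y\<in>stage_paths H M m. (\<forall>i<n. y i = x i) \<longrightarrow> y \<in> U" by blast
qed

lemma openin_tower_imp_path_top:
  assumes MH: "M \<preceq> H" and U: "openin (tower_top H M) U" and pq: "swappable H p q"
  shows "openin (path_top M) (moved H q p U \<inter> paths M)"
  unfolding openin_path_top
proof (intro conjI ballI)
  have l: "length p = length q" using pq by (simp add: swappable_def)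
  have stage: "replace_start q x \<in> stage_paths H M (length q)"
    if x: "x \<in> paths M" "x \<in> thin_cylinder H p" for x
    using replace_start_in_cylinder[OF pq x(2)] thin_cylinder_subset[of H q] paths_edge[OF x(1)]
    by (auto simp: stage_paths_def replace_start_def)
  fix x assume "x \<in> moved H q p U \<inter> paths M"
  then have x: "x \<in> thin_cylinder H p" "replace_start q x \<in> U" "x \<in> paths M" by (auto simp: moved_def)
  then obtain n where n: "\<And>y. y \<in> stage_paths H M (length q) \<Longrightarrow> \<forall>i<n. y i = replace_start q x i \<Longrightarrow> y \<in> U"
    using U stage[OF x(3,1)] unfolding openin_tower_iff by blast
  have "y \<in> moved H q p U \<inter> paths M" if y: "y \<in> paths M" "\<forall>i<max n (length p). y i = x i" for y
  proof -
    have c: "y \<in> thin_cylinder H p"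
      using x(1) y nested_paths[OF MH y(1)] by (auto simp: thin_cylinder_def)
    have "\<forall>i<n. replace_start q y i = replace_start q x i" using y(2) by (simp add: replace_start_def)
    then have "replace_start q y \<in> U" by (rule n[OF stage[OF y(1) c]])
    then show ?thesis using c y(1) by (simp add: moved_def)
  qed
  then show "\<exists>n. \<forall>y\<in>paths M. (\<forall>i<n. y i = x i) \<longrightarrow> y \<in> moved H q p U \<inter> paths M" by blast
qed simp

lemma positive_cylinder:
  assumes D: "bratteli D" and s: "sets N = sets seq_space" and U: "openin (path_top D) U" "emeasure N U > 0"
  shows "\<exists>u. finite_path D u \<and> u \<noteq> [] \<and> thin_cylinder D u \<subseteq> U \<and> emeasure N (thin_cylinder D u) > 0"
proof (rule ccontr)
  assume n: "\<not> ?thesis"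
  let ?C = "{u. finite_path D u \<and> length u \<ge> 1 \<and> thin_cylinder D u \<subseteq> U}"
  have "(\<Union>u\<in>?C. thin_cylinder D u) \<in> null_sets N"
  proof (rule null_sets_UN')
    show "countable ?C" by (rule countable_subset[OF _ countable_finite_paths[OF D]]) blast
    fix u assume u: "u \<in> ?C"
    then have "u \<noteq> []" by auto
    then have "emeasure N (thin_cylinder D u) = 0" using n u by auto
    then show "thin_cylinder D u \<in> null_sets N" using sets_thin_cylinder[OF D] s by (simp add: null_sets_def)
  qed
  then have "U \<in> null_sets N" unfolding path_top_open_cylinders[OF U(1), of 1, symmetric] .
  then show False using U(2) null_setsD1 by fastforce
qed

text \<open>For the intersection of \<open>A\<close> and \<open>M\<close> only the tails matter: some piece of the tower over \<open>M\<close>,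
  in which a finite path \<open>q\<close> is followed by a tail in \<open>M\<close>, meets the path space of \<open>A\<close> in positive
  measure; replacing \<open>q\<close> by a path \<open>p\<close> of \<open>M\<close> gives paths of \<open>M\<close> whose tails lie in \<open>A\<close>.\<close>

lemma common_subdiagram:
  assumes H: "bratteli H" and M: "bratteli M" and MH: "M \<preceq> H" and A: "bratteli A" and AH: "A \<preceq> H"
    and N: "swap_invariant H N" and off: "emeasure N (UNIV - tower_paths H M) = 0"
    and pos: "emeasure N (paths A) > 0" and fin: "emeasure N (paths A) < \<infinity>"
  shows "\<exists>A'. bratteli A' \<and> A' \<preceq> M \<and> (\<exists>n. \<forall>i\<ge>n. edges A' i \<subseteq> edges A i)
    \<and> emeasure N (paths A') > 0 \<and> emeasure N (paths A') < \<infinity>"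
proof -
  note s = swap_invariant_sets[OF N]
  let ?T = "tower_paths H M"
  have PA: "paths A \<in> sets seq_space" and PM: "paths M \<in> sets seq_space" and T: "?T \<in> sets seq_space"
    by (rule sets_paths[OF A], rule sets_paths[OF M], rule sets_tower_paths[OF H])
  let ?X = "paths A \<inter> ?T"
  have "emeasure N ?X = emeasure N (paths A)"
    by (rule emeasure_Int_conull[OF _ _ _ off]) (simp_all add: s PA T)
  then obtain p q where pq: "swappable H p q" and piece: "emeasure N (?X \<inter> moved H p q (paths M)) > 0"
    using saturation_piece_positive[OF H N PM, of ?X] PA T pos tower_eq_saturation[OF H M MH] by auto
  let ?Z = "?X \<inter> moved H p q (paths M)"
  have Z: "?Z \<in> sets seq_space" using PA T sets_moved[OF H PM] by blast
  have l: "length p = length q" and p0: "p \<noteq> []" using pq by (auto simp: swappable_def)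
  obtain y where y: "y \<in> ?Z" using piece by (metis all_not_in_conv emeasure_empty less_irrefl)
  define E where "E i = (if i < length p then {p ! i} else edges A i)" for i
  define A' where "A' = subdiagram M (alph M 0) E"
  have A': "bratteli A'" "A' \<preceq> M"
    unfolding A'_def by (rule bratteli_subdiagram[OF M], simp, rule subdiagram_nested[OF M], simp)
  have pA': "paths A' = {x \<in> paths M. \<forall>i. x i \<in> E i}"
    unfolding A'_def paths_subdiagram using bratteli_src[OF M] by (auto simp: paths_edge)
  have qA: "q ! i \<in> edges A i" if "i < length q" for i
  proof -
    have "y i = q ! i" using y that by (auto simp: moved_def thin_cylinder_def)
    moreover have "y \<in> paths A" using y by blast
    ultimately show ?thesis using paths_edge by metis
  qed
  have "moved H q p ?Z = paths A'"
  proof (intro set_eqI iffI)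
    fix x assume x: "x \<in> moved H q p ?Z"
    then have xp: "x \<in> thin_cylinder H p" "replace_start q x \<in> paths A" by (auto simp: moved_def)
    have "x \<in> moved H q p (moved H p q (paths M))" using x by (auto simp: moved_def)
    then have "x \<in> paths M" using moved_moved[OF pq] by blast
    moreover have "x i \<in> E i" for i
      using xp paths_edge[OF xp(2), of i] l by (auto simp: E_def thin_cylinder_def replace_start_def)
    ultimately show "x \<in> paths A'" using pA' by blast
  next
    fix x assume "x \<in> paths A'"
    then have x: "x \<in> paths M" "\<And>i. x i \<in> E i" using pA' by auto
    have "x i = p ! i" if "i < length p" for i using x(2)[of i] that by (simp add: E_def)
    then have xp: "x \<in> thin_cylinder H p"
      using nested_paths[OF MH x(1)] by (auto simp: thin_cylinder_def)
    have qx: "replace_start q x \<in> thin_cylinder H q" by (rule replace_start_in_cylinder[OF pq xp])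
    have "replace_start q x i \<in> edges A i" for i
      using qA[of i] x(2)[of i] l by (auto simp: replace_start_def E_def)
    then have "replace_start q x \<in> paths A"
      using nested_paths_iff[OF AH] qx thin_cylinder_subset[of H q] by blast
    moreover have inverse: "replace_start p (replace_start q x) = x" by (rule replace_start_inverse[OF xp l])
    then have m: "replace_start q x \<in> moved H p q (paths M)" using qx x(1) by (simp add: moved_def)
    then have "replace_start q x \<in> ?T"
      unfolding tower_eq_saturation[OF H M MH] saturation_eq_moved using pq by blast
    ultimately show "x \<in> moved H q p ?Z" using m xp by (simp add: moved_def)
  qed
  then have "emeasure N (paths A') = emeasure N (?Z \<inter> thin_cylinder H q)"
    using swap_invariant_moved[OF N swappable_sym[OF pq] Z] by simp
  also have "?Z \<inter> thin_cylinder H q = ?Z" using moved_subset[of H p q "paths M"] by blast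
  finally have e: "emeasure N (paths A') = emeasure N ?Z" .
  have "emeasure N ?Z \<le> emeasure N (paths A)" by (rule emeasure_mono) (use PA s in auto)
  then have "emeasure N (paths A') < \<infinity>" using e fin by simp
  moreover have "edges A' i \<subseteq> edges A i" if "i \<ge> length p" for i
    using that by (auto simp: A'_def subdiagram_def E_def)
  moreover have "emeasure N (paths A') > 0" using e piece by simp
  ultimately show ?thesis using A' by blast
qed

lemma is_eigen_measure_iff:
  assumes A: "bratteli A" and s: "sets N = sets seq_space"
  shows "is_eigen_measure A w (restrict_space N (paths A)) \<longleftrightarrow> w \<in> V A \<and> eigen_weights A w N"
proof -
  have "emeasure (restrict_space N (paths A)) (thin_cylinder A u) = emeasure N (thin_cylinder A u)" for u
    by (rule emeasure_restrict_trace[OF s sets_paths[OF A] thin_cylinder_subset])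
  then show ?thesis
    unfolding is_eigen_measure_def eigen_weights_def
    using sets_restrict_trace[OF s sets_paths[OF A]] sets_borel_path_top[OF A] by (auto simp: V_def)
qed

text \<open>Extremality is a statement about the measure on the path space of \<open>A\<close> alone, which inherits
  invariance and ergodicity from the larger diagram; finiteness concerns the whole tower.\<close>

lemma positive_finite_base:
  assumes H: "bratteli H" and A: "bratteli A" and AH: "A \<preceq> H"
    and N: "swap_invariant H N" and erg: "swap_ergodic H N"
    and pos: "emeasure N (paths A) > 0" and fin: "emeasure N (paths A) < \<infinity>"
    and conull: "emeasure N (paths H - tower_paths H A) = 0"
  shows "\<exists>!w. w \<in> ExtV A \<and> is_eigen_measure A w (restrict_space N (paths A))"
    and "is_eigen_measure A w (restrict_space N (paths A)) \<Longrightarrow>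
      emeasure N (paths H) < \<infinity> \<longleftrightarrow> distinguished H A w"
proof -
  note s = swap_invariant_sets[OF N] and P = sets_paths[OF A]
  let ?N = "ext_zero (restrict_space N (paths A))"
  have em: "emeasure ?N X = emeasure N (X \<inter> paths A)" if "X \<in> sets seq_space" for X
    by (rule emeasure_ext_restrict[OF s P that])
  have "emeasure ?N (thin_cylinder A u) = emeasure N (thin_cylinder A u)" for u
    using em[OF sets_thin_cylinder[OF A], of u] thin_cylinder_subset[of A u] by (simp add: Int_absorb2)
  then have ew: "eigen_weights A w ?N \<longleftrightarrow> eigen_weights A w N" for w by (simp add: eigen_weights_def)
  have N': "swap_invariant A ?N" by (rule swap_invariant_nested[OF A AH N])
  have erg': "swap_ergodic A ?N" by (rule swap_ergodic_nested[OF H A AH N erg])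
  have "(UNIV - paths A) \<inter> paths A = {}" by blast
  then have off: "emeasure ?N (UNIV - paths A) = 0"
    using em[OF sets.Diff[OF UNIV_in_seq_space P]] by simp
  have mass: "0 < emeasure ?N UNIV" "emeasure ?N UNIV < \<infinity>" using em[OF UNIV_in_seq_space] pos fin by simp_all
  have "emeasure ?N (paths A) < \<infinity>" using em[OF P] fin by simp
  then obtain w0 where w0: "eigen_weights A w0 ?N" using eigen_weights_exist[OF A N'] by blast
  have "w0 \<in> V A" using eigen_weights_V[OF A _ w0] em[OF P] pos by simp
  moreover have "w0 \<in> ExtV A" by (rule eigen_extremal[OF A N' erg' off mass w0])
  ultimately show "\<exists>!w. w \<in> ExtV A \<and> is_eigen_measure A w (restrict_space N (paths A))"
    unfolding is_eigen_measure_iff[OF A s] using w0 ew eigen_weights_unique[OF A] by blast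
  assume "is_eigen_measure A w (restrict_space N (paths A))"
  then show "emeasure N (paths H) < \<infinity> \<longleftrightarrow> distinguished H A w"
    unfolding is_eigen_measure_iff[OF A s] using distinguished_iff_finite[OF H A AH N _ _ conull] by blast
qed

theorem theorem5p6:
  fixes H M :: "('a, 'e) diagram"
    and \<nu> :: "(nat \<Rightarrow> 'e) measure"
  assumes "bratteli H" and "bratteli M" and "M \<preceq> H"
    and "bounded_alphabet H"
    and "ergodic_invariant_measure H (tower_top H M) \<nu>"
    and "0 < emeasure \<nu> (space \<nu>)"
  shows
    "(ergodic_invariant_measure M (path_top M) (restr M \<nu>)
        \<and> 0 < emeasure (restr M \<nu>) (paths M)
        \<and> tower_extension H M (restr M \<nu>) = \<nu>
        \<and> ((\<exists>U. openin (tower_top H M) U \<and> positive_finite_on \<nu> U) \<longleftrightarrow>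
            (\<exists>U. openin (path_top M) U \<and> positive_finite_on (restr M \<nu>) U))
        \<and> ((\<exists>U. openin (tower_top H M) U \<and> positive_finite_on \<nu> U) \<longrightarrow>
            (\<exists>A. bratteli A \<and> primitive A \<and> A \<preceq> M
               \<and> positive_finite_on (restr A \<nu>) (paths A)
               \<and> is_tower_measure_over H A (restr A \<nu>) \<nu>)))
     \<and>
     (\<forall>A. bratteli A \<and> A \<preceq> H \<and> positive_finite_on (restr A \<nu>) (paths A) \<longrightarrow>
        (\<exists>A'. bratteli A' \<and> A' \<preceq> M \<and> (\<exists>n. \<forall>i\<ge>n. edges A' i \<subseteq> edges A i)
            \<and> positive_finite_on (restr A' \<nu>) (paths A'))
        \<and> (\<exists>!w. w \<in> ExtV A \<and> is_eigen_measure A w (restr A \<nu>))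
        \<and> (\<forall>w. w \<in> ExtV A \<and> is_eigen_measure A w (restr A \<nu>) \<longrightarrow>
              is_tower_measure_over H A (restr A \<nu>) \<nu>
              \<and> (emeasure \<nu> (space \<nu>) < \<infinity> \<longleftrightarrow> distinguished H A w))
        \<and> (\<exists>A0 w \<mu>. bratteli A0 \<and> primitive A0 \<and> A0 \<preceq> A \<and> w \<in> ExtV A0
              \<and> is_eigen_measure A0 w \<mu> \<and> is_tower_measure_over H A0 \<mu> \<nu>
              \<and> (emeasure \<nu> (space \<nu>) < \<infinity> \<longleftrightarrow> distinguished H A0 w)))"
proof -
  note H = assms(1) and M = assms(2) and MH = assms(3) and bd = assms(4)
  let ?T = "tower_paths H M"
  define N where "N = ext_zero \<nu>"
  have T: "?T \<in> sets seq_space" "saturation H ?T = ?T"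
    by (rule sets_tower_paths[OF H], rule saturation_tower[OF H M MH])
  note X = sets_borel_tower_top[OF H, of M]
  have \<nu>: "sets \<nu> = {B \<in> sets seq_space. B \<subseteq> ?T}" and N: "swap_invariant H N" and erg: "swap_ergodic H N"
    using assms(5) unfolding ergodic_invariant_measure_iff[OF H X T] N_def X by auto
  note s = swap_invariant_sets[OF N]
  have em: "emeasure N B = emeasure \<nu> (B \<inter> ?T)" if "B \<in> sets seq_space" for B
    unfolding N_def by (rule emeasure_ext_zero[OF T(1) \<nu> that])
  have TH: "?T \<subseteq> paths H" using T(2) saturation_subset by blast
  have "(UNIV - ?T) \<inter> ?T = {}" by blast
  then have off: "emeasure N (UNIV - ?T) = 0"
    using em[OF sets.Diff[OF UNIV_in_seq_space T(1)]] by simp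
  have total: "emeasure \<nu> (space \<nu>) = emeasure N (paths H)"
    using em[OF sets_paths[OF H]] TH space_trace[OF T(1) \<nu>] by (simp add: Int_absorb1)
  have restr: "restr A \<nu> = restrict_space N (paths A)" if "bratteli A" for A :: "('a, 'e) diagram"
    unfolding N_def by (rule restr_eq_restrict_space[OF that T(1) \<nu>])
  have pf: "positive_finite_on (restr A \<nu>) B \<longleftrightarrow> emeasure N B > 0 \<and> emeasure N B < \<infinity>"
    if "bratteli A" "B \<subseteq> paths A" for A :: "('a, 'e) diagram" and B
    unfolding positive_finite_on_def restr[OF that(1)]
    using emeasure_restrict_trace[OF s sets_paths[OF that(1)] that(2)] by simp
  have tower: "emeasure N (paths H - tower_paths H A) = 0" "is_tower_measure_over H A (restr A \<nu>) \<nu>"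
    if "bratteli A" "A \<preceq> H" "emeasure N (paths A) > 0" for A
    using is_tower_measure_over_restr[OF H that(1,2) T(1) \<nu>] N erg that(3) unfolding N_def by blast+
  have PM: "paths M \<in> sets seq_space" by (rule sets_paths[OF M])
  have MT: "paths M \<subseteq> ?T"
    unfolding tower_eq_saturation[OF H M MH] using nested_paths[OF MH] by (intro subset_saturation) blast

  have "emeasure N ?T = emeasure \<nu> (space \<nu>)" using em[OF T(1)] space_trace[OF T(1) \<nu>] by simp
  then have posM: "emeasure N (paths M) > 0"
    using assms(6) saturation_null[OF H N PM] tower_eq_saturation[OF H M MH]
    by (metis gr_zeroI less_irrefl)

  have 1: "ergodic_invariant_measure M (path_top M) (restr M \<nu>)"
  proof -
    have "saturation M (paths M) = paths M" using saturation_subset subset_saturation by blast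
    moreover have "sets (borel_of (path_top M)) = {B \<in> sets seq_space. B \<subseteq> paths M}"
      by (rule sets_borel_path_top[OF M])
    ultimately show ?thesis
      using ergodic_invariant_measure_iff[OF M _ PM, of "path_top M"] sets_restrict_trace[OF s PM]
        swap_invariant_nested[OF M MH N] swap_ergodic_nested[OF H M MH N erg] restr[OF M] by simp
  qed
  have 2: "0 < emeasure (restr M \<nu>) (paths M)"
    using posM emeasure_restrict_trace[OF s PM, of "paths M"] restr[OF M] by simp
  have 3: "tower_extension H M (restr M \<nu>) = \<nu>"
    using tower_extension_restrict[OF H M MH N] restr[OF M] restrict_ext_zero[OF T(1) \<nu>] by (simp add: N_def)

  have open_sets: "U \<in> sets seq_space" if "openin (tower_top H M) U" for U
  proof -
    have "U \<in> sets (borel_of (tower_top H M))" using that by (auto simp: sets_borel_of)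
    then show ?thesis unfolding X by simp
  qed
  have 4: "(\<exists>U. openin (tower_top H M) U \<and> positive_finite_on \<nu> U) \<longleftrightarrow>
      (\<exists>V. openin (path_top M) V \<and> positive_finite_on (restr M \<nu>) V)"
  proof
    assume "\<exists>U. openin (tower_top H M) U \<and> positive_finite_on \<nu> U"
    then obtain U where U: "openin (tower_top H M) U" "positive_finite_on \<nu> U" by blast
    have UT: "U \<subseteq> ?T" "U \<in> sets seq_space" using U(1) openin_tower_iff open_sets by blast+
    then have NU: "emeasure N U > 0" "emeasure N U < \<infinity>"
      using em[of U] U(2) by (auto simp: positive_finite_on_def Int_absorb2)
    then obtain p q where pq: "swappable H p q" and pos: "emeasure N (U \<inter> moved H p q (paths M)) > 0"
      using saturation_piece_positive[OF H N PM UT(2)] UT(1) tower_eq_saturation[OF H M MH] by auto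
    let ?Z = "U \<inter> moved H p q (paths M)" and ?V = "moved H q p U \<inter> paths M"
    have Z: "?Z \<in> sets seq_space" using UT(2) sets_moved[OF H PM] by blast
    have "moved H q p ?Z = moved H q p U \<inter> moved H q p (moved H p q (paths M))" by (auto simp: moved_def)
    also have "\<dots> = ?V" using moved_moved[OF pq, of "paths M"] moved_subset[of H q p U] by blast
    finally have "emeasure N ?V = emeasure N (?Z \<inter> thin_cylinder H q)"
      using swap_invariant_moved[OF N swappable_sym[OF pq] Z] by simp
    also have "?Z \<inter> thin_cylinder H q = ?Z" using moved_subset[of H p q "paths M"] by blast
    finally have NV: "emeasure N ?V = emeasure N ?Z" .
    have "emeasure N ?Z \<le> emeasure N U" by (rule emeasure_mono) (use UT(2) s in auto)
    then have "positive_finite_on (restr M \<nu>) ?V"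
      using pf[OF M, of ?V] NV pos NU(2) by simp
    then show "\<exists>V. openin (path_top M) V \<and> positive_finite_on (restr M \<nu>) V"
      using openin_tower_imp_path_top[OF MH U(1) pq] by blast
  next
    assume "\<exists>V. openin (path_top M) V \<and> positive_finite_on (restr M \<nu>) V"
    then obtain V where V: "openin (path_top M) V" "positive_finite_on (restr M \<nu>) V" by blast
    have VM: "V \<subseteq> paths M" using V(1) by (simp add: openin_path_top)
    have "emeasure N V = emeasure \<nu> V"
      using em[OF open_path_top_sets[OF M V(1)]] VM MT by (simp add: Int_absorb2)
    then have "positive_finite_on \<nu> V" using V(2) pf[OF M VM] by (simp add: positive_finite_on_def)
    then show "\<exists>U. openin (tower_top H M) U \<and> positive_finite_on \<nu> U"
      using openin_path_top_imp_tower[OF MH V(1)] by blast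
  qed

  have core: "\<exists>A. bratteli A \<and> primitive A \<and> A \<preceq> D \<and> A \<preceq> H \<and> 0 < emeasure N (paths A) \<and> emeasure N (paths A) < \<infinity>"
    if "bratteli D" "D \<preceq> H" "emeasure N (paths D) > 0" "emeasure N (paths D) < \<infinity>" for D
    using primitive_core[OF bd H N that] nested_trans[OF _ that(2)] by blast

  have 5: "(\<exists>U. openin (tower_top H M) U \<and> positive_finite_on \<nu> U) \<longrightarrow>
      (\<exists>A. bratteli A \<and> primitive A \<and> A \<preceq> M \<and> positive_finite_on (restr A \<nu>) (paths A)
        \<and> is_tower_measure_over H A (restr A \<nu>) \<nu>)"
    unfolding 4
  proof (intro impI, elim exE conjE)
    fix V assume V: "openin (path_top M) V" "positive_finite_on (restr M \<nu>) V"
    have VM: "V \<subseteq> paths M" using V(1) by (simp add: openin_path_top)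
    have NV: "emeasure N V > 0" "emeasure N V < \<infinity>" using V(2) pf[OF M VM] by auto
    obtain u where u: "finite_path M u" "u \<noteq> []" "thin_cylinder M u \<subseteq> V" "emeasure N (thin_cylinder M u) > 0"
      using positive_cylinder[OF M s V(1) NV(1)] by blast
    have "emeasure N (thin_cylinder M u) \<le> emeasure N V"
      using open_path_top_sets[OF M V(1)] s u(3) by (intro emeasure_mono) auto
    then have finu: "emeasure N (thin_cylinder M u) < \<infinity>" using NV(2) by simp
    \<comment> \<open>The part of \<open>M\<close> below \<open>u\<close> is again a diagram, with path space \<open>[u]\<close>.\<close>
    define D where "D = subdiagram M (alph M 0) (\<lambda>i. if i < length u then {u ! i} else UNIV)"
    have D: "bratteli D" "D \<preceq> M"
      unfolding D_def by (rule bratteli_subdiagram[OF M], simp, rule subdiagram_nested[OF M], simp)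
    have "paths D = thin_cylinder M u"
      unfolding D_def paths_subdiagram thin_cylinder_def
      using bratteli_src[OF M] by (auto simp: paths_edge split: if_splits)
    then obtain A where A: "bratteli A" "primitive A" "A \<preceq> D" "A \<preceq> H" "0 < emeasure N (paths A)"
      "emeasure N (paths A) < \<infinity>"
      using core[OF D(1) nested_trans[OF D(2) MH]] u(4) finu by auto
    then show "\<exists>A. bratteli A \<and> primitive A \<and> A \<preceq> M \<and> positive_finite_on (restr A \<nu>) (paths A)
        \<and> is_tower_measure_over H A (restr A \<nu>) \<nu>"
      using nested_trans[OF A(3) D(2)] pf[OF A(1) order_refl] tower(2)[OF A(1,4,5)] by blast
  qed

  have 6: "(\<exists>A'. bratteli A' \<and> A' \<preceq> M \<and> (\<exists>n. \<forall>i\<ge>n. edges A' i \<subseteq> edges A i)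
            \<and> positive_finite_on (restr A' \<nu>) (paths A'))
        \<and> (\<exists>!w. w \<in> ExtV A \<and> is_eigen_measure A w (restr A \<nu>))
        \<and> (\<forall>w. w \<in> ExtV A \<and> is_eigen_measure A w (restr A \<nu>) \<longrightarrow>
              is_tower_measure_over H A (restr A \<nu>) \<nu>
              \<and> (emeasure \<nu> (space \<nu>) < \<infinity> \<longleftrightarrow> distinguished H A w))
        \<and> (\<exists>A0 w \<mu>. bratteli A0 \<and> primitive A0 \<and> A0 \<preceq> A \<and> w \<in> ExtV A0
              \<and> is_eigen_measure A0 w \<mu> \<and> is_tower_measure_over H A0 \<mu> \<nu>
              \<and> (emeasure \<nu> (space \<nu>) < \<infinity> \<longleftrightarrow> distinguished H A0 w))"
    if A: "bratteli A" "A \<preceq> H" "positive_finite_on (restr A \<nu>) (paths A)" for A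
  proof -
    have NA: "emeasure N (paths A) > 0" "emeasure N (paths A) < \<infinity>"
      using A(3) pf[OF A(1) order_refl] by auto
    have common: "\<exists>A'. bratteli A' \<and> A' \<preceq> M \<and> (\<exists>n. \<forall>i\<ge>n. edges A' i \<subseteq> edges A i)
        \<and> positive_finite_on (restr A' \<nu>) (paths A')"
      using common_subdiagram[OF H M MH A(1,2) N off NA] pf[OF _ order_refl] by blast
    have base: "\<exists>!w. w \<in> ExtV B \<and> is_eigen_measure B w (restr B \<nu>)"
      "is_eigen_measure B w (restr B \<nu>) \<Longrightarrow> emeasure \<nu> (space \<nu>) < \<infinity> \<longleftrightarrow> distinguished H B w"
      if B: "bratteli B" "B \<preceq> H" "emeasure N (paths B) > 0" "emeasure N (paths B) < \<infinity>" for B w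
      using positive_finite_base[OF H B(1,2) N erg B(3,4) tower(1)[OF B(1,2,3)]]
      unfolding restr[OF B(1)] total by blast+
    obtain A0 where A0: "bratteli A0" "primitive A0" "A0 \<preceq> A" "A0 \<preceq> H" "0 < emeasure N (paths A0)"
      "emeasure N (paths A0) < \<infinity>"
      using core[OF A(1,2) NA] by blast
    obtain w where w: "w \<in> ExtV A0" "is_eigen_measure A0 w (restr A0 \<nu>)"
      using base(1)[OF A0(1,4,5,6)] by blast
    show ?thesis
    proof (rule conjI[OF common conjI[OF base(1)[OF A(1,2) NA] conjI]])
      show "\<forall>w. w \<in> ExtV A \<and> is_eigen_measure A w (restr A \<nu>) \<longrightarrow>
          is_tower_measure_over H A (restr A \<nu>) \<nu> \<and> (emeasure \<nu> (space \<nu>) < \<infinity> \<longleftrightarrow> distinguished H A w)"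
        using base(2)[OF A(1,2) NA] tower(2)[OF A(1,2) NA(1)] by blast
    qed (intro exI conjI, rule A0(1), rule A0(2), rule A0(3), rule w(1), rule w(2), rule tower(2)[OF A0(1,4,5)],
        rule base(2)[OF A0(1,4,5,6) w(2)])
  qed
  show ?thesis
    by (rule conjI[OF conjI[OF 1 conjI[OF 2 conjI[OF 3 conjI[OF 4 5]]]]], intro allI impI, elim conjE, rule 6)
qed

end
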